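(* Let $Z$ be a generalized random field on a probability space $(\Omega,\mathfrak A,\mathsf P)$ indexed by $\mathscr S(\mathbb R^d)$ which is $|||\cdot|||$-continuous. Assume that the unique $|||\cdot|||$-continuous linear extension of $Z$ to $L^1(\mathbb R^d)\cap L^2(\mathbb R^d)$ satisfies $Z(f)\in L^1(\Omega,\mathfrak A,\mathsf P)$ for all $f\in L^1(\mathbb R^d)\cap L^2(\mathbb R^d)$. Then the following are equivalent: (i) $Z$ is a Lévy noise field; (ii) $Z$ is a stationary noise field.
   Context: $\mathscr S=\mathscr S(\mathbb R^d)$ is the space of real-valued Schwartz functions with its standard Fréchet topology. $L^0(\Omega,\mathfrak A,\mathsf P)$ is the space of real random variables (modulo a.s. equality) with the topology of convergence in probability. A generalized random field indexed by $\mathscr S$ is a map $Z:\mathscr S\to L^0(\Omega,\mathfrak A,\mathsf P)$ which is linear ($Z(\alpha f+\beta g)=\alpha Z(f)+\beta Z(g)$ a.s.) and continuous ($f\to f_0$ in $\mathscr S$ implies $Z(f)\to Z(f_0)$ in probability). For $f\in L^1\cap L^2(\mathbb R^d)$ put $|||f|||:=(\|f\|_{L^1(\mathbb R^d)}^2+\|f\|_{L^2(\mathbb R^d)}^2)^{1/2}$; $Z$ is $|||\cdot|||$-continuous if $|||f_n-f|||\to0$ ($f_n,f\in\mathscr S$) implies $Z(f_n)\to Z(f)$ in probability; since $\mathscr S$ is $|||\cdot|||$-dense in $L^1\cap L^2(\mathbb R^d)$, such a $Z$ has a unique $|||\cdot|||$-continuous linear extension to $L^1\cap L^2(\mathbb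 R^d)$. A characteristic triplet is $(b,\sigma^2,\nu)$ with $b\in\mathbb R$, $\sigma^2\ge0$, $\nu$ a $\sigma$-finite Borel measure on $\mathbb R\setminus\{0\}$ with $\int\min\{1,s^2\}\,\nu(\mathrm ds)<\infty$; its Lévy characteristic is $\psi(t)=ibt-\frac{\sigma^2t^2}{2}+\int_{\mathbb R\setminus\{0\}}(e^{its}-1-its\mathbf 1_{\{|s|\le1\}}(s))\,\nu(\mathrm ds)$. $Z$ is a Lévy noise field if for some characteristic triplet, $\psi\circ f\in L^1(\mathbb R^d)$ and $\mathbb E[e^{iZ(f)}]=\exp(\int_{\mathbb R^d}\psi(f(x))\,\mathrm dx)$ for all $f\in\mathscr S$. $Z$ is a noise field if for all $f_1,\dots,f_n\in\mathscr S$ with mutually disjoint supports, $Z(f_1),\dots,Z(f_n)$ are independent; $Z$ is stationary if $Z(f)$ and $Z(f(\cdot-a))$ have the same distribution for all $f\in\mathscr S$, $a\in\mathbb R^d$; a stationary noise field is both. *)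

theory Defs
  imports "HOL-Probability.Probability"
begin

fun iter_partial :: "'a::euclidean_space list \<Rightarrow> ('a \<Rightarrow> real) \<Rightarrow> ('a \<Rightarrow> real)" where
  "iter_partial [] f = f"
| "iter_partial (v # vs) f = (\<lambda>x. frechet_derivative (iter_partial vs f) (at x) v)"

definition schwartz :: "('a::euclidean_space \<Rightarrow> real) set" where
  "schwartz = {f. (\<forall>vs. set vs \<subseteq> Basis \<longrightarrow>
        (\<forall>x. iter_partial vs f differentiable (at x)) \<and>
        (\<forall>k::nat. \<exists>C. \<forall>x. (1 + norm x) ^ k * \<bar>iter_partial vs f x\<bar> \<le> C))}"

definition schwartz_conv :: "(nat \<Rightarrow> ('a::euclidean_space \<Rightarrow> real)) \<Rightarrow> ('a \<Rightarrow> real) \<Rightarrow> bool" where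
  "schwartz_conv fs f \<longleftrightarrow> (\<forall>vs. set vs \<subseteq> Basis \<longrightarrow> (\<forall>k::nat.
      ((\<lambda>n. SUP x. (1 + norm x) ^ k * \<bar>iter_partial vs (\<lambda>y. fs n y - f y) x\<bar>) \<longlonglongrightarrow> 0)))"

definition L12 :: "('a::euclidean_space \<Rightarrow> real) set" where
  "L12 = {f. integrable lborel f \<and> integrable lborel (\<lambda>x. (f x)\<^sup>2)}"

definition triple_norm :: "('a::euclidean_space \<Rightarrow> real) \<Rightarrow> real" where
  "triple_norm f = sqrt ((LINT x|lborel. \<bar>f x\<bar>)\<^sup>2 + (LINT x|lborel. (f x)\<^sup>2))"

definition conv_in_prob :: "'w measure \<Rightarrow> (nat \<Rightarrow> 'w \<Rightarrow> real) \<Rightarrow> ('w \<Rightarrow> real) \<Rightarrow> bool" where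
  "conv_in_prob M X Y \<longleftrightarrow> (\<forall>e>0.
     ((\<lambda>n. measure M {\<omega> \<in> space M. e < \<bar>X n \<omega> - Y \<omega>\<bar>}) \<longlonglongrightarrow> 0))"

definition gen_random_field :: "'w measure \<Rightarrow> (('a::euclidean_space \<Rightarrow> real) \<Rightarrow> 'w \<Rightarrow> real) \<Rightarrow> bool" where
  "gen_random_field M Z \<longleftrightarrow>
     (\<forall>f\<in>schwartz. Z f \<in> borel_measurable M) \<and>
     (\<forall>f\<in>schwartz. \<forall>g\<in>schwartz. \<forall>\<alpha> \<beta> :: real.
        AE \<omega> in M. Z (\<lambda>x. \<alpha> * f x + \<beta> * g x) \<omega> = \<alpha> * Z f \<omega> + \<beta> * Z g \<omega>) \<and>
     (\<forall>fs f. (\<forall>n. fs n \<in> schwartz) \<longrightarrow> f \<in> schwartz \<longrightarrow> schwartz_conv fs f \<longrightarrow>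
        conv_in_prob M (\<lambda>n. Z (fs n)) (Z f))"

definition triple_continuous :: "'w measure \<Rightarrow> (('a::euclidean_space \<Rightarrow> real) \<Rightarrow> 'w \<Rightarrow> real) \<Rightarrow> ('a \<Rightarrow> real) set \<Rightarrow> bool" where
  "triple_continuous M Z D \<longleftrightarrow>
     (\<forall>fs f. (\<forall>n. fs n \<in> D) \<longrightarrow> f \<in> D \<longrightarrow>
        ((\<lambda>n. triple_norm (\<lambda>x. fs n x - f x)) \<longlonglongrightarrow> 0) \<longrightarrow>
        conv_in_prob M (\<lambda>n. Z (fs n)) (Z f))"

definition triple_extension :: "'w measure \<Rightarrow> (('a::euclidean_space \<Rightarrow> real) \<Rightarrow> 'w \<Rightarrow> real)
     \<Rightarrow> (('a \<Rightarrow> real) \<Rightarrow> 'w \<Rightarrow> real) \<Rightarrow> bool" where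
  "triple_extension M Z Z' \<longleftrightarrow>
     (\<forall>f\<in>L12. Z' f \<in> borel_measurable M) \<and>
     (\<forall>f\<in>schwartz. AE \<omega> in M. Z' f \<omega> = Z f \<omega>) \<and>
     (\<forall>f\<in>L12. \<forall>g\<in>L12. \<forall>\<alpha> \<beta> :: real.
        AE \<omega> in M. Z' (\<lambda>x. \<alpha> * f x + \<beta> * g x) \<omega> = \<alpha> * Z' f \<omega> + \<beta> * Z' g \<omega>) \<and>
     triple_continuous M Z' L12"

text \<open>Characteristic triplet (b, sigma^2, nu); nu is a measure on the Borel sets of R
  with nu {0} = 0 (i.e. a measure on R \ {0}).\<close>
definition char_triplet :: "real \<Rightarrow> real \<Rightarrow> real measure \<Rightarrow> bool" where
  "char_triplet b s2 \<nu> \<longleftrightarrow> s2 \<ge> 0 \<and> sets \<nu> = sets borel \<and> emeasure \<nu> {0} = 0 \<and>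
     sigma_finite_measure \<nu> \<and> (\<integral>\<^sup>+ s. ennreal (min 1 (s\<^sup>2)) \<partial>\<nu>) < \<infinity>"

definition levy_char :: "real \<Rightarrow> real \<Rightarrow> real measure \<Rightarrow> real \<Rightarrow> complex" where
  "levy_char b s2 \<nu> t = \<i> * complex_of_real (b * t) - complex_of_real (s2 * t\<^sup>2 / 2)
     + (CLINT s|\<nu>. iexp (t * s) - 1 - \<i> * complex_of_real (t * s * indicator {-1..1} s))"

definition levy_noise_field :: "'w measure \<Rightarrow> (('a::euclidean_space \<Rightarrow> real) \<Rightarrow> 'w \<Rightarrow> real) \<Rightarrow> bool" where
  "levy_noise_field M Z \<longleftrightarrow> (\<exists>b s2 \<nu>. char_triplet b s2 \<nu> \<and>
     (\<forall>f\<in>schwartz. integrable lborel (\<lambda>x. levy_char b s2 \<nu> (f x)) \<and>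
        (CLINT \<omega>|M. iexp (Z f \<omega>)) = exp (CLINT x|lborel. levy_char b s2 \<nu> (f x))))"

definition fsupport :: "('a::topological_space \<Rightarrow> real) \<Rightarrow> 'a set" where
  "fsupport f = closure {x. f x \<noteq> 0}"

definition noise_field :: "'w measure \<Rightarrow> (('a::euclidean_space \<Rightarrow> real) \<Rightarrow> 'w \<Rightarrow> real) \<Rightarrow> bool" where
  "noise_field M Z \<longleftrightarrow> (\<forall>(n::nat) fs. (\<forall>i<n. fs i \<in> schwartz) \<longrightarrow>
     (\<forall>i<n. \<forall>j<n. i \<noteq> j \<longrightarrow> fsupport (fs i) \<inter> fsupport (fs j) = {}) \<longrightarrow>
     prob_space.indep_vars M (\<lambda>_. borel) (\<lambda>i. Z (fs i)) {..<n})"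

definition stationary_field :: "'w measure \<Rightarrow> (('a::euclidean_space \<Rightarrow> real) \<Rightarrow> 'w \<Rightarrow> real) \<Rightarrow> bool" where
  "stationary_field M Z \<longleftrightarrow> (\<forall>f\<in>schwartz. \<forall>a.
     distr M borel (Z f) = distr M borel (Z (\<lambda>x. f (x - a))))"

end

theory Submission
  imports Defs
begin

text \<open>
  A Levy noise field satisfies \<open>E exp (i Z f) = exp (\<integral> \<psi> \<circ> f)\<close>; since \<open>\<psi> 0 = 0\<close>, the right-hand side is
  multiplicative over functions with disjoint supports and translation invariant, and both properties
  pass to the distributions by uniqueness of characteristic functions.

  Conversely, approximating indicators of dyadic cubes of side \<open>2 ^ -k\<close> by smooth bumps shows that the
  extension \<open>Z'\<close> has, on step functions, characteristic functional \<open>\<Prod>\<^sub>a \<phi>\<^sub>k (c\<^sub>a)\<close>, where \<open>\<phi>\<^sub>k\<close> belongs to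
  one cube and \<open>\<phi>\<^sub>k = \<phi>\<^sub>k\<^sub>+\<^sub>1 ^ D\<close> with \<open>D = 2 ^ d\<close>. Continuity of \<open>Z'\<close> at \<open>0\<close> in the triple norm forces
  \<open>\<phi>\<^sub>k (t) ^ m\<close> to stay near \<open>1\<close> whenever \<open>m / D ^ k\<close> is at most a constant over \<open>\<bar>t\<bar> + t\<^sup>2\<close>. Hence
  \<open>\<psi> (t) = D ^ k Ln (\<phi>\<^sub>k t)\<close> does not depend on large \<open>k\<close>, is continuous and is \<open>O(\<bar>t\<bar> + t\<^sup>2)\<close>. Weak
  compactness of the measures \<open>D ^ k min 1 (s\<^sup>2) \<mu>\<^sub>k(ds)\<close> identifies \<open>\<psi>\<close> as a Levy characteristic, and
  dominated convergence extends the formula from step functions to Schwartz functions.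
\<close>

section \<open>Independence from characteristic functions\<close>

text \<open>Both field properties speak of Schwartz functions only, and neighbouring closed cubes
  touch. Hence the bumps: their closed supports lie in the open cubes, and they converge to the
  indicators in the triple norm.

  Powers are controlled by one computation. For \<open>m\<close> cubes of level \<open>k\<close>,
  common height \<open>t\<close> and total volume \<open>v = m / D ^ k\<close>, the squared triple
  norm is \<open>t^2 (v^2 + v)\<close>, while the characteristic functional is
  \<open>phi_k(t) ^ m\<close>. The L1 part of the norm produces the condition
  \<open>v < c / |t|\<close>, the L2 part \<open>v < c / t^2\<close>.

  Controlling all powers up to \<open>m\<close>, and not just one, is what makes logarithms usable:
  every partial power stays in the right half plane, so principal logarithms add up and
  \<open>phi_k(t)\<close> has no zero there. Large \<open>t\<close> require a fine level, which is
  why the exponent is built from levels depending on \<open>t\<close>.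

  Near \<open>0\<close> the growth bound on the exponent is linear. Averaged over
  \<open>[0, u]\<close> it bounds the rescaled moments of \<open>min 1 ((u s)^2)\<close> by a
  multiple of \<open>u\<close>: for \<open>u = 1\<close> this bounds the masses, for
  \<open>u = 1 / R\<close> the tails, and compactness follows.\<close>

lemma (in prob_space) Fourier_uniqueness_bounded_real:
  fixes X V :: "'a \<Rightarrow> real"
  assumes [measurable]: "X \<in> borel_measurable M" "V \<in> borel_measurable M"
    and bd: "\<And>x. \<bar>V x\<bar> \<le> B"
    and four: "\<And>t. (CLINT x|M. iexp (t * X x) * V x) = (CLINT x|M. iexp (t * X x)) * (LINT x|M. V x)"
    and [measurable]: "A \<in> sets borel"
  shows "(LINT x|M. indicator A (X x) * V x) = prob (X -` A \<inter> space M) * (LINT x|M. V x)"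
proof -
  have B0: "0 \<le> B" using bd[of undefined] by linarith
  \<comment> \<open>The factorization says that weighting by \<open>V\<close> does not change the
    law of \<open>X\<close>. To turn the signed weight into a probability density, \<open>V\<close>
    is shifted by \<open>B + 1\<close>: then \<open>W \<ge> 1\<close>, its mean \<open>c\<close> is
    at least \<open>1\<close>, and the law of \<open>X\<close> under \<open>W / c\<close> has the
    same characteristic function as under \<open>M\<close>.\<close>
  define W where "W = (\<lambda>x. V x + (B + 1))"
  have W[measurable]: "W \<in> borel_measurable M" unfolding W_def by measurable
  have Wge: "1 \<le> W x" for x using bd[of x] by (auto simp: W_def)
  have Wle: "W x \<le> 2 * B + 1" for x using bd[of x] by (auto simp: W_def)
  have iV[simp]: "integrable M V"
    by (rule integrable_const_bound[where B=B]) (use bd in auto)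
  have iW[simp]: "integrable M W" unfolding W_def by simp
  define c where "c = (LINT x|M. W x)"
  have c: "c = (LINT x|M. V x) + (B + 1)" unfolding c_def W_def by (simp add: prob_space)
  have "1 \<le> c"
  proof -
    have "(LINT x|M. 1) \<le> c" unfolding c_def by (rule integral_mono) (use Wge in auto)
    then show ?thesis by (simp add: prob_space)
  qed
  define D where "D = density M (\<lambda>x. ennreal (W x / c))"
  have D_emeasure: "emeasure D (space M) = 1"
  proof -
    have "emeasure D (space M) = (\<integral>\<^sup>+x. ennreal (W x / c) \<partial>M)"
      unfolding D_def by (subst emeasure_density) (auto intro!: nn_integral_cong simp: indicator_def)
    also have "\<dots> = ennreal (LINT x|M. W x / c)"
      using \<open>1 \<le> c\<close> by (intro nn_integral_eq_integral) (auto intro!: AE_I2 divide_nonneg_pos order_trans[OF zero_le_one Wge])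
    also have "(LINT x|M. W x / c) = 1" using \<open>1 \<le> c\<close> by (simp add: c_def)
    finally show ?thesis by simp
  qed
  interpret D: prob_space D by (rule prob_spaceI) (use D_emeasure in \<open>simp add: D_def\<close>)
  have XD[measurable]: "X \<in> borel_measurable D" unfolding D_def by simp
  have rd: "real_distribution (distr D borel X)" by (rule D.real_distribution_distr) simp
  have rm: "real_distribution (distr M borel X)" by (rule real_distribution_distr) simp
  have WD: "W x / c \<ge> 0" for x using Wge[of x] \<open>1 \<le> c\<close> by simp
  have iexp_int: "complex_integrable M (\<lambda>x. iexp (t * X x))" for t
    by (rule integrable_const_bound[where B=1]) auto
  have iexpV_int: "complex_integrable M (\<lambda>x. iexp (t * X x) * V x)" for t
    by (rule integrable_const_bound[where B=B]) (auto simp: norm_mult bd)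
  have "char (distr D borel X) = char (distr M borel X)"
  proof
    fix t
    have "char (distr D borel X) t = (CLINT x|D. iexp (t * X x))"
      unfolding char_def by (subst integral_distr) auto
    also have "\<dots> = (CLINT x|M. (W x / c) *\<^sub>R iexp (t * X x))"
      unfolding D_def by (subst integral_density) (auto simp: WD)
    also have "\<dots> = (CLINT x|M. (iexp (t * X x) * V x + iexp (t * X x) * (B + 1)) / c)"
      by (intro Bochner_Integration.integral_cong refl) (simp add: W_def scaleR_conv_of_real field_simps)
    also have "\<dots> = ((CLINT x|M. iexp (t * X x) * V x) + (CLINT x|M. iexp (t * X x)) * (B + 1)) / c"
      by (simp del: of_real_mult of_real_add add: iexp_int iexpV_int)
    also have "\<dots> = (CLINT x|M. iexp (t * X x)) * (complex_of_real c / c)"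
      unfolding four c by (simp add: field_simps)
    also have "\<dots> = char (distr M borel X) t"
      unfolding char_def using \<open>1 \<le> c\<close> by (subst integral_distr) auto
    finally show "char (distr D borel X) t = char (distr M borel X) t" .
  qed
  from Levy_uniqueness[OF rd rm this] have eq: "distr D borel X = distr M borel X" .
  have "(LINT x|distr D borel X. indicator A x) = (LINT x|M. (W x / c) * indicator A (X x))"
    by (subst integral_distr, simp, simp) (simp add: D_def integral_density WD)
  also have "\<dots> = (LINT x|M. (indicator A (X x) * V x + (B + 1) * indicator A (X x)) / c)"
    by (intro Bochner_Integration.integral_cong refl) (simp add: W_def field_simps)
  also have "\<dots> = ((LINT x|M. indicator A (X x) * V x) + (B + 1) * (LINT x|M. indicator A (X x))) / c"
  proof -
    have "integrable M (\<lambda>x. indicator A (X x) * V x)"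
      by (rule integrable_const_bound[where B=B]) (use bd B0 in \<open>auto simp: indicator_def\<close>)
    moreover have "integrable M (\<lambda>x. indicator A (X x) :: real)"
      by (rule integrable_const_bound[where B=1]) (auto simp: indicator_def)
    ultimately show ?thesis by simp
  qed
  finally have 1: "(LINT x|distr M borel X. indicator A x) * c =
     (LINT x|M. indicator A (X x) * V x) + (B + 1) * (LINT x|M. indicator A (X x))"
    using \<open>1 \<le> c\<close> by (simp add: eq field_simps)
  have 2: "(LINT x|distr M borel X. indicator A x :: real) = (LINT x|M. indicator A (X x))"
    by (rule integral_distr) auto
  have 3: "(LINT x|M. indicator A (X x) :: real) = prob (X -` A \<inter> space M)"
  proof -
    have "(\<lambda>x. indicator A (X x)) = (indicator (X -` A) :: 'a \<Rightarrow> real)" by (auto simp: indicator_def)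
    then show ?thesis by simp
  qed
  show ?thesis using 1 unfolding 2 3 c by (simp add: algebra_simps)
qed

text \<open>Reduction to the real case. Real parts cannot be taken in the hypothesis, because
  \<open>iexp\<close> is complex too; but conjugating it at \<open>-t\<close> yields the same
  identity for \<open>cnj W\<close> at \<open>t\<close>, and \<open>Re W\<close>,
  \<open>Im W\<close> are linear combinations of \<open>W\<close> and \<open>cnj W\<close>.\<close>

lemma (in prob_space) Fourier_uniqueness_bounded_complex:
  fixes X :: "'a \<Rightarrow> real" and W :: "'a \<Rightarrow> complex"
  assumes [measurable]: "X \<in> borel_measurable M" "W \<in> borel_measurable M"
    and bd: "\<And>x. cmod (W x) \<le> B"
    and four: "\<And>t. (CLINT x|M. iexp (t * X x) * W x) = (CLINT x|M. iexp (t * X x)) * (CLINT x|M. W x)"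
    and [measurable]: "A \<in> sets borel"
  shows "(CLINT x|M. indicator A (X x) * W x) = prob (X -` A \<inter> space M) * (CLINT x|M. W x)"
proof -
  have iW: "complex_integrable M W"
    by (rule integrable_const_bound[where B=B]) (use bd in auto)
  have iexp_W: "complex_integrable M (\<lambda>x. iexp (t * X x) * W x)" for t
    by (rule integrable_const_bound[where B=B]) (use bd in \<open>auto simp: norm_mult\<close>)
  have [measurable]: "(\<lambda>x. cnj (W x)) \<in> borel_measurable M"
    by (rule measurable_compose[OF assms(2) borel_measurable_continuous_onI]) (intro continuous_intros)
  have iexp_cW: "complex_integrable M (\<lambda>x. iexp (t * X x) * cnj (W x))" for t
    by (rule integrable_const_bound[where B=B]) (use bd in \<open>auto simp: norm_mult\<close>)
  have cnj: "(CLINT x|M. iexp (t * X x) * cnj (W x)) = (CLINT x|M. iexp (t * X x)) * (CLINT x|M. cnj (W x))" for t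
  proof -
    have "(CLINT x|M. iexp (t * X x) * cnj (W x)) = (CLINT x|M. cnj (iexp ((-t) * X x) * W x))"
      by (simp add: exp_cnj)
    also have "\<dots> = cnj (CLINT x|M. iexp ((-t) * X x) * W x)" by (rule Bochner_Integration.integral_cnj)
    also have "\<dots> = cnj (CLINT x|M. iexp ((-t) * X x)) * cnj (CLINT x|M. W x)" by (simp only: four complex_cnj_mult)
    also have "\<dots> = (CLINT x|M. cnj (iexp ((-t) * X x))) * (CLINT x|M. cnj (W x))" by (simp only: Bochner_Integration.integral_cnj)
    also have "\<dots> = (CLINT x|M. iexp (t * X x)) * (CLINT x|M. cnj (W x))"
      by (simp add: exp_cnj)
    finally show ?thesis .
  qed
  have re: "(CLINT x|M. iexp (t * X x) * Re (W x)) = (CLINT x|M. iexp (t * X x)) * (LINT x|M. Re (W x))" for t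
  proof -
    have "(CLINT x|M. iexp (t * X x) * Re (W x)) = (CLINT x|M. (iexp (t * X x) * W x + iexp (t * X x) * cnj (W x)) / 2)"
      by (intro Bochner_Integration.integral_cong refl) (simp add: complex_add_cnj flip: distrib_left)
    also have "\<dots> = (CLINT x|M. iexp (t * X x)) * (((CLINT x|M. W x) + cnj (CLINT x|M. W x)) / 2)"
      using iexp_W[of t] iexp_cW[of t] four[of t] cnj[of t] by (simp add: algebra_simps)
    also have "\<dots> = (CLINT x|M. iexp (t * X x)) * complex_of_real (LINT x|M. Re (W x))"
      using iW by (simp add: complex_add_cnj)
    finally show ?thesis .
  qed
  have i_sandwich: "\<i> * (z * \<i>) = - z" for z by (simp add: mult.commute[of z])
  have im: "(CLINT x|M. iexp (t * X x) * Im (W x)) = (CLINT x|M. iexp (t * X x)) * (LINT x|M. Im (W x))" for t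
  proof -
    have "(CLINT x|M. iexp (t * X x) * Im (W x)) = (CLINT x|M. (iexp (t * X x) * W x - iexp (t * X x) * cnj (W x)) / (2 * \<i>))"
      by (intro Bochner_Integration.integral_cong refl) (simp only: right_diff_distrib[symmetric] complex_diff_cnj, subst nonzero_eq_divide_eq, simp, simp add: mult_ac)
    also have "\<dots> = (CLINT x|M. iexp (t * X x)) * (((CLINT x|M. W x) - cnj (CLINT x|M. W x)) / (2 * \<i>))"
      using iexp_W[of t] iexp_cW[of t] four[of t] cnj[of t] by (simp add: algebra_simps)
    also have "\<dots> = (CLINT x|M. iexp (t * X x)) * complex_of_real (LINT x|M. Im (W x))"
      using iW by (simp add: complex_diff_cnj i_sandwich)
    finally show ?thesis .
  qed
  have R: "(LINT x|M. indicator A (X x) * Re (W x)) = prob (X -` A \<inter> space M) * (LINT x|M. Re (W x))"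
    by (rule Fourier_uniqueness_bounded_real[where B=B])
       (use re bd abs_Re_le_cmod order_trans in \<open>auto simp del: of_real_mult intro: order_trans\<close>)
  have I: "(LINT x|M. indicator A (X x) * Im (W x)) = prob (X -` A \<inter> space M) * (LINT x|M. Im (W x))"
    by (rule Fourier_uniqueness_bounded_real[where B=B])
       (use im bd abs_Im_le_cmod order_trans in \<open>auto simp del: of_real_mult intro: order_trans\<close>)
  have iA: "complex_integrable M (\<lambda>x. indicator A (X x) * W x)"
    by (rule integrable_const_bound[where B=B]) (use bd order_trans[OF norm_ge_zero bd] in \<open>auto simp: norm_mult indicator_def\<close>)
  show ?thesis
  proof (rule complex_eqI)
    have "Re (CLINT x|M. indicator A (X x) * W x) = (LINT x|M. indicator A (X x) * Re (W x))"
      using iA by (subst integral_Re[symmetric]) (auto intro!: Bochner_Integration.integral_cong simp: indicator_def)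
    then show "Re (CLINT x|M. indicator A (X x) * W x) = Re (prob (X -` A \<inter> space M) * (CLINT x|M. W x))"
      using R iW by simp
    have "Im (CLINT x|M. indicator A (X x) * W x) = (LINT x|M. indicator A (X x) * Im (W x))"
      using iA by (subst integral_Im[symmetric]) (auto intro!: Bochner_Integration.integral_cong simp: indicator_def)
    then show "Im (CLINT x|M. indicator A (X x) * W x) = Im (prob (X -` A \<inter> space M) * (CLINT x|M. W x))"
      using I iW by simp
  qed
qed

text \<open>Only uniqueness in one dimension is used: the exponentials are exchanged for indicators
  one index at a time. In \<open>main\<close>, \<open>J\<close> holds the indices already exchanged.
  Since \<open>t\<close> stays arbitrary, the induction hypothesis at \<open>t(j := s)\<close>, for
  all \<open>s\<close>, is the Fourier identity needed to exchange index \<open>j\<close>.\<close>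

lemma (in prob_space) indep_vars_if_char_factorizes:
  fixes X :: "'i \<Rightarrow> 'a \<Rightarrow> real"
  assumes fin: "finite I"
    and X: "\<And>i. i \<in> I \<Longrightarrow> X i \<in> borel_measurable M"
    and four: "\<And>t. (CLINT x|M. iexp (\<Sum>i\<in>I. t i * X i x)) = (\<Prod>i\<in>I. CLINT x|M. iexp (t i * X i x))"
  shows "indep_vars (\<lambda>_. borel) X I"
proof (cases "I = {}")
  case True
  then show ?thesis by (auto simp: indep_vars_def indep_sets_def)
next
  case False
  have main: "(CLINT x|M. (\<Prod>j\<in>J. indicator (A j) (X j x)) * (\<Prod>i\<in>I-J. iexp (t i * X i x)))
      = (\<Prod>j\<in>J. complex_of_real (prob (X j -` A j \<inter> space M))) * (\<Prod>i\<in>I-J. CLINT x|M. iexp (t i * X i x))"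
    if "J \<subseteq> I" and A: "\<And>i. i \<in> I \<Longrightarrow> A i \<in> sets borel" for J A t
    using finite_subset[OF that(1) fin] that(1)
  proof (induction J arbitrary: t rule: finite_induct)
    case empty
    show ?case using four[of t] by (simp add: exp_sum fin sum_distrib_left)
  next
    case (insert j J)
    note [measurable] = X A
    define W where "W x = (\<Prod>j\<in>J. indicator (A j) (X j x)) * (\<Prod>i\<in>I - insert j J. iexp (t i * X i x))" for x
    have jI: "j \<in> I" and JI: "J \<subseteq> I" using insert by auto
    have split: "I - J = insert j (I - insert j J)" using insert by auto
    have meas: "W \<in> borel_measurable M" unfolding W_def
      using JI by (intro borel_measurable_times borel_measurable_prod) (auto intro!: measurable_compose[OF X] borel_measurable_indicator A)
    have fac: "(CLINT x|M. iexp (s * X j x) * W x) =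
        (\<Prod>j\<in>J. complex_of_real (prob (X j -` A j \<inter> space M))) * ((CLINT x|M. iexp (s * X j x)) *
          (\<Prod>i\<in>I - insert j J. CLINT x|M. iexp (t i * X i x)))" for s
    proof -
      have e1: "(\<Prod>i\<in>I-J. iexp ((t(j:=s)) i * X i x)) = iexp (s * X j x) * (\<Prod>i\<in>I - insert j J. iexp (t i * X i x))" for x
        unfolding split using fin by (subst prod.insert) (auto intro!: prod.cong)
      have e2: "(\<Prod>i\<in>I-J. CLINT x|M. iexp ((t(j:=s)) i * X i x)) = (CLINT x|M. iexp (s * X j x)) *
          (\<Prod>i\<in>I - insert j J. CLINT x|M. iexp (t i * X i x))"
        unfolding split using fin by (subst prod.insert) (auto intro!: prod.cong)
      show ?thesis using insert.IH[OF JI, of "t(j:=s)"] unfolding e1 e2 W_def by (simp add: mult_ac)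
    qed
    \<comment> \<open>At \<open>s = 0\<close> the factor of index \<open>j\<close> becomes
      \<open>1\<close>.\<close>
    have fac0: "(CLINT x|M. W x) =
        (\<Prod>j\<in>J. complex_of_real (prob (X j -` A j \<inter> space M))) * (\<Prod>i\<in>I - insert j J. CLINT x|M. iexp (t i * X i x))"
      using fac[of 0] by (simp add: prob_space)
    have "(CLINT x|M. indicator (A j) (X j x) * W x) = prob (X j -` A j \<inter> space M) * (CLINT x|M. W x)"
    proof (rule Fourier_uniqueness_bounded_complex[where B=1])
      show "cmod (W x) \<le> 1" for x
        unfolding W_def norm_mult prod_norm[symmetric]
        by (intro mult_le_one prod_le_1 prod_nonneg) (auto simp: indicator_def)
      show "(CLINT x|M. iexp (s * X j x) * W x) = (CLINT x|M. iexp (s * X j x)) * (CLINT x|M. W x)" for s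
        unfolding fac fac0 by simp
    qed (use jI meas A X in auto)
    then show ?case unfolding fac0 using insert by (simp add: W_def mult_ac)
  qed
  have rect: "prob (\<Inter>j\<in>I. X j -` A j \<inter> space M) = (\<Prod>j\<in>I. prob (X j -` A j \<inter> space M))"
    if A: "\<And>i. i \<in> I \<Longrightarrow> A i \<in> sets borel" for A
  proof -
    define S where "S = (\<Inter>j\<in>I. X j -` A j \<inter> space M)"
    have "complex_of_real (prob S) = complex_of_real (LINT x|M. indicator S x)"
      using False by (simp add: S_def Int_absorb2)
    also have "\<dots> = (CLINT x|M. indicator S x)"
      by (subst integral_complex_of_real[symmetric]) (simp only: of_real_indicator)
    also have "\<dots> = (CLINT x|M. (\<Prod>j\<in>I. indicator (A j) (X j x)))"
      using fin False by (intro Bochner_Integration.integral_cong refl) (auto simp: S_def indicator_def prod_zero_iff)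
    also have "\<dots> = complex_of_real (\<Prod>j\<in>I. prob (X j -` A j \<inter> space M))"
      using main[of I A "\<lambda>_. 0"] A by simp
    finally show ?thesis using of_real_eq_iff unfolding S_def by blast
  qed
  show ?thesis
    by (subst indep_vars_finite[OF False fin, where E="\<lambda>_. sets borel"])
       (use rect X in \<open>auto simp: Int_stable_def sets.sigma_sets_eq[of borel, simplified] Pi_iff\<close>)
qed

section \<open>Schwartz functions\<close>

lemma schwartz_differentiable:
  assumes "f \<in> schwartz" "set vs \<subseteq> Basis" shows "iter_partial vs f differentiable (at x)"
  using assms unfolding schwartz_def by auto

lemma schwartz_decay:
  assumes "f \<in> schwartz" "set vs \<subseteq> Basis"
  obtains C where "C \<ge> 0" "\<And>x. (1 + norm x) ^ k * \<bar>iter_partial vs f x\<bar> \<le> C"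
proof -
  obtain C where C: "\<And>x. (1 + norm x) ^ k * \<bar>iter_partial vs f x\<bar> \<le> C"
    using assms unfolding schwartz_def by blast
  moreover have "0 \<le> (1 + norm (0::'a)) ^ k * \<bar>iter_partial vs f 0\<bar>" by simp
  ultimately show ?thesis using that order_trans by blast
qed

lemma schwartzI:
  assumes "\<And>vs x. set vs \<subseteq> Basis \<Longrightarrow> iter_partial vs f differentiable (at x)"
    and "\<And>vs k. set vs \<subseteq> Basis \<Longrightarrow> \<exists>C. \<forall>x. (1 + norm x) ^ k * \<bar>iter_partial vs f x\<bar> \<le> C"
  shows "f \<in> schwartz"
  using assms unfolding schwartz_def by blast

lemma iter_partial_lincomb:
  assumes "f \<in> schwartz" "g \<in> schwartz" "set vs \<subseteq> Basis"
  shows "iter_partial vs (\<lambda>x. \<alpha> * f x + \<beta> * g x) = (\<lambda>x. \<alpha> * iter_partial vs f x + \<beta> * iter_partial vs g x)"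
  using assms(3)
proof (induction vs)
  case (Cons v vs)
  then have vs: "set vs \<subseteq> Basis" by simp
  have d: "((\<lambda>x. \<alpha> * iter_partial vs f x + \<beta> * iter_partial vs g x) has_derivative
      (\<lambda>h. \<alpha> * frechet_derivative (iter_partial vs f) (at x) h + \<beta> * frechet_derivative (iter_partial vs g) (at x) h)) (at x)" for x
    using schwartz_differentiable[OF assms(1) vs] schwartz_differentiable[OF assms(2) vs]
    by (intro has_derivative_add has_derivative_mult_right) (simp_all flip: frechet_derivative_works)
  show ?case
    by (simp add: Cons.IH[OF vs] frechet_derivative_at[OF d, symmetric])
qed simp

lemma schwartz_lincomb:
  assumes f: "f \<in> schwartz" and g: "g \<in> schwartz"
  shows "(\<lambda>x. \<alpha> * f x + \<beta> * g x) \<in> schwartz"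
proof (rule schwartzI)
  fix vs :: "'a list" and k :: nat and x :: 'a
  assume vs: "set vs \<subseteq> Basis"
  show "iter_partial vs (\<lambda>x. \<alpha> * f x + \<beta> * g x) differentiable (at x)"
    unfolding iter_partial_lincomb[OF f g vs]
    using schwartz_differentiable[OF f vs] schwartz_differentiable[OF g vs]
    by (intro differentiable_add differentiable_mult differentiable_const)
  obtain C D where C: "\<And>x. (1 + norm x) ^ k * \<bar>iter_partial vs f x\<bar> \<le> C"
    and D: "\<And>x. (1 + norm x) ^ k * \<bar>iter_partial vs g x\<bar> \<le> D"
    by (metis schwartz_decay[OF f vs] schwartz_decay[OF g vs])
  have "(1 + norm x) ^ k * \<bar>\<alpha> * iter_partial vs f x + \<beta> * iter_partial vs g x\<bar> \<le> \<bar>\<alpha>\<bar> * C + \<bar>\<beta>\<bar> * D" for x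
  proof -
    have "(1 + norm x) ^ k * \<bar>\<alpha> * iter_partial vs f x + \<beta> * iter_partial vs g x\<bar>
       \<le> (1 + norm x) ^ k * (\<bar>\<alpha>\<bar> * \<bar>iter_partial vs f x\<bar> + \<bar>\<beta>\<bar> * \<bar>iter_partial vs g x\<bar>)"
      by (intro mult_left_mono order_trans[OF abs_triangle_ineq]) (auto simp: abs_mult)
    also have "\<dots> = \<bar>\<alpha>\<bar> * ((1 + norm x) ^ k * \<bar>iter_partial vs f x\<bar>) + \<bar>\<beta>\<bar> * ((1 + norm x) ^ k * \<bar>iter_partial vs g x\<bar>)"
      by (simp add: algebra_simps)
    also have "\<dots> \<le> \<bar>\<alpha>\<bar> * C + \<bar>\<beta>\<bar> * D" by (intro add_mono mult_left_mono C D) auto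
    finally show ?thesis .
  qed
  then show "\<exists>C. \<forall>x. (1 + norm x) ^ k * \<bar>iter_partial vs (\<lambda>x. \<alpha> * f x + \<beta> * g x) x\<bar> \<le> C"
    unfolding iter_partial_lincomb[OF f g vs] by blast
qed

lemma schwartz_zero: "(\<lambda>x. 0) \<in> schwartz"
proof (rule schwartzI)
  have "iter_partial vs (\<lambda>x::'a. 0::real) = (\<lambda>x. 0)" for vs
    by (induction vs) auto
  then show "iter_partial vs (\<lambda>x. 0) differentiable (at x)"
    "\<exists>C. \<forall>x. (1 + norm x) ^ k * \<bar>iter_partial vs (\<lambda>x. 0) x\<bar> \<le> C" for vs k and x :: 'a by auto
qed

lemma schwartz_scale: "f \<in> schwartz \<Longrightarrow> (\<lambda>x. c * f x) \<in> schwartz"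
  using schwartz_lincomb[of f f c 0] by simp

lemma schwartz_sum:
  assumes "\<And>i. i \<in> I \<Longrightarrow> f i \<in> schwartz"
  shows "(\<lambda>x. \<Sum>i\<in>I. c i * f i x) \<in> schwartz"
  using assms
proof (induction I rule: infinite_finite_induct)
  case (insert i I)
  then have "(\<lambda>x. c i * f i x + 1 * (\<Sum>i\<in>I. c i * f i x)) \<in> schwartz"
    by (intro schwartz_lincomb) auto
  then show ?case using insert by simp
qed (auto simp: schwartz_zero)

lemma iter_partial_translate:
  assumes f: "f \<in> schwartz" and vs: "set vs \<subseteq> Basis"
  shows "iter_partial vs (\<lambda>x. f (x - a)) = (\<lambda>x. iter_partial vs f (x - a))"
  using vs
proof (induction vs)
  case (Cons v vs)
  then have vs: "set vs \<subseteq> Basis" by simp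
  have d: "((\<lambda>x. iter_partial vs f (x - a)) has_derivative frechet_derivative (iter_partial vs f) (at (x - a))) (at x)" for x
  proof -
    have "(iter_partial vs f has_derivative frechet_derivative (iter_partial vs f) (at (x - a))) (at (x - a))"
      using schwartz_differentiable[OF f vs] frechet_derivative_works by blast
    then show ?thesis
      by (rule has_derivative_compose[rotated, where f="\<lambda>x. x - a" and f'="\<lambda>h. h", simplified])
         (auto intro!: derivative_eq_intros)
  qed
  show ?case by (simp add: Cons.IH[OF vs] frechet_derivative_at[OF d, symmetric])
qed simp

text \<open>Polynomial weights at two points differ by a factor depending only on the distance. This
  gives translation invariance of Schwartz decay, and later a bound on \<open>f\<close> at grid
  points by a weight at nearby points.\<close>

lemma one_plus_norm_le_mult: "1 + norm x \<le> (1 + norm (x - a)) * (1 + norm (a::'a::real_normed_vector))"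
proof -
  have "norm x \<le> norm (x - a) + norm a" using norm_triangle_ineq[of "x - a" a] by simp
  moreover have "0 \<le> norm (x - a) * norm a" by simp
  ultimately show ?thesis unfolding distrib_left distrib_right mult_1_left mult_1_right by linarith
qed

lemma schwartz_translate:
  assumes f: "f \<in> schwartz"
  shows "(\<lambda>x. f (x - a)) \<in> schwartz"
proof (rule schwartzI)
  fix vs :: "'a list" and k :: nat and x :: 'a
  assume vs: "set vs \<subseteq> Basis"
  have "iter_partial vs f differentiable (at (x - a))" by (rule schwartz_differentiable[OF f vs])
  then have "(iter_partial vs f \<circ> (\<lambda>x. x - a)) differentiable (at x)"
    by (intro differentiable_chain_at) auto
  then show "iter_partial vs (\<lambda>x. f (x - a)) differentiable (at x)"
    unfolding iter_partial_translate[OF f vs] by (simp add: comp_def)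
  obtain C where C: "\<And>x. (1 + norm x) ^ k * \<bar>iter_partial vs f x\<bar> \<le> C"
    by (metis schwartz_decay[OF f vs])
  have "(1 + norm x) ^ k * \<bar>iter_partial vs f (x - a)\<bar> \<le> (1 + norm a) ^ k * C" for x
  proof -
    have "(1 + norm x) ^ k \<le> ((1 + norm (x - a)) * (1 + norm a)) ^ k"
      by (intro power_mono one_plus_norm_le_mult) simp
    then have "(1 + norm x) ^ k * \<bar>iter_partial vs f (x - a)\<bar>
       \<le> ((1 + norm (x - a)) * (1 + norm a)) ^ k * \<bar>iter_partial vs f (x - a)\<bar>"
      by (intro mult_right_mono) auto
    also have "\<dots> = (1 + norm a) ^ k * ((1 + norm (x - a)) ^ k * \<bar>iter_partial vs f (x - a)\<bar>)"
      by (simp add: power_mult_distrib mult_ac)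
    also have "\<dots> \<le> (1 + norm a) ^ k * C" by (intro mult_left_mono C) auto
    finally show ?thesis .
  qed
  then show "\<exists>C. \<forall>x. (1 + norm x) ^ k * \<bar>iter_partial vs (\<lambda>x. f (x - a)) x\<bar> \<le> C"
    unfolding iter_partial_translate[OF f vs] by blast
qed

lemma schwartz_continuous: "f \<in> schwartz \<Longrightarrow> continuous_on UNIV f"
  using schwartz_differentiable[of f "[]"]
  by (auto intro!: differentiable_imp_continuous_on simp: differentiable_on_def)

lemma schwartz_measurable: "f \<in> schwartz \<Longrightarrow> f \<in> borel_measurable borel"
  by (intro borel_measurable_continuous_onI schwartz_continuous)

text \<open>The common majorant of all dominated convergence arguments. As a product over
  coordinates it is integrable by Tonelli; unlike a compactly supported weight it dominates every
  Schwartz function.\<close>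

definition lorentz_prod :: "'a::euclidean_space \<Rightarrow> real" where
  "lorentz_prod x = (\<Prod>b\<in>Basis. 1 / (1 + (x \<bullet> b)\<^sup>2))"

lemma lorentz_prod_measurable[measurable]: "lorentz_prod \<in> borel_measurable borel"
  unfolding lorentz_prod_def by measurable

lemma lorentz_prod_pos: "0 < lorentz_prod x"
  unfolding lorentz_prod_def by (auto intro!: prod_pos simp: add_pos_nonneg)

lemma lorentz_prod_le_1: "lorentz_prod x \<le> 1"
  unfolding lorentz_prod_def by (intro prod_le_1) (auto simp: divide_simps add_pos_nonneg)

lemma integrable_lorentz: "integrable lborel (\<lambda>x::real. 1 / (1 + x\<^sup>2))"
proof -
  have "set_integrable lborel (einterval (-\<infinity>) \<infinity>) (\<lambda>x::real. 1 / (1 + x\<^sup>2))"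
    by (rule interval_integral_FTC_nonneg(1)[where F=arctan and A="-pi/2" and B="pi/2"])
       (auto intro!: derivative_eq_intros continuous_intros simp: ereal_tendsto_simps add_nonneg_eq_0_iff
         inverse_eq_divide tendsto_arctan_at_bot tendsto_arctan_at_top)
  then show ?thesis by (simp add: set_integrable_def)
qed

lemma integrable_lorentz_prod: "integrable lborel (lorentz_prod :: 'a::euclidean_space \<Rightarrow> real)"
proof (rule integrableI_nonneg)
  have "(\<integral>\<^sup>+ x. ennreal (lorentz_prod (x::'a)) \<partial>lborel) = (\<integral>\<^sup>+ x. (\<Prod>b\<in>(Basis::'a set). ennreal (1 / (1 + (x \<bullet> b)\<^sup>2))) \<partial>lborel)"
    unfolding lorentz_prod_def by (intro nn_integral_cong) (simp add: prod_ennreal)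
  also have "\<dots> = (\<Prod>b\<in>(Basis::'a set). (\<integral>\<^sup>+ x. ennreal (1 / (1 + x\<^sup>2)) \<partial>lborel))"
    by (rule nn_integral_lborel_prod) auto
  also have "\<dots> < \<infinity>"
  proof -
    have "(\<integral>\<^sup>+ x. ennreal (1 / (1 + (x::real)\<^sup>2)) \<partial>lborel) < \<infinity>"
      using integrableD(2)[OF integrable_lorentz] by (simp add: less_top add_nonneg_nonneg)
    then show ?thesis by (simp add: power_less_top_ennreal)
  qed
  finally show "(\<integral>\<^sup>+ x. ennreal (lorentz_prod (x::'a)) \<partial>lborel) < \<infinity>" .
qed (auto intro: less_imp_le lorentz_prod_pos)

text \<open>Each of the \<open>DIM('a)\<close> factors \<open>1 + (x \<bullet> b)^2\<close> is at
  most \<open>(1 + norm x)^2\<close>; hence the exponent.\<close>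

lemma one_le_lorentz_prod: "1 \<le> (1 + norm x) ^ (2 * DIM('a)) * lorentz_prod (x::'a::euclidean_space)"
proof -
  have "(\<Prod>b\<in>(Basis::'a set). 1 + (x \<bullet> b)\<^sup>2) \<le> (\<Prod>b\<in>(Basis::'a set). (1 + norm x)\<^sup>2)"
  proof (intro prod_mono conjI)
    fix b :: 'a assume b: "b \<in> Basis"
    have "(x \<bullet> b)\<^sup>2 \<le> (norm x)\<^sup>2" using Basis_le_norm[OF b, of x] by (metis abs_ge_zero power2_abs power_mono)
    then show "1 + (x \<bullet> b)\<^sup>2 \<le> (1 + norm x)\<^sup>2"
      using norm_ge_zero[of x] unfolding power2_sum power_one by linarith
  qed auto
  moreover have "(\<Prod>b\<in>(Basis::'a set). 1 + (x \<bullet> b)\<^sup>2) > 0" by (auto intro!: prod_pos add_pos_nonneg)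
  ultimately show ?thesis
    by (simp add: lorentz_prod_def prod_dividef divide_simps power_mult)
qed

text \<open>The weight lies in \<open>(0, 1]\<close>, so its square is below it, and one pointwise
  bound gives integrability of both \<open>g\<close> and its square.\<close>

lemma L12_if_lorentz_bound:
  fixes g :: "'a::euclidean_space \<Rightarrow> real"
  assumes [measurable]: "g \<in> borel_measurable borel" and bd: "\<And>x. \<bar>g x\<bar> \<le> C * lorentz_prod x"
  shows "g \<in> L12"
proof -
  have C: "0 \<le> C * lorentz_prod x" for x :: 'a using bd[of x] by linarith
  have "integrable lborel g"
    by (rule Bochner_Integration.integrable_bound[OF integrable_mult_right[OF integrable_lorentz_prod, of C]])
       (use bd C in auto)
  moreover have "integrable lborel (\<lambda>x. (g x)\<^sup>2)"
  proof (rule Bochner_Integration.integrable_bound[OF integrable_mult_right[OF integrable_lorentz_prod, of "C\<^sup>2"]])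
    show "AE x in lborel. norm ((g x)\<^sup>2) \<le> norm (C\<^sup>2 * lorentz_prod x)"
    proof (rule AE_I2)
      fix x
      have "(g x)\<^sup>2 \<le> (C * lorentz_prod x)\<^sup>2" using bd[of x] by (metis abs_ge_zero power2_abs power_mono)
      also have "\<dots> = C\<^sup>2 * (lorentz_prod x * lorentz_prod x)"
        by (simp add: power2_eq_square)
      also have "\<dots> \<le> C\<^sup>2 * lorentz_prod x"
        using lorentz_prod_pos[of x] lorentz_prod_le_1[of x] by (intro mult_left_mono mult_left_le) auto
      finally show "norm ((g x)\<^sup>2) \<le> norm (C\<^sup>2 * lorentz_prod x)" using lorentz_prod_pos[of x] by (simp add: abs_mult)
    qed
  qed auto
  ultimately show ?thesis by (simp add: L12_def)
qed

lemma schwartz_lorentz_bound: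
  assumes f: "(f::'a::euclidean_space \<Rightarrow> real) \<in> schwartz"
  obtains C where "C \<ge> 0" "\<And>x. \<bar>f x\<bar> \<le> C * lorentz_prod x"
proof -
  obtain C where C: "C \<ge> 0" "\<And>x. (1 + norm x) ^ (2 * DIM('a)) * \<bar>f x\<bar> \<le> C"
    using schwartz_decay[OF f, of "[]" "2 * DIM('a)"] by auto
  have "\<bar>f x\<bar> \<le> C * lorentz_prod x" for x
  proof -
    have "\<bar>f x\<bar> \<le> \<bar>f x\<bar> * ((1 + norm x) ^ (2 * DIM('a)) * lorentz_prod x)"
      using one_le_lorentz_prod[of x] by (metis abs_ge_zero mult_left_mono mult.right_neutral)
    also have "\<dots> = ((1 + norm x) ^ (2 * DIM('a)) * \<bar>f x\<bar>) * lorentz_prod x" by simp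
    also have "\<dots> \<le> C * lorentz_prod x" using C(2)[of x] lorentz_prod_pos[of x] by (intro mult_right_mono) auto
    finally show ?thesis .
  qed
  with C that show ?thesis by blast
qed

lemma schwartz_in_L12: "f \<in> schwartz \<Longrightarrow> f \<in> L12"
  using schwartz_lorentz_bound L12_if_lorentz_bound schwartz_measurable by metis

section \<open>Smooth bump functions on cubes\<close>

text \<open>The derivative is existentially quantified so that closure under sums, products and
  affine substitution follows by naming a candidate, without computing with
  \<open>deriv\<close>.\<close>

primrec nth_diff :: "nat \<Rightarrow> (real \<Rightarrow> real) \<Rightarrow> bool" where
  "nth_diff 0 f = True"
| "nth_diff (Suc n) f = (\<exists>f'. (\<forall>x. (f has_real_derivative f' x) (at x)) \<and> nth_diff n f')"

lemma nth_diff_SucI: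
  "(\<And>x. (f has_real_derivative f' x) (at x)) \<Longrightarrow> nth_diff n f' \<Longrightarrow> nth_diff (Suc n) f"
  by auto

lemma nth_diff_lower: "nth_diff (Suc n) f \<Longrightarrow> nth_diff n f"
proof (induction n arbitrary: f)
  case (Suc n)
  then obtain f' where "\<forall>x. (f has_real_derivative f' x) (at x)" "nth_diff (Suc n) f'" by auto
  then show ?case using Suc.IH[of f'] by auto
qed simp

lemma nth_diff_add: "nth_diff n f \<Longrightarrow> nth_diff n g \<Longrightarrow> nth_diff n (\<lambda>x. f x + g x)"
proof (induction n arbitrary: f g)
  case (Suc n)
  then obtain f' g' where "\<forall>x. (f has_real_derivative f' x) (at x)" "nth_diff n f'"
      "\<forall>x. (g has_real_derivative g' x) (at x)" "nth_diff n g'" by auto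
  then show ?case using Suc.IH[of f' g'] by (auto intro!: exI[of _ "\<lambda>x. f' x + g' x"] DERIV_add)
qed simp

text \<open>Each summand of the product rule keeps one undifferentiated factor, which enters the
  induction at the lower order; this is what \<open>nth_diff_lower\<close> provides.\<close>

lemma nth_diff_mult: "nth_diff n f \<Longrightarrow> nth_diff n g \<Longrightarrow> nth_diff n (\<lambda>x. f x * g x)"
proof (induction n arbitrary: f g)
  case (Suc n)
  then obtain f' g' where *: "\<forall>x. (f has_real_derivative f' x) (at x)" "nth_diff n f'"
      "\<forall>x. (g has_real_derivative g' x) (at x)" "nth_diff n g'" by auto
  have "nth_diff n (\<lambda>x. f' x * g x + f x * g' x)"
    by (intro nth_diff_add Suc.IH * nth_diff_lower[OF Suc.prems(1)] nth_diff_lower[OF Suc.prems(2)])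
  moreover have "((\<lambda>x. f x * g x) has_real_derivative (f' x * g x + f x * g' x)) (at x)" for x
    using * by (auto intro!: derivative_eq_intros)
  ultimately show ?case by (rule nth_diff_SucI[rotated])
qed simp

lemma nth_diff_affine: "nth_diff n f \<Longrightarrow> nth_diff n (\<lambda>x. c * f (a * x + b))"
proof (induction n arbitrary: f c)
  case (Suc n)
  then obtain f' where *: "\<And>x. (f has_real_derivative f' x) (at x)" "nth_diff n f'" by auto
  have "((\<lambda>x. c * f (a * x + b)) has_real_derivative ((c * a) * f' (a * x + b))) (at x)" for x
  proof -
    have "((\<lambda>x. f (a * x + b)) has_real_derivative f' (a * x + b) * a) (at x)"
      by (rule DERIV_chain2[OF *(1)]) (auto intro!: derivative_eq_intros)
    from DERIV_cmult[OF this, of c] show ?thesis by (simp add: mult_ac)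
  qed
  then show ?case by (rule nth_diff_SucI) (rule Suc.IH[OF *(2), of "c * a"])
qed simp

definition smooth1 :: "(real \<Rightarrow> real) \<Rightarrow> bool" where
  "smooth1 f \<longleftrightarrow> (\<forall>n. nth_diff n f)"

lemma smooth1_deriv:
  assumes "smooth1 f"
  shows "(f has_real_derivative deriv f x) (at x)" "smooth1 (deriv f)"
proof -
  have D: "(f has_real_derivative deriv f x) (at x)" for x
  proof -
    have "nth_diff 1 f" using assms unfolding smooth1_def by blast
    then obtain f' where "\<And>x. (f has_real_derivative f' x) (at x)" by auto
    then show ?thesis using DERIV_imp_deriv[of f "f' x" x] by simp
  qed
  then show "(f has_real_derivative deriv f x) (at x)" .
  have "nth_diff n (deriv f)" for n
  proof -
    have "nth_diff (Suc n) f" using assms unfolding smooth1_def by blast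
    then obtain f' where "\<forall>x. (f has_real_derivative f' x) (at x)" "nth_diff n f'" by auto
    moreover from this have "deriv f = f'" using DERIV_imp_deriv by blast
    ultimately show ?thesis by simp
  qed
  then show "smooth1 (deriv f)" unfolding smooth1_def by blast
qed

lemma smooth1_iter_deriv: "smooth1 f \<Longrightarrow> smooth1 ((deriv ^^ n) f)"
  by (induction n) (auto intro: smooth1_deriv)

text \<open>The classical \<open>exp (-1/x)\<close>, enlarged by polynomial factors in
  \<open>1/x\<close> to a family that is closed under differentiation; smoothness is then a one-line
  induction.\<close>

definition flat_exp :: "real poly \<Rightarrow> real \<Rightarrow> real" where
  "flat_exp p x = (if x > 0 then poly p (1 / x) * exp (- (1 / x)) else 0)"

lemma tendsto_poly_exp_0: "((\<lambda>y::real. poly p y * exp (- y)) \<longlongrightarrow> 0) at_top"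
proof -
  have "((\<lambda>y::real. \<Sum>i\<le>degree p. coeff p i * (y ^ i / exp y)) \<longlongrightarrow> (\<Sum>i\<le>degree p. coeff p i * 0)) at_top"
    by (intro tendsto_sum tendsto_mult tendsto_const tendsto_power_div_exp_0)
  then show ?thesis by (simp add: poly_altdef exp_minus field_simps sum_distrib_left sum_distrib_right)
qed

text \<open>With \<open>y = 1 / x\<close> one has \<open>dy/dx = - y^2\<close>, so
  \<open>p(y) exp (-y)\<close> has derivative \<open>y^2 (p(y) - p'(y)) exp (-y)\<close>;
  \<open>[:0, 0, 1:]\<close> is the factor \<open>y^2\<close>.\<close>

lemma DERIV_flat_exp:
  "(flat_exp p has_real_derivative flat_exp ([:0, 0, 1:] * (p - pderiv p)) x) (at x)"
proof -
  consider "x > 0" | "x < 0" | "x = 0" by linarith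
  then show ?thesis
  proof cases
    case 1
    have "((\<lambda>x. poly p (1 / x) * exp (- (1 / x))) has_real_derivative flat_exp ([:0, 0, 1:] * (p - pderiv p)) x) (at x)"
      using 1 by (auto intro!: derivative_eq_intros DERIV_chain2[OF poly_DERIV]
          simp: flat_exp_def power2_eq_square field_simps)
    then show ?thesis
      by (rule has_field_derivative_transform_within_open[of _ _ _ "{0<..}"]) (use 1 in \<open>auto simp: flat_exp_def\<close>)
  next
    case 2
    have "((\<lambda>x. 0) has_real_derivative flat_exp ([:0, 0, 1:] * (p - pderiv p)) x) (at x)"
      using 2 by (simp add: flat_exp_def)
    then show ?thesis
      by (rule has_field_derivative_transform_within_open[of _ _ _ "{..<0}"]) (use 2 in \<open>auto simp: flat_exp_def\<close>)
  next
    case 3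
    have "((\<lambda>h. (flat_exp p (0 + h) - flat_exp p 0) / h) \<longlongrightarrow> 0) (at 0)"
    proof (rule filterlim_split_at)
      show "((\<lambda>h. (flat_exp p (0 + h) - flat_exp p 0) / h) \<longlongrightarrow> 0) (at_left 0)"
        by (rule tendsto_eventually) (auto simp: eventually_at_filter flat_exp_def)
      \<comment> \<open>The right difference quotient at \<open>0\<close> is
        \<open>y p(y) exp (-y)\<close> with \<open>y = 1 / h\<close>, again a polynomial against an
        exponential.\<close>
      have "((\<lambda>h::real. poly ([:0, 1:] * p) (inverse h) * exp (- inverse h)) \<longlongrightarrow> 0) (at_right 0)"
        by (rule filterlim_compose[OF tendsto_poly_exp_0 filterlim_inverse_at_top_right])
      then show "((\<lambda>h. (flat_exp p (0 + h) - flat_exp p 0) / h) \<longlongrightarrow> 0) (at_right 0)"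
        by (rule Lim_transform_eventually) (auto simp: eventually_at_filter flat_exp_def field_simps)
    qed
    then show ?thesis using 3 by (simp add: DERIV_def flat_exp_def)
  qed
qed

lemma nth_diff_flat_exp: "nth_diff n (flat_exp p)"
  by (induction n arbitrary: p) (auto intro!: exI DERIV_flat_exp)

definition unit_bump :: "nat \<Rightarrow> real \<Rightarrow> real" where
  "unit_bump n x = flat_exp 1 (real n * x - 1) * flat_exp 1 (real n * (1 - x) - 1)"

lemma flat_exp_1_bounds: "0 \<le> flat_exp 1 x" "flat_exp 1 x \<le> 1" "flat_exp 1 x \<noteq> 0 \<longleftrightarrow> x > 0"
  by (auto simp: flat_exp_def)

lemma unit_bump_bounds: "0 \<le> unit_bump n x" "unit_bump n x \<le> 1"
  by (auto simp: unit_bump_def flat_exp_1_bounds intro: mult_le_one)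

lemma unit_bump_nonzero:
  assumes "unit_bump n x \<noteq> 0" shows "1 / real n < x \<and> x < 1 - 1 / real n \<and> n > 0"
proof -
  have "real n * x > 1" "real n * (1 - x) > 1"
    using assms flat_exp_1_bounds(3) by (auto simp: unit_bump_def)
  moreover from this have "n > 0" by (cases n) auto
  ultimately show ?thesis by (auto simp: field_simps)
qed

lemma smooth1_unit_bump: "smooth1 (\<lambda>x. unit_bump n (x / d))"
proof -
  have "nth_diff m (\<lambda>x. (1 * flat_exp 1 ((n / d) * x + (- 1))) * (1 * flat_exp 1 ((- n / d) * x + (real n - 1))))" for m
    by (intro nth_diff_mult nth_diff_affine nth_diff_flat_exp)
  moreover have "(\<lambda>x. unit_bump n (x / d)) =
     (\<lambda>x. (1 * flat_exp 1 ((n / d) * x + (- 1))) * (1 * flat_exp 1 ((- n / d) * x + (real n - 1))))"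
    by (simp add: unit_bump_def fun_eq_iff algebra_simps)
  ultimately show ?thesis unfolding smooth1_def by simp
qed

lemma unit_bump_tendsto: "(\<lambda>n. unit_bump n x) \<longlonglongrightarrow> indicator {0<..<1} x"
proof -
  have *: "(\<lambda>n. flat_exp 1 (real n * y - 1)) \<longlonglongrightarrow> 1" if "y > 0" for y
  proof -
    have lim: "filterlim (\<lambda>n. real n * y - 1) at_top sequentially"
      using filterlim_tendsto_add_at_top[OF tendsto_const filterlim_tendsto_pos_mult_at_top[OF tendsto_const that filterlim_real_sequentially], of "- 1"]
      by (simp add: mult.commute)
    have "(\<lambda>n. exp (- inverse (real n * y - 1))) \<longlonglongrightarrow> exp (- 0)"
      by (intro tendsto_intros tendsto_inverse_0_at_top lim)
    moreover have "eventually (\<lambda>n. real n * y - 1 > 0) sequentially"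
      using lim[unfolded filterlim_at_top_dense, rule_format, of 0] .
    ultimately show ?thesis
      by (auto elim!: Lim_transform_eventually eventually_mono simp: flat_exp_def inverse_eq_divide)
  qed
  show ?thesis
  proof (cases "0 < x \<and> x < 1")
    case True
    then show ?thesis using tendsto_mult[OF *[of x] *[of "1 - x"]] by (simp add: unit_bump_def)
  next
    case False
    have "unit_bump n x = 0" for n
    proof (rule ccontr)
      assume "unit_bump n x \<noteq> 0"
      from unit_bump_nonzero[OF this] have "1 / real n < x \<and> x < 1 - 1 / real n" by simp
      moreover have "1 / real n \<ge> 0" by simp
      ultimately show False using False by linarith
    qed
    then show ?thesis using False by simp
  qed
qed

text \<open>Every partial derivative acts on a single coordinate factor: in the product rule the
  term of \<open>b\<close> carries \<open>v \<bullet> b\<close>, which vanishes unless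
  \<open>b = v\<close>. The order in each coordinate is thus its multiplicity in
  \<open>vs\<close>.\<close>

lemma iter_partial_prod:
  fixes h :: "real \<Rightarrow> real"
  assumes h: "smooth1 h" and vs: "set vs \<subseteq> (Basis :: 'a::euclidean_space set)"
  shows "iter_partial vs (\<lambda>x::'a. \<Prod>b\<in>Basis. h (x \<bullet> b)) = (\<lambda>x. \<Prod>b\<in>Basis. (deriv ^^ count_list vs b) h (x \<bullet> b))"
    and "iter_partial vs (\<lambda>x::'a. \<Prod>b\<in>Basis. h (x \<bullet> b)) differentiable (at x)"
proof -
  define H where "H k = (deriv ^^ k) h" for k
  have DH: "(H k has_real_derivative H (Suc k) y) (at y)" for k y
    unfolding H_def using smooth1_deriv(1)[OF smooth1_iter_deriv[OF h]] by simp
  have d: "((\<lambda>x::'a. \<Prod>b\<in>Basis. H (c b) (x \<bullet> b)) has_derivative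
     (\<lambda>y. \<Sum>b\<in>Basis. (H (Suc (c b)) (x \<bullet> b) * (y \<bullet> b)) * (\<Prod>j\<in>Basis - {b}. H (c j) (x \<bullet> j)))) (at x)" for c x
  proof (rule has_derivative_prod)
    fix b :: 'a assume "b \<in> Basis"
    show "((\<lambda>x. H (c b) (x \<bullet> b)) has_derivative (\<lambda>y. H (Suc (c b)) (x \<bullet> b) * (y \<bullet> b))) (at x)"
    proof -
      have "((\<lambda>x. x \<bullet> b) has_derivative (\<lambda>y. y \<bullet> b)) (at x)" by (auto intro!: derivative_eq_intros)
      from has_derivative_compose[OF this DH[unfolded has_field_derivative_def]] show ?thesis by simp
    qed
  qed
  have main: "iter_partial vs (\<lambda>x::'a. \<Prod>b\<in>Basis. h (x \<bullet> b)) = (\<lambda>x. \<Prod>b\<in>Basis. H (count_list vs b) (x \<bullet> b))"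
    using vs
  proof (induction vs)
    case (Cons v vs)
    then have v: "v \<in> Basis" and IH: "iter_partial vs (\<lambda>x::'a. \<Prod>b\<in>Basis. h (x \<bullet> b)) = (\<lambda>x. \<Prod>b\<in>Basis. H (count_list vs b) (x \<bullet> b))" by auto
    have "(\<Sum>b\<in>Basis. (H (Suc (count_list vs b)) (x \<bullet> b) * (v \<bullet> b)) * (\<Prod>j\<in>Basis - {b}. H (count_list vs j) (x \<bullet> j)))
        = (\<Prod>b\<in>Basis. H (count_list (v # vs) b) (x \<bullet> b))" for x
    proof -
      have "(\<Sum>b\<in>Basis. (H (Suc (count_list vs b)) (x \<bullet> b) * (v \<bullet> b)) * (\<Prod>j\<in>Basis - {b}. H (count_list vs j) (x \<bullet> j)))
        = (\<Sum>b\<in>Basis. if b = v then H (Suc (count_list vs b)) (x \<bullet> b) * (\<Prod>j\<in>Basis - {b}. H (count_list vs j) (x \<bullet> j)) else 0)"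
        using v by (intro sum.cong) (auto simp: inner_Basis)
      also have "\<dots> = H (Suc (count_list vs v)) (x \<bullet> v) * (\<Prod>j\<in>Basis - {v}. H (count_list vs j) (x \<bullet> j))"
        using v by simp
      also have "\<dots> = (\<Prod>b\<in>Basis. H (count_list (v # vs) b) (x \<bullet> b))"
        unfolding prod.remove[OF finite_Basis v, of "\<lambda>b. H (count_list (v # vs) b) (x \<bullet> b)"]
      proof (rule arg_cong2[where f="(*)"])
        show "(\<Prod>j\<in>Basis - {v}. H (count_list vs j) (x \<bullet> j)) = (\<Prod>j\<in>Basis - {v}. H (count_list (v # vs) j) (x \<bullet> j))"
          by (rule prod.cong) auto
      qed simp
      finally show ?thesis .
    qed
    then show ?case by (simp add: IH frechet_derivative_at[OF d, symmetric])
  qed (simp add: H_def)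
  then show "iter_partial vs (\<lambda>x::'a. \<Prod>b\<in>Basis. h (x \<bullet> b)) = (\<lambda>x. \<Prod>b\<in>Basis. (deriv ^^ count_list vs b) h (x \<bullet> b))"
    by (simp add: H_def)
  show "iter_partial vs (\<lambda>x::'a. \<Prod>b\<in>Basis. h (x \<bullet> b)) differentiable (at x)"
    unfolding main using d differentiableI by blast
qed

text \<open>All derivatives of \<open>h\<close> vanish off \<open>{l..u}\<close>, because its
  complement is open. The weighted partial derivatives are therefore supported in one compact box
  and bounded there by continuity.\<close>

lemma schwartz_prod_compact:
  fixes h :: "real \<Rightarrow> real"
  assumes h: "smooth1 h" and supp: "\<And>y. y \<notin> {l..u} \<Longrightarrow> h y = 0"
  shows "(\<lambda>x::'a::euclidean_space. \<Prod>b\<in>Basis. h (x \<bullet> b)) \<in> schwartz"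
proof (rule schwartzI)
  fix vs :: "'a list" and k :: nat and x :: 'a
  assume vs: "set vs \<subseteq> Basis"
  let ?g = "\<lambda>x::'a. \<Prod>b\<in>Basis. h (x \<bullet> b)"
  show "iter_partial vs ?g differentiable (at x)" by (rule iter_partial_prod(2)[OF h vs])
  have zero: "(deriv ^^ k) h y = 0" if "y \<notin> {l..u}" for k y
    using that
  proof (induction k arbitrary: y)
    case (Suc k)
    have "((\<lambda>y. 0) has_real_derivative 0) (at y)" by simp
    then have "((deriv ^^ k) h has_real_derivative 0) (at y)"
      by (rule has_field_derivative_transform_within_open[of _ _ _ "- {l..u}"]) (use Suc in auto)
    then show ?case by (simp add: DERIV_imp_deriv)
  qed (simp add: supp)
  have cont: "continuous_on (cbox (l *\<^sub>R One) (u *\<^sub>R One)) (\<lambda>x. (1 + norm x) ^ k * \<bar>iter_partial vs ?g x\<bar>)"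
    using iter_partial_prod(2)[OF h vs]
    by (intro continuous_intros differentiable_imp_continuous_on) (auto simp: differentiable_on_def differentiable_at_withinI)
  obtain C where C: "\<And>x. x \<in> cbox (l *\<^sub>R One) (u *\<^sub>R One) \<Longrightarrow> norm ((1 + norm x) ^ k * \<bar>iter_partial vs ?g x\<bar>) \<le> C"
    using compact_imp_bounded[OF compact_continuous_image[OF cont compact_cbox]] by (auto simp: bounded_iff)
  have "(1 + norm x) ^ k * \<bar>iter_partial vs ?g x\<bar> \<le> max C 0" for x
  proof (cases "x \<in> cbox (l *\<^sub>R One) (u *\<^sub>R One)")
    case True
    then show ?thesis using C[OF True] by auto
  next
    case False
    then obtain b where "b \<in> Basis" "x \<bullet> b \<notin> {l..u}" by (auto simp: mem_box)
    then have "iter_partial vs ?g x = 0"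
      unfolding iter_partial_prod(1)[OF h vs] using zero by (intro prod_zero) auto
    then show ?thesis by simp
  qed
  then show "\<exists>C. \<forall>x. (1 + norm x) ^ k * \<bar>iter_partial vs ?g x\<bar> \<le> C" by blast
qed

definition cube_bump :: "real \<Rightarrow> nat \<Rightarrow> 'a::euclidean_space \<Rightarrow> real" where
  "cube_bump d n x = (\<Prod>b\<in>Basis. unit_bump n ((x \<bullet> b) / d))"

lemma cube_bump_schwartz:
  assumes "d > 0" shows "(cube_bump d n :: 'a::euclidean_space \<Rightarrow> real) \<in> schwartz"
proof -
  have "unit_bump n (y / d) = 0" if "y \<notin> {0..d}" for y
  proof (rule ccontr)
    assume "unit_bump n (y / d) \<noteq> 0"
    from unit_bump_nonzero[OF this] have "1 / real n < y / d" "y / d < 1 - 1 / real n" by auto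
    moreover have "1 / real n \<ge> 0" by simp
    ultimately have "0 < y / d" "y / d < 1" by linarith+
    then show False using that assms by (auto simp: field_simps zero_less_mult_iff)
  qed
  from schwartz_prod_compact[OF smooth1_unit_bump this] show ?thesis
    unfolding cube_bump_def .
qed

lemma cube_bump_bounds: "0 \<le> cube_bump d n x" "cube_bump d n x \<le> 1"
  unfolding cube_bump_def by (auto intro!: prod_nonneg prod_le_1 simp: unit_bump_bounds)

text \<open>The closed support fits into the open cube, so translates to distinct grid points have
  disjoint closed supports, as \<open>noise_field\<close> demands.\<close>

lemma fsupport_cube_bump:
  assumes "d > 0" shows "fsupport (cube_bump d n :: 'a::euclidean_space \<Rightarrow> real) \<subseteq> box 0 (d *\<^sub>R One)"
\<comment> \<open>For \<open>n = 0\<close> the quotient \<open>d / n\<close> is \<open>0\<close> and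
  leaves no margin to the faces; but then the bump is identically zero.\<close>
proof (cases "n = 0")
  case True
  have "cube_bump d n x = 0" for x :: 'a
  proof -
    obtain b :: 'a where "b \<in> Basis" using nonempty_Basis by blast
    moreover have "unit_bump 0 y = 0" for y by (simp add: unit_bump_def flat_exp_def)
    ultimately show ?thesis unfolding cube_bump_def True by (intro prod_zero) auto
  qed
  then show ?thesis by (simp add: fsupport_def)
next
  case False
  have "{x. cube_bump d n x \<noteq> 0} \<subseteq> cbox ((d / n) *\<^sub>R One) ((d - d / n) *\<^sub>R One :: 'a)"
  proof safe
    fix x :: 'a assume "cube_bump d n x \<noteq> 0"
    then have "unit_bump n ((x \<bullet> b) / d) \<noteq> 0" if "b \<in> Basis" for b
      using that unfolding cube_bump_def by auto
    then have "1 / real n < (x \<bullet> b) / d \<and> (x \<bullet> b) / d < 1 - 1 / real n" if "b \<in> Basis" for b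
      using unit_bump_nonzero that by blast
    then have "d / real n < x \<bullet> b \<and> x \<bullet> b < d - d / real n" if "b \<in> Basis" for b
      using that \<open>d > 0\<close> False by (fastforce simp: field_simps)
    then show "x \<in> cbox ((d / n) *\<^sub>R One) ((d - d / n) *\<^sub>R One)" by (fastforce simp: mem_box)
  qed
  then have "fsupport (cube_bump d n :: 'a \<Rightarrow> real) \<subseteq> cbox ((d / n) *\<^sub>R One) ((d - d / n) *\<^sub>R One)"
    unfolding fsupport_def by (rule closure_minimal) auto
  also have "\<dots> \<subseteq> box 0 (d *\<^sub>R One)"
    
  proof -
    have "0 < d / n" using \<open>d > 0\<close> False by simp
    then show ?thesis by (auto simp: subset_box)
  qed
  finally show ?thesis .
qed

lemma cube_bump_tendsto:
  assumes "d > 0" shows "(\<lambda>n. cube_bump d n x) \<longlonglongrightarrow> indicator (box 0 (d *\<^sub>R One)) (x::'a::euclidean_space)"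
proof -
  have "(\<lambda>n. cube_bump d n x) \<longlonglongrightarrow> (\<Prod>b\<in>Basis. indicator {0<..<1} ((x \<bullet> b) / d))"
    unfolding cube_bump_def by (intro tendsto_prod unit_bump_tendsto)
  also have "(\<Prod>b\<in>Basis. indicator {0<..<1} ((x \<bullet> b) / d)) = (indicator (box 0 (d *\<^sub>R One)) x :: real)"
    using assms by (auto simp: indicator_def mem_box field_simps zero_less_mult_iff zero_less_divide_iff prod_zero_iff)
  finally show ?thesis .
qed

section \<open>Dyadic cubes\<close>

lemma triple_norm_tendsto_0:
  fixes g :: "nat \<Rightarrow> 'a::euclidean_space \<Rightarrow> real"
  assumes [measurable]: "\<And>n. g n \<in> borel_measurable borel" "h \<in> borel_measurable borel"
    and bg: "\<And>n x. \<bar>g n x\<bar> \<le> C * lorentz_prod x" and bh: "\<And>x. \<bar>h x\<bar> \<le> C * lorentz_prod x"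
    and lim: "AE x in lborel. (\<lambda>n. g n x) \<longlonglongrightarrow> h x"
  shows "(\<lambda>n. triple_norm (\<lambda>x. g n x - h x)) \<longlonglongrightarrow> 0"
proof -
  have bd: "\<bar>g n x - h x\<bar> \<le> (2 * C) * lorentz_prod x" for n x
    using bg[of n x] bh[of x] by linarith
  have C0: "0 \<le> C * lorentz_prod x" for x :: 'a using bh[of x] by linarith
  have "(\<lambda>n. LINT x|lborel. \<bar>g n x - h x\<bar>) \<longlonglongrightarrow> (LINT x|(lborel :: 'a measure). (0::real))"
  proof (rule integral_dominated_convergence[where w="\<lambda>x::'a. (2 * C) * lorentz_prod x"])
    show "AE x in lborel. (\<lambda>n. \<bar>g n x - h x\<bar>) \<longlonglongrightarrow> 0"
      using lim by eventually_elim (simp add: tendsto_rabs_zero_iff LIM_zero_iff)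
  qed (use bd in \<open>auto intro!: integrable_mult_right integrable_lorentz_prod\<close>)
  moreover have "(\<lambda>n. LINT x|lborel. (g n x - h x)\<^sup>2) \<longlonglongrightarrow> (LINT x|(lborel :: 'a measure). (0::real))"
  proof (rule integral_dominated_convergence[where w="\<lambda>x::'a. (2 * C)\<^sup>2 * lorentz_prod x"])
    show "AE x in lborel. (\<lambda>n. (g n x - h x)\<^sup>2) \<longlonglongrightarrow> 0"
      using lim by eventually_elim (auto dest!: LIM_zero intro!: tendsto_eq_intros)
    have "(g n x - h x)\<^sup>2 \<le> (2 * C)\<^sup>2 * lorentz_prod x" for n x
    proof -
      have "(g n x - h x)\<^sup>2 \<le> ((2 * C) * lorentz_prod x)\<^sup>2"
        using power_mono[OF bd[of n x], of 2] by simp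
      also have "\<dots> = (2 * C)\<^sup>2 * (lorentz_prod x * lorentz_prod x)" by (simp add: power2_eq_square)
      also have "\<dots> \<le> (2 * C)\<^sup>2 * lorentz_prod x"
        using lorentz_prod_pos[of x] lorentz_prod_le_1[of x] by (intro mult_left_mono mult_left_le) auto
      finally show ?thesis .
    qed
    then show "AE x in lborel. norm ((g n x - h x)\<^sup>2) \<le> (2 * C)\<^sup>2 * lorentz_prod x" for n by simp
  qed (auto intro!: integrable_mult_right integrable_lorentz_prod)
  ultimately have "(\<lambda>n. triple_norm (\<lambda>x. g n x - h x)) \<longlonglongrightarrow> sqrt (0\<^sup>2 + 0)"
    unfolding triple_norm_def by (intro tendsto_intros) simp_all
  then show ?thesis by simp
qed

text \<open>The weight is bounded below on bounded sets. The bound is stated for numbers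
  \<open>y\<close> instead of functions so that a single \<open>C\<close> serves a whole family,
  such as all bump approximations of a step function.\<close>

lemma lorentz_bound_if_bounded_support:
  fixes S :: "'a::euclidean_space set"
  assumes "bounded S" "B \<ge> 0"
  shows "\<exists>C\<ge>0. \<forall>x y. \<bar>y\<bar> \<le> B \<longrightarrow> (x \<notin> S \<longrightarrow> y = 0) \<longrightarrow> \<bar>y\<bar> \<le> C * lorentz_prod x"
proof -
  obtain R where R: "R > 0" "\<And>x. x \<in> S \<Longrightarrow> norm x \<le> R"
    using assms(1) bounded_pos[of S] by blast
  define C where "C = B * (1 + R) ^ (2 * DIM('a))"
  have C0: "C \<ge> 0" using assms R by (simp add: C_def)
  have "\<bar>y\<bar> \<le> C * lorentz_prod x" if y: "\<bar>y\<bar> \<le> B" "x \<notin> S \<longrightarrow> y = 0" for x and y :: real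
  proof (cases "x \<in> S")
    case True
    have "1 \<le> (1 + norm x) ^ (2 * DIM('a)) * lorentz_prod x" by (rule one_le_lorentz_prod)
    also have "\<dots> \<le> (1 + R) ^ (2 * DIM('a)) * lorentz_prod x"
      using R(2)[OF True] less_imp_le[OF lorentz_prod_pos[of x]] by (intro mult_right_mono power_mono) auto
    finally have "B * 1 \<le> B * ((1 + R) ^ (2 * DIM('a)) * lorentz_prod x)" using assms by (intro mult_left_mono)
    then show ?thesis using y by (simp add: C_def mult.assoc)
  next
    case False
    then show ?thesis using y C0 lorentz_prod_pos[of x] by simp
  qed
  with C0 show ?thesis by blast
qed

text \<open>The lower corner of the half-open dyadic cube of side \<open>2 ^ -k\<close> containing
  \<open>x\<close>. Cubes are defined as fibres of this map, so they partition the space by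
  construction.\<close>

definition dyadic_floor :: "nat \<Rightarrow> 'a::euclidean_space \<Rightarrow> 'a" where
  "dyadic_floor k x = (\<Sum>b\<in>Basis. (of_int \<lfloor>2 ^ k * (x \<bullet> b)\<rfloor> / 2 ^ k) *\<^sub>R b)"

definition dyadic_cube :: "nat \<Rightarrow> 'a::euclidean_space \<Rightarrow> 'a set" where
  "dyadic_cube k a = {x. dyadic_floor k x = a}"

lemma dyadic_floor_inner: "b \<in> Basis \<Longrightarrow> dyadic_floor k x \<bullet> b = of_int \<lfloor>2 ^ k * (x \<bullet> b)\<rfloor> / 2 ^ k"
  by (simp add: dyadic_floor_def)

lemma dyadic_floor_eq_iff:
  "dyadic_floor k x = dyadic_floor k y \<longleftrightarrow> (\<forall>b\<in>Basis. \<lfloor>2 ^ k * (x \<bullet> b)\<rfloor> = \<lfloor>2 ^ k * (y \<bullet> b)\<rfloor>)"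
  by (subst euclidean_eq_iff) (simp add: dyadic_floor_inner)

lemma dyadic_floor_idem: "dyadic_floor k (dyadic_floor k x) = dyadic_floor k x"
  by (simp add: dyadic_floor_eq_iff dyadic_floor_inner)

text \<open>Nesting of the grids, from the fact that the floor of half an integer part is the floor
  of half the number.\<close>

lemma dyadic_floor_Suc: "dyadic_floor k (dyadic_floor (Suc k) x) = dyadic_floor k x"
proof -
  have "\<lfloor>(2::real) ^ k * (of_int \<lfloor>2 ^ Suc k * y\<rfloor> / 2 ^ Suc k)\<rfloor> = \<lfloor>2 ^ k * y\<rfloor>" for y :: real
  proof -
    have "\<lfloor>(2::real) ^ k * (of_int \<lfloor>2 ^ Suc k * y\<rfloor> / 2 ^ Suc k)\<rfloor> = \<lfloor>of_int \<lfloor>2 ^ Suc k * y\<rfloor> / real_of_int 2\<rfloor>"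
      by (rule arg_cong[where f=floor]) simp
    also have "\<dots> = \<lfloor>2 ^ Suc k * y\<rfloor> div 2" by (subst floor_divide_real_eq_div) auto
    also have "\<dots> = \<lfloor>(2 ^ Suc k * y) / real_of_int 2\<rfloor>" by (subst floor_divide_real_eq_div) auto
    also have "\<dots> = \<lfloor>2 ^ k * y\<rfloor>" by (rule arg_cong[where f=floor]) simp
    finally show ?thesis .
  qed
  then show ?thesis by (simp add: dyadic_floor_eq_iff dyadic_floor_inner)
qed

lemma dyadic_floor_bounds:
  assumes "b \<in> Basis"
  shows "dyadic_floor k x \<bullet> b \<le> x \<bullet> b" "x \<bullet> b < dyadic_floor k x \<bullet> b + 1 / 2 ^ k"
proof -
  have "of_int \<lfloor>2 ^ k * (x \<bullet> b)\<rfloor> \<le> 2 ^ k * (x \<bullet> b)" "2 ^ k * (x \<bullet> b) < of_int \<lfloor>2 ^ k * (x \<bullet> b)\<rfloor> + 1" by linarith+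
  then show "dyadic_floor k x \<bullet> b \<le> x \<bullet> b" "x \<bullet> b < dyadic_floor k x \<bullet> b + 1 / 2 ^ k"
    using assms by (simp_all add: dyadic_floor_inner field_simps)
qed

lemma dyadic_floor_dist: "norm (x - dyadic_floor k x) \<le> real DIM('a) / 2 ^ k" for x :: "'a::euclidean_space"
proof -
  have "norm (x - dyadic_floor k x) \<le> (\<Sum>b\<in>Basis. \<bar>(x - dyadic_floor k x) \<bullet> b\<bar>)" by (rule norm_le_l1)
  also have "\<dots> \<le> (\<Sum>b\<in>(Basis::'a set). 1 / 2 ^ k)"
  proof (rule sum_mono)
    fix b :: 'a assume "b \<in> Basis"
    from dyadic_floor_bounds[OF this, where k=k and x=x] show "\<bar>(x - dyadic_floor k x) \<bullet> b\<bar> \<le> 1 / 2 ^ k"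
      by (simp add: inner_diff_left)
  qed
  finally show ?thesis by simp
qed

lemma dyadic_floor_measurable[measurable]: "dyadic_floor k \<in> borel_measurable borel"
  unfolding dyadic_floor_def by measurable

lemma dyadic_cube_sets[measurable]: "dyadic_cube k a \<in> sets borel"
proof -
  have "dyadic_cube k a = dyadic_floor k -` {a} \<inter> space borel" by (auto simp: dyadic_cube_def)
  also have "\<dots> \<in> sets borel" by (rule measurable_sets[OF dyadic_floor_measurable]) simp
  finally show ?thesis .
qed

abbreviation "dyadic_lattice k \<equiv> range (dyadic_floor k)"

text \<open>Open and closed box have equal volume, so this sandwich gives the volume of the
  half-open cube and its equality with the open box up to a null set.\<close>

lemma dyadic_cube_between:
  fixes a :: "'a::euclidean_space"
  assumes "a \<in> dyadic_lattice k"
  shows "box a (a + (1 / 2 ^ k) *\<^sub>R One) \<subseteq> dyadic_cube k a" "dyadic_cube k a \<subseteq> cbox a (a + (1 / 2 ^ k) *\<^sub>R One)"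
proof -
  obtain y where a: "a = dyadic_floor k y" using assms by auto
  show "box a (a + (1 / 2 ^ k) *\<^sub>R One) \<subseteq> dyadic_cube k a"
  proof
    fix x assume x: "x \<in> box a (a + (1 / 2 ^ k) *\<^sub>R One)"
    have "\<lfloor>2 ^ k * (x \<bullet> b)\<rfloor> = \<lfloor>2 ^ k * (y \<bullet> b)\<rfloor>" if b: "b \<in> Basis" for b
    proof -
      have "a \<bullet> b < x \<bullet> b" "x \<bullet> b < a \<bullet> b + 1 / 2 ^ k" using x b by (auto simp: mem_box inner_add_left)
      then show ?thesis using b by (simp add: a dyadic_floor_inner field_simps floor_eq_iff)
    qed
    then show "x \<in> dyadic_cube k a" by (simp add: dyadic_cube_def a dyadic_floor_eq_iff)
  qed
  show "dyadic_cube k a \<subseteq> cbox a (a + (1 / 2 ^ k) *\<^sub>R One)"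
  proof
    fix x assume "x \<in> dyadic_cube k a"
    then have "dyadic_floor k x = a" by (simp add: dyadic_cube_def)
    then show "x \<in> cbox a (a + (1 / 2 ^ k) *\<^sub>R One)"
      using dyadic_floor_bounds[where k=k and x=x] by (auto simp: mem_box inner_add_left less_imp_le)
  qed
qed

text \<open>The \<open>D\<close> of the overview: the number of subcubes at the next level. A cube
  of level \<open>k\<close> has volume \<open>1 / D ^ k\<close>.\<close>

definition dyadic_density :: "'a::euclidean_space itself \<Rightarrow> nat" where
  "dyadic_density _ = 2 ^ DIM('a)"

lemma emeasure_dyadic_box:
  fixes a :: "'a::euclidean_space"
  shows "emeasure lborel (box a (a + (1 / 2 ^ k) *\<^sub>R One)) = ennreal (1 / real (dyadic_density TYPE('a)) ^ k)"
    and "emeasure lborel (cbox a (a + (1 / 2 ^ k) *\<^sub>R One)) = ennreal (1 / real (dyadic_density TYPE('a)) ^ k)"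
proof -
  have "(1 / 2 ^ k) ^ DIM('a) = 1 / real (dyadic_density TYPE('a)) ^ k"
    by (simp add: dyadic_density_def power_divide mult.commute flip: power_mult)
  then show "emeasure lborel (box a (a + (1 / 2 ^ k) *\<^sub>R One)) = ennreal (1 / real (dyadic_density TYPE('a)) ^ k)"
    and "emeasure lborel (cbox a (a + (1 / 2 ^ k) *\<^sub>R One)) = ennreal (1 / real (dyadic_density TYPE('a)) ^ k)"
    by (simp_all add: emeasure_lborel_box emeasure_lborel_cbox inner_add_left)
qed

lemma emeasure_dyadic_cube:
  fixes a :: "'a::euclidean_space"
  assumes "a \<in> dyadic_lattice k"
  shows "emeasure lborel (dyadic_cube k a) = ennreal (1 / real (dyadic_density TYPE('a)) ^ k)"
proof (rule antisym)
  show "emeasure lborel (dyadic_cube k a) \<le> ennreal (1 / real (dyadic_density TYPE('a)) ^ k)"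
    using emeasure_mono[OF dyadic_cube_between(2)[OF assms], of lborel] emeasure_dyadic_box(2)[of a k] by simp
  show "ennreal (1 / real (dyadic_density TYPE('a)) ^ k) \<le> emeasure lborel (dyadic_cube k a)"
    using emeasure_mono[OF dyadic_cube_between(1)[OF assms], of lborel] emeasure_dyadic_box(1)[of a k] by simp
qed

lemma measure_dyadic_cube:
  fixes a :: "'a::euclidean_space"
  assumes "a \<in> dyadic_lattice k"
  shows "measure lborel (dyadic_cube k a) = 1 / real (dyadic_density TYPE('a)) ^ k"
  using emeasure_dyadic_cube[OF assms] by (simp add: measure_def)

lemma AE_dyadic_cube_eq_box:
  fixes a :: "'a::euclidean_space"
  assumes "a \<in> dyadic_lattice k"
  shows "AE x in lborel. indicator (dyadic_cube k a) x = (indicator (box a (a + (1 / 2 ^ k) *\<^sub>R One)) x :: real)"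
proof -
  let ?B = "box a (a + (1 / 2 ^ k) *\<^sub>R One)" and ?C = "cbox a (a + (1 / 2 ^ k) *\<^sub>R One)"
  have "emeasure lborel (?C - ?B) = emeasure lborel ?C - emeasure lborel ?B"
    by (rule emeasure_Diff) (auto simp: emeasure_dyadic_box box_subset_cbox simp del: emeasure_lborel_box_eq)
  then have "?C - ?B \<in> null_sets lborel" by (auto simp: emeasure_dyadic_box)
  then have "AE x in lborel. x \<notin> ?C - ?B" by (rule AE_not_in)
  then show ?thesis
    by (rule eventually_mono) (use dyadic_cube_between[OF assms] in \<open>auto simp: indicator_def\<close>)
qed

text \<open>Provides, for any \<open>m\<close>, that many distinct cubes of one level; this is how
  arbitrary powers of the characteristic function of a cube are realized.\<close>

lemma infinite_dyadic_lattice: "infinite (dyadic_lattice k :: 'a::euclidean_space set)"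
proof -
  obtain b :: 'a where b: "b \<in> Basis" using nonempty_Basis by blast
  have "inj (\<lambda>n::nat. dyadic_floor k (real n *\<^sub>R b))"
  proof (rule injI)
    fix m n :: nat assume "dyadic_floor k (real m *\<^sub>R b) = dyadic_floor k (real n *\<^sub>R b)"
    then have "\<lfloor>2 ^ k * real m\<rfloor> = \<lfloor>2 ^ k * real n\<rfloor>" using b by (auto simp: dyadic_floor_eq_iff)
    moreover have "\<lfloor>2 ^ k * real j\<rfloor> = 2 ^ k * int j" for j
      using floor_of_int[of "2 ^ k * int j", where 'a=real] by simp
    ultimately show "m = n" by simp
  qed
  then have "infinite (range (\<lambda>n::nat. dyadic_floor k (real n *\<^sub>R b)))" by (rule range_inj_infinite)
  moreover have "range (\<lambda>n::nat. dyadic_floor k (real n *\<^sub>R b)) \<subseteq> dyadic_lattice k" by auto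
  ultimately show ?thesis using infinite_super by blast
qed

lemma finite_dyadic_lattice_bounded:
  fixes S :: "'a::euclidean_space set"
  assumes "bounded S" shows "finite (dyadic_lattice k \<inter> S)"
proof -
  obtain R where R: "R > 0" "\<And>x. x \<in> S \<Longrightarrow> norm x \<le> R"
    using assms(1) bounded_pos[of S] by blast
  define J where "J = {\<lfloor>- (2 ^ k * R)\<rfloor>..\<lfloor>2 ^ k * R\<rfloor>}"
  define L where "L n = (\<Sum>b\<in>(Basis::'a set). (of_int (n b) / 2 ^ k) *\<^sub>R b)" for n :: "'a \<Rightarrow> int"
  have "dyadic_lattice k \<inter> S \<subseteq> L ` (PiE Basis (\<lambda>_. J))"
  proof
    fix a assume a: "a \<in> dyadic_lattice k \<inter> S"
    then have fl: "dyadic_floor k a = a" using dyadic_floor_idem by auto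
    have "\<lfloor>2 ^ k * (a \<bullet> b)\<rfloor> \<in> J" if "b \<in> Basis" for b
    proof -
      have "\<bar>a \<bullet> b\<bar> \<le> R" using Basis_le_norm[OF that, of a] R(2)[of a] a by auto
      then have "- (2 ^ k * R) \<le> 2 ^ k * (a \<bullet> b)" "2 ^ k * (a \<bullet> b) \<le> 2 ^ k * R"
        unfolding minus_mult_right by (intro mult_left_mono; simp)+
      then show ?thesis unfolding J_def by (auto intro: floor_mono)
    qed
    then have "restrict (\<lambda>b. \<lfloor>2 ^ k * (a \<bullet> b)\<rfloor>) Basis \<in> PiE Basis (\<lambda>_. J)" by auto
    moreover have "a = L (restrict (\<lambda>b. \<lfloor>2 ^ k * (a \<bullet> b)\<rfloor>) Basis)"
      using fl unfolding dyadic_floor_def L_def by simp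
    ultimately show "a \<in> L ` (PiE Basis (\<lambda>_. J))" by blast
  qed
  moreover have "finite (PiE (Basis::'a set) (\<lambda>_. J))" by (intro finite_PiE) (auto simp: J_def)
  ultimately show ?thesis using finite_surj by blast
qed

text \<open>The number of subcubes is found by comparing volumes: disjoint pieces of volume
  \<open>1 / D ^ Suc k\<close> fill a set of volume \<open>1 / D ^ k\<close>.\<close>

lemma card_dyadic_subcubes:
  fixes a :: "'a::euclidean_space"
  assumes a: "a \<in> dyadic_lattice k"
  defines "I \<equiv> {c \<in> dyadic_lattice (Suc k). dyadic_floor k c = a}"
  shows "finite I" "card I = dyadic_density TYPE('a)" "(\<Union>c\<in>I. dyadic_cube (Suc k) c) = dyadic_cube k a"
proof -
  have "I \<subseteq> dyadic_lattice (Suc k) \<inter> cbox a (a + (1 / 2 ^ k) *\<^sub>R One)"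
    using dyadic_cube_between(2)[OF a] unfolding I_def by (auto simp: dyadic_cube_def)
  then show fin: "finite I" using finite_dyadic_lattice_bounded[OF bounded_cbox] finite_subset by blast
  show un: "(\<Union>c\<in>I. dyadic_cube (Suc k) c) = dyadic_cube k a"
  proof (intro equalityI subsetI)
    fix x assume "x \<in> (\<Union>c\<in>I. dyadic_cube (Suc k) c)"
    then show "x \<in> dyadic_cube k a" by (auto simp: I_def dyadic_cube_def) (metis dyadic_floor_Suc)
  next
    fix x assume "x \<in> dyadic_cube k a"
    then show "x \<in> (\<Union>c\<in>I. dyadic_cube (Suc k) c)" by (auto simp: I_def dyadic_cube_def dyadic_floor_Suc)
  qed
  let ?D = "real (dyadic_density TYPE('a))"
  have D: "?D > 0" by (simp add: dyadic_density_def)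
  have "measure lborel (\<Union>c\<in>I. dyadic_cube (Suc k) c) = (\<Sum>c\<in>I. measure lborel (dyadic_cube (Suc k) c))"
    by (rule measure_finite_Union[OF fin])
       (auto simp: disjoint_family_on_def dyadic_cube_def[symmetric] emeasure_dyadic_cube I_def, auto simp: dyadic_cube_def)
  also have "\<dots> = (\<Sum>c\<in>I. 1 / ?D ^ Suc k)"
    by (intro sum.cong refl measure_dyadic_cube) (auto simp: I_def)
  also have "\<dots> = real (card I) * (1 / ?D ^ Suc k)" by simp
  finally have "1 / ?D ^ k = real (card I) * (1 / ?D ^ Suc k)"
    unfolding un measure_dyadic_cube[OF a] .
  then show "card I = dyadic_density TYPE('a)" using D by (simp add: field_simps)
qed

section \<open>The Levy--Khinchine kernel\<close>

text \<open>For \<open>0 < y \<le> 2\<close>, the Taylor polynomial of order \<open>4\<close> with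
  its remainder leaves \<open>y^2 (1/6 - 4/120) = 2 y^2 / 15\<close>, which exceeds
  \<open>y^2 / 8\<close>. For \<open>y > 2\<close>, already
  \<open>sin y / y \<le> 1/2\<close>.\<close>

lemma one_minus_sinc_ge:
  fixes y :: real
  assumes "y \<noteq> 0" shows "min 1 (y\<^sup>2) / 8 \<le> 1 - sin y / y"
proof -
  have pos: "min 1 (y\<^sup>2) / 8 \<le> 1 - sin y / y" if "y > 0" for y :: real
  proof (cases "y \<le> 2")
    case True
    have "\<bar>Im (iexp y - (\<Sum>k\<le>4. (\<i> * y) ^ k / fact k))\<bar> \<le> \<bar>y\<bar> ^ Suc 4 / fact (Suc 4)"
      by (rule order_trans[OF abs_Im_le_cmod iexp_approx1])
    moreover have "Im (iexp y - (\<Sum>k\<le>4. (\<i> * y) ^ k / fact k)) = sin y - (y - y ^ 3 / 6)"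
      by (simp add: eval_nat_numeral Im_exp fact_numeral power_mult_distrib divide_simps)
    moreover have "\<bar>y\<bar> ^ Suc 4 / fact (Suc 4) = y ^ 5 / 120"
      using that by (simp add: fact_numeral eval_nat_numeral)
    ultimately have "sin y \<le> y - y ^ 3 / 6 + y ^ 5 / 120" by linarith
    then have "sin y / y \<le> (y - y ^ 3 / 6 + y ^ 5 / 120) / y" using that by (intro divide_right_mono) auto
    also have "\<dots> = 1 - y\<^sup>2 / 6 + y\<^sup>2 * y\<^sup>2 / 120"
      using that by (simp add: field_simps eval_nat_numeral)
    also have "\<dots> \<le> 1 - y\<^sup>2 / 6 + y\<^sup>2 * 4 / 120"
      using True that power_mono[of y 2 2] by (intro add_left_mono divide_right_mono mult_left_mono) auto
    finally have "y\<^sup>2 / 8 \<le> 1 - sin y / y" using zero_le_power2[of y] by linarith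
    then show ?thesis by (rule order_trans[rotated]) auto
  next
    case False
    then have "sin y * 2 \<le> y" using sin_le_one[of y] by linarith
    then have "sin y / y \<le> 1 / 2" using that by (simp add: field_simps)
    moreover have "min 1 (y\<^sup>2) / 8 \<le> 1 / 8" by simp
    ultimately show ?thesis by linarith
  qed
  show ?thesis using pos[of y] pos[of "-y"] assms by (cases "y > 0") auto
qed

lemma nn_integral_one_minus_cos_ge:
  fixes y :: real
  shows "ennreal (min 1 (y\<^sup>2) / 8) \<le> (\<integral>\<^sup>+ t. ennreal (1 - cos (t * y)) * indicator {0..1} t \<partial>lborel)"
proof (cases "y = 0")
  case False
  have "(\<integral>\<^sup>+ t. ennreal (1 - cos (t * y)) * indicator {0..1} t \<partial>lborel) = ennreal ((1 - sin (1 * y) / y) - (0 - sin (0 * y) / y))"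
    by (rule nn_integral_FTC_Icc) (use False in \<open>auto intro!: derivative_eq_intros\<close>)
  then show ?thesis using one_minus_sinc_ge[OF False] by (simp add: ennreal_leI)
qed simp

text \<open>Averaging \<open>1 - cos (u t s)\<close> over \<open>t\<close> turns a bound on the characteristic function near
  the origin into a bound on truncated second moments.\<close>

lemma (in real_distribution) truncated_moment_le_char:
  assumes u: "u > 0" and bd: "\<And>t. 0 \<le> t \<Longrightarrow> t \<le> u \<Longrightarrow> Re (1 - char M t) \<le> D"
  shows "(LINT s|M. min 1 ((u * s)\<^sup>2)) \<le> 8 * D"
proof -
  interpret P: pair_sigma_finite M lborel ..
  have D0: "0 \<le> D" using bd[of 0] u by (simp add: char_zero)
  have intw: "integrable M (\<lambda>s. min 1 ((u * s)\<^sup>2))"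
    by (rule integrable_const_bound[where B=1]) auto
  have cosint: "integrable M (\<lambda>s. 1 - cos (t * (u * s)))" for t
    by (rule integrable_const_bound[where B=2]) (auto intro!: AE_I2 order_trans[OF abs_triangle_ineq4])
  have inner: "(\<integral>\<^sup>+ s. ennreal (1 - cos (t * (u * s))) \<partial>M) \<le> ennreal D" if "t \<in> {0..1}" for t
  proof -
    have "(\<integral>\<^sup>+ s. ennreal (1 - cos (t * (u * s))) \<partial>M) = ennreal (LINT s|M. 1 - cos (t * (u * s)))"
      by (rule nn_integral_eq_integral[OF cosint]) auto
    also have "(LINT s|M. 1 - cos (t * (u * s))) = Re (1 - char M (t * u))"
    proof -
      have e: "complex_integrable M (\<lambda>s. iexp (t * u * s))"
        by (rule integrable_const_bound[where B=1]) auto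
      have c: "integrable M (\<lambda>s. cos (t * (u * s)))"
        by (rule integrable_const_bound[where B=1]) auto
      have "Re (char M (t * u)) = (LINT s|M. Re (iexp (t * u * s)))"
        unfolding char_def by (rule integral_Re[OF e, symmetric])
      also have "\<dots> = (LINT s|M. cos (t * (u * s)))"
        by (simp add: Re_exp mult.assoc)
      finally show ?thesis using c by (simp add: prob_space del: space_eq_univ)
    qed
    also have "\<dots> \<le> D" using that u by (intro bd) (auto intro: mult_left_le_one_le)
    finally show ?thesis by (simp add: ennreal_leI)
  qed
  have "ennreal ((LINT s|M. min 1 ((u * s)\<^sup>2)) / 8) = (\<integral>\<^sup>+ s. ennreal (min 1 ((u * s)\<^sup>2) / 8) \<partial>M)"
    using intw by (subst nn_integral_eq_integral) auto
  also have "\<dots> \<le> (\<integral>\<^sup>+ s. (\<integral>\<^sup>+ t. ennreal (1 - cos (t * (u * s))) * indicator {0..1} t \<partial>lborel) \<partial>M)"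
    by (intro nn_integral_mono nn_integral_one_minus_cos_ge)
  also have "\<dots> = (\<integral>\<^sup>+ t. (\<integral>\<^sup>+ s. ennreal (1 - cos (t * (u * s))) * indicator {0..1} t \<partial>M) \<partial>lborel)"
    by (rule P.Fubini'[symmetric]) measurable
  also have "\<dots> \<le> (\<integral>\<^sup>+ t. ennreal D * indicator {0..1::real} t \<partial>lborel)"
  proof (rule nn_integral_mono)
    fix t :: real
    show "(\<integral>\<^sup>+ s. ennreal (1 - cos (t * (u * s))) * indicator {0..1} t \<partial>M) \<le> ennreal D * indicator {0..1} t"
      using inner[of t] by (cases "t \<in> {0..1}") auto
  qed
  also have "\<dots> = ennreal D" by (simp add: nn_integral_cmult)
  finally show ?thesis using D0 by (simp add: ennreal_le_iff)
qed

text \<open>A continuous substitute for the truncation \<open>s * indicator {-1..1} s\<close>: weak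
  convergence only tests continuous integrands.\<close>

definition clamp1 :: "real \<Rightarrow> real" where
  "clamp1 s = max (- 1) (min 1 s)"

text \<open>The Levy-Khinchine integrand divided by \<open>min 1 (s^2)\<close>. The value at
  \<open>0\<close> is its continuous extension; an atom at \<open>0\<close> of a limit measure
  thereby contributes the Gaussian term.\<close>

definition levy_kernel :: "real \<Rightarrow> real \<Rightarrow> complex" where
  "levy_kernel t s = (if s = 0 then - complex_of_real (t\<^sup>2 / 2)
     else (iexp (t * s) - 1 - \<i> * complex_of_real (t * clamp1 s)) / complex_of_real (min 1 (s\<^sup>2)))"

lemma clamp1_cases: "\<bar>s\<bar> \<le> 1 \<Longrightarrow> clamp1 s = s" "\<bar>s\<bar> > 1 \<Longrightarrow> clamp1 s = sgn s"
  "\<bar>clamp1 s\<bar> \<le> 1"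
  by (auto simp: clamp1_def abs_le_iff sgn_real_def)

lemma min_one_square_cases: "\<bar>s\<bar> \<le> 1 \<Longrightarrow> min 1 (s\<^sup>2) = (s\<^sup>2::real)" "\<bar>s\<bar> > 1 \<Longrightarrow> min 1 (s\<^sup>2) = (1::real)"
  using abs_square_le_1[of s] abs_square_less_1[of s] by (auto simp: min_def)

lemma min_one_square_nonzero: "(s::real) \<noteq> 0 \<Longrightarrow> min 1 (s\<^sup>2) \<noteq> 0"
  by (simp add: min_def)

lemma isCont_clamp1: "isCont clamp1 s"
  unfolding clamp1_def by (intro continuous_intros)

lemma clamp1_measurable[measurable]: "clamp1 \<in> borel_measurable borel"
  unfolding clamp1_def by measurable

text \<open>For small \<open>s\<close> the second-order Taylor remainder compensates the division by
  \<open>s^2\<close>; for \<open>\<bar>s\<bar> > 1\<close> the denominator is \<open>1\<close> and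
  the triangle inequality suffices.\<close>

lemma levy_kernel_bound: "cmod (levy_kernel t s) \<le> t\<^sup>2 + \<bar>t\<bar> + 2"
proof -
  consider "s = 0" | "s \<noteq> 0" "\<bar>s\<bar> \<le> 1" | "\<bar>s\<bar> > 1" by linarith
  then show ?thesis
  proof cases
    case 1
    then show ?thesis by (simp add: levy_kernel_def norm_divide norm_power)
  next
    case 2
    have "cmod (iexp (t * s) - (\<Sum>k\<le>1. (\<i> * complex_of_real (t * s)) ^ k / fact k)) \<le> \<bar>t * s\<bar> ^ Suc 1 / fact (Suc 1)"
      by (rule iexp_approx1)
    then have "cmod (iexp (t * s) - 1 - \<i> * complex_of_real (t * s)) \<le> (t * s)\<^sup>2 / 2"
      by (simp add: diff_diff_eq eval_nat_numeral)
    then have "cmod (iexp (t * s) - 1 - \<i> * complex_of_real (t * s)) / s\<^sup>2 \<le> ((t * s)\<^sup>2 / 2) / s\<^sup>2"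
      by (rule divide_right_mono) simp
    then have "cmod (levy_kernel t s) \<le> ((t * s)\<^sup>2 / 2) / s\<^sup>2"
      using 2 by (simp add: levy_kernel_def norm_divide clamp1_cases min_one_square_cases norm_power)
    also have "\<dots> = t\<^sup>2 / 2" using 2 by (simp add: power_mult_distrib)
    also have "\<dots> \<le> t\<^sup>2 + \<bar>t\<bar> + 2" by (simp add: field_simps add_nonneg_nonneg)
    finally show ?thesis .
  next
    case 3
    have "cmod (levy_kernel t s) = cmod (iexp (t * s) - 1 - \<i> * complex_of_real (t * clamp1 s))"
      using 3 by (auto simp: levy_kernel_def min_one_square_cases)
    also have "\<dots> \<le> cmod (iexp (t * s)) + cmod 1 + cmod (\<i> * complex_of_real (t * clamp1 s))"
      by (rule order_trans[OF norm_triangle_ineq4 add_right_mono[OF norm_triangle_ineq4]])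
    also have "\<dots> = 2 + \<bar>t\<bar> * \<bar>clamp1 s\<bar>" by (simp add: norm_mult abs_mult del: of_real_mult)
    also have "\<dots> \<le> 2 + \<bar>t\<bar>" using clamp1_cases(3)[of s] by (simp add: mult_left_le)
    also have "\<dots> \<le> t\<^sup>2 + \<bar>t\<bar> + 2" by simp
    finally show ?thesis .
  qed
qed

lemma isCont_levy_kernel: "isCont (levy_kernel t) s"
proof (cases "s = 0")
  case True
  have "((\<lambda>s. levy_kernel t s - levy_kernel t 0) \<longlongrightarrow> 0) (at 0)"
  proof (rule Lim_null_comparison)
    show "eventually (\<lambda>s. cmod (levy_kernel t s - levy_kernel t 0) \<le> \<bar>t\<bar> ^ 3 * \<bar>s\<bar> / 6) (at 0)"
      unfolding eventually_at
    proof (intro exI[of _ 1] conjI ballI impI)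
      fix s :: real assume s: "s \<noteq> 0 \<and> dist s 0 < 1"
      \<comment> \<open>One order more than for the bound: the quadratic term is the value at
        \<open>0\<close>, and the cubic remainder over \<open>s^2\<close> is of order
        \<open>\<bar>s\<bar>\<close>.\<close>
      have "cmod (iexp (t * s) - (\<Sum>k\<le>2. (\<i> * complex_of_real (t * s)) ^ k / fact k)) \<le> \<bar>t * s\<bar> ^ Suc 2 / fact (Suc 2)"
        by (rule iexp_approx1)
      then have A: "cmod (iexp (t * s) - 1 - \<i> * complex_of_real (t * s) + complex_of_real ((t * s)\<^sup>2 / 2)) \<le> \<bar>t * s\<bar> ^ 3 / 6"
        by (simp add: eval_nat_numeral algebra_simps)
      have "levy_kernel t s - levy_kernel t 0 =
         (iexp (t * s) - 1 - \<i> * complex_of_real (t * s) + complex_of_real ((t * s)\<^sup>2 / 2)) / complex_of_real (s\<^sup>2)"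
        using s by (simp add: levy_kernel_def clamp1_cases min_one_square_cases add_divide_distrib power_mult_distrib)
      then have "cmod (levy_kernel t s - levy_kernel t 0) \<le> (\<bar>t * s\<bar> ^ 3 / 6) / s\<^sup>2"
        using divide_right_mono[OF A, of "s\<^sup>2"] by (simp only: norm_divide) (simp add: norm_power)
      also have "\<dots> = \<bar>t\<bar> ^ 3 * \<bar>s\<bar> / 6"
      proof -
        have "\<bar>s\<bar> ^ 3 = \<bar>s\<bar> * s\<^sup>2" by (simp add: power3_eq_cube power2_eq_square)
        then show ?thesis using s by (simp add: abs_mult power_mult_distrib)
      qed
      finally show "cmod (levy_kernel t s - levy_kernel t 0) \<le> \<bar>t\<bar> ^ 3 * \<bar>s\<bar> / 6" .
    qed simp
    show "((\<lambda>s. \<bar>t\<bar> ^ 3 * \<bar>s\<bar> / 6) \<longlongrightarrow> 0) (at 0)"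
      by (auto intro!: tendsto_eq_intros)
  qed
  then show ?thesis using True by (simp add: isCont_def LIM_zero_iff)
next
  case False
  have "isCont (\<lambda>s. (iexp (t * s) - 1 - \<i> * complex_of_real (t * clamp1 s)) / complex_of_real (min 1 (s\<^sup>2))) s"
    using min_one_square_nonzero[OF False] by (intro continuous_intros isCont_clamp1) (simp only: of_real_eq_0_iff not_False_eq_True)
  moreover have "eventually (\<lambda>s. levy_kernel t s = (iexp (t * s) - 1 - \<i> * complex_of_real (t * clamp1 s)) / complex_of_real (min 1 (s\<^sup>2))) (nhds s)"
    using t1_space_nhds[OF False] by (rule eventually_mono) (auto simp: levy_kernel_def)
  ultimately show ?thesis by (simp add: isCont_cong)
qed

lemma levy_kernel_measurable[measurable]: "levy_kernel t \<in> borel_measurable borel"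
  by (intro borel_measurable_continuous_onI continuous_at_imp_continuous_on ballI isCont_levy_kernel)

lemma (in real_distribution) char_minus_one_eq_levy_kernel:
  "char M t - 1 = \<i> * complex_of_real (t * (LINT s|M. clamp1 s)) + (CLINT s|M. (min 1 (s\<^sup>2)) *\<^sub>R levy_kernel t s)"
proof -
  have i1: "complex_integrable M (\<lambda>s. iexp (t * s))"
    by (rule integrable_const_bound[where B=1]) auto
  have i2: "integrable M clamp1"
    by (rule integrable_const_bound[where B=1]) (auto simp: clamp1_cases)
  have i3: "complex_integrable M (\<lambda>s. complex_of_real (clamp1 s))"
    using i2 by simp
  have eq: "(min 1 (s\<^sup>2)) *\<^sub>R levy_kernel t s = iexp (t * s) - 1 - \<i> * t * clamp1 s" for s
  proof (cases "s = 0")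
    case False
    then have "complex_of_real (min 1 (s\<^sup>2)) \<noteq> 0" using min_one_square_nonzero[of s] of_real_eq_0_iff by blast
    then show ?thesis using False unfolding levy_kernel_def scaleR_conv_of_real by (simp add: mult.assoc)
  qed (simp add: clamp1_def)
  have "(CLINT s|M. (min 1 (s\<^sup>2)) *\<^sub>R levy_kernel t s) = char M t - 1 - \<i> * t * (LINT s|M. clamp1 s)"
    unfolding eq char_def using i1 i2 i3 by (simp add: prob_space del: of_real_mult space_eq_univ)
  then show ?thesis by simp
qed

section \<open>The Levy--Khinchine formula\<close>

text \<open>Reads the triplet off a finite measure \<open>g M\<close>: its atom at \<open>0\<close>
  becomes the variance, and the rest, divided by \<open>min 1 (s^2)\<close>, becomes
  \<open>\<nu>\<close>. Replacing the continuous truncation by the sharp one only changes the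
  drift.\<close>

lemma levy_char_if_kernel_integral:
  assumes "real_distribution M" and g: "g \<ge> 0"
    and \<psi>: "\<And>t. \<psi> t = \<i> * complex_of_real (t * b) + complex_of_real g * (CLINT s|M. levy_kernel t s)"
  shows "\<exists>b s2 \<nu>. char_triplet b s2 \<nu> \<and> (\<forall>t. \<psi> t = levy_char b s2 \<nu> t)"
proof -
  interpret real_distribution M by fact
  define f where "f s = g * indicator (- {0}) s / min 1 (s\<^sup>2)" for s :: real
  define \<nu> where "\<nu> = density M (\<lambda>s. ennreal (f s))"
  have f[measurable]: "f \<in> borel_measurable borel" unfolding f_def by measurable
  have f0: "0 \<le> f s" for s using g by (auto simp: f_def)
  have fw: "f s * min 1 (s\<^sup>2) = g * indicator (- {0}) s" for s
    using min_one_square_nonzero[of s] by (cases "s = 0") (simp_all add: f_def)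
  have sets_\<nu>: "sets \<nu> = sets borel" by (simp add: \<nu>_def)
  have meas_\<nu>: "measurable \<nu> = measurable borel" by (rule ext, rule measurable_cong_sets) (auto simp: sets_\<nu>)
  have \<nu>_int: "(\<integral>\<^sup>+ s. ennreal (min 1 (s\<^sup>2)) \<partial>\<nu>) < \<infinity>"
  proof -
    have "(\<integral>\<^sup>+ s. ennreal (min 1 (s\<^sup>2)) \<partial>\<nu>) = (\<integral>\<^sup>+ s. ennreal (f s) * ennreal (min 1 (s\<^sup>2)) \<partial>M)"
      unfolding \<nu>_def by (subst nn_integral_density) auto
    also have "\<dots> = (\<integral>\<^sup>+ s. ennreal (g * indicator (- {0}) s) \<partial>M)"
      by (intro nn_integral_cong) (simp add: fw f0 flip: ennreal_mult)
    also have "\<dots> \<le> (\<integral>\<^sup>+ s. ennreal g \<partial>M)"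
      using g by (intro nn_integral_mono ennreal_leI) (auto simp: indicator_def)
    also have "\<dots> < \<infinity>" by (simp add: emeasure_space_1 del: space_eq_univ)
    finally show ?thesis .
  qed
  have \<nu>0: "emeasure \<nu> {0} = 0"
    unfolding \<nu>_def by (subst emeasure_density) (auto simp: f_def indicator_def nn_integral_0_iff_AE)
  have "sigma_finite_measure \<nu>"
    unfolding \<nu>_def by (subst sigma_finite_iff_density_finite) auto
  define s2 where "s2 = g * prob {0}"
  \<comment> \<open>The difference of the two truncations vanishes on \<open>[-1, 1]\<close> and is
    \<open>sgn s\<close> outside, hence is bounded by \<open>min 1 (s^2)\<close> and
    \<open>\<nu>\<close>-integrable.\<close>
  define d where "d s = clamp1 s - s * indicator {-1..1} s" for s
  have d_meas[measurable]: "d \<in> borel_measurable borel" unfolding d_def by measurable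
  have d_bd: "\<bar>d s\<bar> \<le> min 1 (s\<^sup>2)" for s
  proof (cases "\<bar>s\<bar> \<le> 1")
    case True
    then show ?thesis by (simp add: d_def clamp1_cases indicator_def abs_le_iff)
  next
    case False
    then have "d s = sgn s" by (auto simp: d_def clamp1_cases indicator_def)
    moreover have "min 1 (s\<^sup>2) = 1" using False by (intro min_one_square_cases) simp
    ultimately show ?thesis by (simp add: abs_sgn_eq)
  qed
  have w_int: "integrable \<nu> (\<lambda>s. min 1 (s\<^sup>2))"
    using \<nu>_int by (intro integrableI_nonneg) (auto simp: meas_\<nu>)
  have d_int: "integrable \<nu> d"
    by (rule Bochner_Integration.integrable_bound[OF w_int]) (use d_bd in \<open>auto simp: meas_\<nu>\<close>)
  define b' where "b' = b - (LINT s|\<nu>. d s)"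
  have kernel_int: "complex_integrable M (levy_kernel t)" for t
    by (rule integrable_const_bound[where B="t\<^sup>2 + \<bar>t\<bar> + 2"]) (auto simp: levy_kernel_bound)
  have "\<psi> t = levy_char b' s2 \<nu> t" for t
  proof -
    define L where "L s = iexp (t * s) - 1 - \<i> * complex_of_real (t * clamp1 s)" for s
    have L_meas[measurable]: "L \<in> borel_measurable borel" unfolding L_def by measurable
    have Lf: "f s *\<^sub>R L s = complex_of_real g * (indicator (- {0}) s *\<^sub>R levy_kernel t s)" for s
      by (cases "s = 0") (simp_all add: f_def L_def levy_kernel_def scaleR_conv_of_real)
    have ind_int: "complex_integrable M (\<lambda>s. indicator (- {0}) s *\<^sub>R levy_kernel t s)"
      by (rule Bochner_Integration.integrable_bound[OF kernel_int[of t]]) (auto simp: indicator_def)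
    have L_int: "complex_integrable \<nu> L"
      unfolding \<nu>_def
    proof (subst integrable_density)
      show "complex_integrable M (\<lambda>s. f s *\<^sub>R L s)"
        unfolding Lf by (intro integrable_mult_right ind_int)
    qed (auto simp: f0)
    have nu_L: "(CLINT s|\<nu>. L s) = complex_of_real g * (CLINT s|M. indicator (- {0}) s *\<^sub>R levy_kernel t s)"
      unfolding \<nu>_def
    proof (subst integral_density)
      show "(CLINT s|M. f s *\<^sub>R L s) = complex_of_real g * (CLINT s|M. indicator (- {0}) s *\<^sub>R levy_kernel t s)"
        unfolding Lf by (rule integral_mult_right_zero)
    qed (auto simp: f0)
    have "(CLINT s|M. levy_kernel t s) =
       (CLINT s|M. (indicator {0} s * - (t\<^sup>2 / 2)) *\<^sub>R 1 + indicator (- {0}) s *\<^sub>R levy_kernel t s)"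
      by (intro Bochner_Integration.integral_cong refl) (auto simp: indicator_def levy_kernel_def scaleR_conv_of_real)
    also have "\<dots> = (CLINT s|M. (indicator {0} s * - (t\<^sup>2 / 2)) *\<^sub>R 1) + (CLINT s|M. indicator (- {0}) s *\<^sub>R levy_kernel t s)"
    proof (rule Bochner_Integration.integral_add)
      have "integrable M (\<lambda>s. indicator {0} s * - (t\<^sup>2 / 2))"
        by (intro integrable_mult_left integrable_real_indicator) (auto simp: emeasure_eq_measure)
      then show "complex_integrable M (\<lambda>s. (indicator {0} s * - (t\<^sup>2 / 2)) *\<^sub>R 1)" by (rule integrable_scaleR_left)
    qed (rule ind_int)
    also have "(CLINT s|M. (indicator {0} s * - (t\<^sup>2 / 2)) *\<^sub>R 1) = complex_of_real (prob {0} * - (t\<^sup>2 / 2))"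
      by (simp add: scaleR_conv_of_real del: of_real_mult of_real_minus)
    finally have "(CLINT s|M. levy_kernel t s) = complex_of_real (prob {0} * - (t\<^sup>2 / 2)) +
        (CLINT s|M. indicator (- {0}) s *\<^sub>R levy_kernel t s)" .
    from arg_cong[OF this, of "\<lambda>z. complex_of_real g * z"]
    have K: "complex_of_real g * (CLINT s|M. levy_kernel t s) = - complex_of_real (s2 * t\<^sup>2 / 2) + (CLINT s|\<nu>. L s)"
      unfolding nu_L s2_def distrib_left by simp
    have "(CLINT s|\<nu>. iexp (t * s) - 1 - \<i> * complex_of_real (t * s * indicator {-1..1} s)) =
       (CLINT s|\<nu>. L s + (\<i> * t) * complex_of_real (d s))"
      by (intro Bochner_Integration.integral_cong refl) (simp add: L_def d_def algebra_simps)
    also have "\<dots> = (CLINT s|\<nu>. L s) + (\<i> * t) * complex_of_real (LINT s|\<nu>. d s)"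
      using L_int d_int by simp
    finally show ?thesis
      unfolding levy_char_def \<psi> K by (simp add: b'_def algebra_simps)
  qed
  moreover have "char_triplet b' s2 \<nu>"
    unfolding char_triplet_def using g \<nu>_int \<nu>0 \<open>sigma_finite_measure \<nu>\<close> by (simp add: s2_def sets_\<nu>)
  ultimately show ?thesis by blast
qed

lemma real_of_complex_limit:
  assumes "(\<lambda>k. \<i> * complex_of_real (b k)) \<longlonglongrightarrow> l"
  shows "b \<longlonglongrightarrow> Im l"
  using tendsto_Im[OF assms] by simp

text \<open>The rescaled exponent is a drift plus the integral of the bounded continuous kernel
  against the measure with \<open>\<mu> k\<close>-density \<open>N k * w\<close>. Hypothesis
  \<open>bd\<close> controls masses and tails of these measures; the drifts need no separate bound,
  as they converge once the integrals do.\<close>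

theorem levy_khinchine_limit:
  fixes \<mu> :: "nat \<Rightarrow> real measure" and N :: "nat \<Rightarrow> real" and \<psi> :: "real \<Rightarrow> complex"
  assumes rd: "\<And>k. real_distribution (\<mu> k)" and N: "\<And>k. N k > 0"
    and lim: "\<And>t. (\<lambda>k. N k * (char (\<mu> k) t - 1)) \<longlonglongrightarrow> \<psi> t"
    and bd: "\<And>k t. \<bar>t\<bar> \<le> 1 \<Longrightarrow> cmod (N k * (char (\<mu> k) t - 1)) \<le> C * \<bar>t\<bar>"
  shows "\<exists>b s2 \<nu>. char_triplet b s2 \<nu> \<and> (\<forall>t. \<psi> t = levy_char b s2 \<nu> t)"
proof -
  interpret \<mu>: real_distribution "\<mu> k" for k by (rule rd)
  define w where "w s = min 1 (s\<^sup>2)" for s :: real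
  have w01: "0 \<le> w s" "w s \<le> 1" for s by (auto simp: w_def)
  have w_meas[measurable]: "w \<in> borel_measurable borel" unfolding w_def by measurable
  have C0: "0 \<le> C" using order_trans[OF norm_ge_zero bd[of 1 0]] by simp
  \<comment> \<open>The linear bound near the origin becomes a moment bound at every scale
    \<open>u \<le> 1\<close>: \<open>u = 1\<close> controls the total mass \<open>g k\<close>, and
    \<open>u = 1 / R\<close> the mass beyond \<open>R\<close>.\<close>
  have trunc: "N k * (LINT s|\<mu> k. min 1 ((u * s)\<^sup>2)) \<le> 8 * C * u" if "0 < u" "u \<le> 1" for u k
  proof -
    have "(LINT s|\<mu> k. min 1 ((u * s)\<^sup>2)) \<le> 8 * (C * u / N k)"
    proof (rule \<mu>.truncated_moment_le_char[OF \<open>0 < u\<close>])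
      fix t :: real assume t: "0 \<le> t" "t \<le> u"
      have "N k * Re (1 - char (\<mu> k) t) = Re (- (N k * (char (\<mu> k) t - 1)))" by (simp add: algebra_simps)
      also have "\<dots> \<le> cmod (- (N k * (char (\<mu> k) t - 1)))" by (rule complex_Re_le_cmod)
      also have "\<dots> \<le> C * \<bar>t\<bar>" unfolding norm_minus_cancel by (rule bd) (use t that in auto)
      also have "\<dots> \<le> C * u" using t C0 by (intro mult_left_mono) auto
      finally show "Re (1 - char (\<mu> k) t) \<le> C * u / N k"
        using N[of k] by (simp add: field_simps)
    qed
    then show ?thesis using N[of k] by (simp add: field_simps)
  qed
  define g where "g k = N k * (LINT s|\<mu> k. w s)" for k
  have w_int: "integrable (\<mu> k) w" for k
    by (rule \<mu>.integrable_const_bound[where B=1]) (use w01 in auto)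
  have g_ge: "0 \<le> g k" for k
    unfolding g_def using N[of k] w01 by (intro mult_nonneg_nonneg integral_nonneg) auto
  have g_le: "g k \<le> 8 * C" for k
    using trunc[of 1 k] by (simp add: g_def w_def)
  define b where "b k = N k * (LINT s|\<mu> k. clamp1 s)" for k
  define I where "I t k = (CLINT s|\<mu> k. w s *\<^sub>R levy_kernel t s)" for t k
  have wk_int: "complex_integrable (\<mu> k) (\<lambda>s. w s *\<^sub>R levy_kernel t s)" for t k
  proof (rule \<mu>.integrable_const_bound[where B="t\<^sup>2 + \<bar>t\<bar> + 2"])
    have "w s * cmod (levy_kernel t s) \<le> 1 * (t\<^sup>2 + \<bar>t\<bar> + 2)" for s
      using w01 levy_kernel_bound by (intro mult_mono) auto
    then show "AE s in \<mu> k. cmod (w s *\<^sub>R levy_kernel t s) \<le> t\<^sup>2 + \<bar>t\<bar> + 2" using w01 by simp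
  qed auto
  have decomp: "N k * (char (\<mu> k) t - 1) = \<i> * complex_of_real (t * b k) + N k * I t k" for k t
    unfolding \<mu>.char_minus_one_eq_levy_kernel by (simp add: b_def I_def w_def algebra_simps)
  obtain l r where lr: "strict_mono r" "(g \<circ> r) \<longlonglongrightarrow> l" "l \<in> {0..8*C}"
    using compact_Icc[of 0 "8*C", unfolded compact_def, rule_format, of g] g_ge g_le by auto
  have "\<exists>b g M. real_distribution M \<and> g \<ge> 0 \<and>
    (\<forall>t. \<psi> t = \<i> * complex_of_real (t * b) + complex_of_real g * (CLINT s|M. levy_kernel t s))"
  \<comment> \<open>If the masses vanish in the limit, they cannot be normalized; but then the
    kernel integrals vanish too and \<open>\<psi>\<close> is a pure drift. With \<open>g = 0\<close>
    any distribution serves as \<open>M\<close>.\<close>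
  proof (cases "l = 0")
    case True
    have I0: "(\<lambda>k. N (r k) * I t (r k)) \<longlonglongrightarrow> 0" for t
    proof (rule Lim_null_comparison)
      have "cmod (N k * I t k) \<le> (t\<^sup>2 + \<bar>t\<bar> + 2) * g k" for k
      proof -
        have "cmod (I t k) \<le> (LINT s|\<mu> k. cmod (w s *\<^sub>R levy_kernel t s))"
          unfolding I_def by (rule integral_norm_bound)
        also have "\<dots> \<le> (LINT s|\<mu> k. w s * (t\<^sup>2 + \<bar>t\<bar> + 2))"
          using wk_int w_int w01 levy_kernel_bound
          by (intro integral_mono integrable_norm integrable_mult_left) (auto intro!: mult_left_mono)
        also have "\<dots> = (t\<^sup>2 + \<bar>t\<bar> + 2) * (LINT s|\<mu> k. w s)" by simp
        finally show ?thesis using N[of k] by (simp add: norm_mult g_def mult.left_commute mult_left_mono)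
      qed
      then show "eventually (\<lambda>k. cmod (N (r k) * I t (r k)) \<le> (t\<^sup>2 + \<bar>t\<bar> + 2) * g (r k)) sequentially" by simp
      show "(\<lambda>k. (t\<^sup>2 + \<bar>t\<bar> + 2) * g (r k)) \<longlonglongrightarrow> 0"
        using tendsto_mult_left[OF lr(2), of "t\<^sup>2 + \<bar>t\<bar> + 2"] True by (simp add: comp_def)
    qed
    have lim_r: "(\<lambda>k. N (r k) * (char (\<mu> (r k)) t - 1)) \<longlonglongrightarrow> \<psi> t" for t
      using LIMSEQ_subseq_LIMSEQ[OF lim[of t] lr(1)] by (simp add: comp_def)
    have lim_b: "(\<lambda>k. \<i> * complex_of_real (t * b (r k))) \<longlonglongrightarrow> \<psi> t" for t
      using tendsto_diff[OF lim_r[of t] I0[of t]] unfolding decomp by simp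
    define \<beta> where "\<beta> = Im (\<psi> 1)"
    have \<beta>: "(\<lambda>k. b (r k)) \<longlonglongrightarrow> \<beta>"
      using real_of_complex_limit[OF lim_b[of 1]] by (simp add: \<beta>_def)
    have "\<psi> t = \<i> * complex_of_real (t * \<beta>)" for t
      by (rule LIMSEQ_unique[OF lim_b]) (intro tendsto_intros \<beta>)
    then show ?thesis using rd[of 0] by (intro exI[of _ \<beta>] exI[of _ 0] exI[of _ "\<mu> 0"]) simp
  next
    case False
    then have l: "l > 0" using lr by simp
    have "eventually (\<lambda>k. l / 2 < g (r k)) sequentially"
      using order_tendstoD(1)[OF lr(2), of "l / 2"] l by simp
    then obtain K where K: "\<And>k. k \<ge> K \<Longrightarrow> l / 2 < g (r k)" by (auto simp: eventually_sequentially)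
    \<comment> \<open>Dropping an initial segment keeps the masses above \<open>l / 2\<close>, so
      that every \<open>P k\<close> is a genuine probability measure.\<close>
    define q where "q k = r (k + K)" for k
    have q: "strict_mono q" using lr(1) by (simp add: q_def strict_mono_def)
    have gq: "l / 2 < g (q k)" for k using K by (simp add: q_def)
    have gq0: "0 < g (q k)" for k using gq[of k] l by linarith
    have lim_g: "(\<lambda>k. g (q k)) \<longlonglongrightarrow> l"
      using LIMSEQ_ignore_initial_segment[OF lr(2), of K] by (simp add: q_def)
    define p where "p k s = N (q k) * w s / g (q k)" for k s
    define P where "P k = density (\<mu> (q k)) (\<lambda>s. ennreal (p k s))" for k
    have p_meas[measurable]: "p k \<in> borel_measurable borel" for k unfolding p_def by measurable
    have p0: "0 \<le> p k s" for k s using N[of "q k"] gq0[of k] w01[of s] by (simp add: p_def)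
    have p_int: "integrable (\<mu> (q k)) (p k)" for k
      unfolding p_def using w_int by (intro integrable_divide integrable_mult_right) auto
    have P_emeasure: "emeasure (P k) A = ennreal (LINT s|\<mu> (q k). p k s * indicator A s)" if [measurable]: "A \<in> sets borel" for k A
    proof -
      have "emeasure (P k) A = (\<integral>\<^sup>+ s. ennreal (p k s * indicator A s) \<partial>\<mu> (q k))"
        unfolding P_def by (subst emeasure_density) (auto intro!: nn_integral_cong simp: indicator_def)
      also have "\<dots> = ennreal (LINT s|\<mu> (q k). p k s * indicator A s)"
        using p_int p0 by (intro nn_integral_eq_integral integrable_real_mult_indicator) auto
      finally show ?thesis .
    qed
    have P_rd: "real_distribution (P k)" for k
    proof -
      have "emeasure (P k) UNIV = 1"
      proof -
        have "(LINT s|\<mu> (q k). p k s) = N (q k) * (LINT s|\<mu> (q k). w s) / g (q k)"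
          unfolding p_def by (simp only: integral_divide_zero integral_mult_right_zero)
        also have "\<dots> = 1" using gq0[of k] by (simp only: g_def[symmetric]) simp
        finally show ?thesis using P_emeasure[of UNIV k] by simp
      qed
      then have "prob_space (P k)" by (intro prob_spaceI) (simp add: P_def)
      then show ?thesis unfolding real_distribution_def real_distribution_axioms_def by (simp add: P_def)
    qed
    interpret P: real_distribution "P k" for k by (rule P_rd)
    \<comment> \<open>On \<open>\<bar>s\<bar> > R\<close> the truncated square at scale
      \<open>1 / R\<close> equals \<open>1\<close>. \<open>trunc\<close> then gives
      \<open>8 * C / R\<close>, and the normalizing mass above \<open>l / 2\<close> doubles the
      constant.\<close>
    have tail: "measure (P k) {s. R < \<bar>s\<bar>} \<le> (16 * C / l) / R" if R: "R \<ge> 1" for R k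
    proof -
      have "measure (P k) {s. R < \<bar>s\<bar>} = (LINT s|\<mu> (q k). p k s * indicator {s. R < \<bar>s\<bar>} s)"
        using P_emeasure[of "{s. R < \<bar>s\<bar>}" k] p0
        by (simp add: measure_def enn2real_ennreal integral_nonneg)
      also have "\<dots> \<le> (LINT s|\<mu> (q k). N (q k) / g (q k) * min 1 ((1 / R * s)\<^sup>2))"
      proof (rule integral_mono)
        show "integrable (\<mu> (q k)) (\<lambda>s. p k s * indicator {s. R < \<bar>s\<bar>} s)"
          using p_int by (intro integrable_real_mult_indicator) auto
        show "integrable (\<mu> (q k)) (\<lambda>s. N (q k) / g (q k) * min 1 ((1 / R * s)\<^sup>2))"
          by (intro integrable_mult_right \<mu>.integrable_const_bound[where B=1]) auto
        fix s
        show "p k s * indicator {s. R < \<bar>s\<bar>} s \<le> N (q k) / g (q k) * min 1 ((1 / R * s)\<^sup>2)"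
        proof (cases "R < \<bar>s\<bar>")
          case True
          then have "1 < \<bar>1 / R * s\<bar>" using R by (simp add: abs_mult field_simps)
          then have "min 1 ((1 / R * s)\<^sup>2) = 1" by (rule min_one_square_cases)
          then show ?thesis
            using True N[of "q k"] gq0[of k] w01(2)[of s] by (simp add: p_def divide_right_mono mult_left_le)
        next
          case False
          then show ?thesis using N[of "q k"] gq0[of k] by simp
        qed
      qed
      also have "\<dots> = N (q k) * (LINT s|\<mu> (q k). min 1 ((1 / R * s)\<^sup>2)) / g (q k)" by simp
      also have "\<dots> \<le> (8 * C * (1 / R)) / g (q k)"
        using R gq0[of k] by (intro divide_right_mono trunc) auto
      also have "\<dots> \<le> (8 * C * (1 / R)) / (l / 2)"
        using R C0 l gq[of k] gq0[of k] by (intro divide_left_mono) auto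
      also have "\<dots> = (16 * C / l) / R" by simp
      finally show ?thesis .
    qed
    have "tight P"
      unfolding tight_def
    proof (intro conjI allI impI P_rd)
      fix e :: real assume e: "e > 0"
      define R where "R = max 1 (16 * C / l / e + 1)"
      have R: "R \<ge> 1" "16 * C / l / e < R" by (auto simp: R_def)
      \<comment> \<open>Doubling \<open>R\<close> lets the half-open interval contain all of
        \<open>[-R, R]\<close>.\<close>
      have "1 - e < measure (P k) {-2*R<..2*R}" for k
      proof -
        have "16 * C / l < R * e" using R(2) unfolding pos_divide_less_eq[OF e] .
        then have "16 * C / l / R < e" using R(1) by (subst pos_divide_less_eq) (auto simp: mult.commute)
        then have "measure (P k) {s. R < \<bar>s\<bar>} < e" using tail[OF R(1), of k] by linarith
        moreover have "measure (P k) (UNIV - {s. R < \<bar>s\<bar>}) = 1 - measure (P k) {s. R < \<bar>s\<bar>}"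
          using P.prob_compl[of "{s. R < \<bar>s\<bar>}" k] by simp
        moreover have "measure (P k) (UNIV - {s. R < \<bar>s\<bar>}) \<le> measure (P k) {-2*R<..2*R}"
          using R by (intro P.finite_measure_mono) auto
        ultimately show ?thesis by linarith
      qed
      moreover have "-2*R < 2*R" using R by simp
      ultimately show "\<exists>a b. a < b \<and> (\<forall>n. 1 - e < measure (P n) {a<..b})" by blast
    qed
    from tight_imp_convergent_subsubsequence[OF this strict_mono_id]
    obtain v M where v: "strict_mono v" "real_distribution M" "weak_conv_m (P \<circ> id \<circ> v) M" by auto
    have weak: "(\<lambda>k. integral\<^sup>L (P (v k)) (levy_kernel t)) \<longlonglongrightarrow> integral\<^sup>L M (levy_kernel t)" for t
      using weak_conv_imp_integral_bdd_continuous_conv[OF _ v(2,3) isCont_levy_kernel levy_kernel_bound] P_rd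
      by (simp add: comp_def)
    have PI: "complex_of_real (g (q k)) * integral\<^sup>L (P k) (levy_kernel t) = N (q k) * I t (q k)" for t k
    proof -
      have "integral\<^sup>L (P k) (levy_kernel t) = (CLINT s|\<mu> (q k). p k s *\<^sub>R levy_kernel t s)"
        unfolding P_def by (subst integral_density) (auto simp: p0)
      also have "\<dots> = (CLINT s|\<mu> (q k). (N (q k) / g (q k)) *\<^sub>R (w s *\<^sub>R levy_kernel t s))"
        by (simp add: p_def)
      also have "\<dots> = (N (q k) / g (q k)) *\<^sub>R I t (q k)"
        unfolding I_def by (rule integral_scaleR_right)
      finally show ?thesis using gq0[of k] by (simp add: scaleR_conv_of_real)
    qed
    define z where "z k = q (v k)" for k
    have z: "strict_mono z" using q v(1) by (simp add: z_def strict_mono_def)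
    have lim_g': "(\<lambda>k. g (z k)) \<longlonglongrightarrow> l"
      using LIMSEQ_subseq_LIMSEQ[OF lim_g v(1)] by (simp add: comp_def z_def)
    have lim_I: "(\<lambda>k. N (z k) * I t (z k)) \<longlonglongrightarrow> complex_of_real l * integral\<^sup>L M (levy_kernel t)" for t
      using tendsto_mult[OF tendsto_of_real[OF lim_g', where 'a=complex] weak[of t]] unfolding z_def PI .
    have lim_z: "(\<lambda>k. N (z k) * (char (\<mu> (z k)) t - 1)) \<longlonglongrightarrow> \<psi> t" for t
      using LIMSEQ_subseq_LIMSEQ[OF lim[of t] z] by (simp add: comp_def)
    have lim_b: "(\<lambda>k. \<i> * complex_of_real (t * b (z k))) \<longlonglongrightarrow> \<psi> t - complex_of_real l * integral\<^sup>L M (levy_kernel t)" for t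
      using tendsto_diff[OF lim_z[of t] lim_I[of t]] unfolding decomp by simp
    \<comment> \<open>The limit of the drifts is identified at \<open>t = 1\<close>; linearity in
      \<open>t\<close> then yields the formula for all \<open>t\<close>.\<close>
    define \<beta> where "\<beta> = Im (\<psi> 1 - complex_of_real l * integral\<^sup>L M (levy_kernel 1))"
    have \<beta>: "(\<lambda>k. b (z k)) \<longlonglongrightarrow> \<beta>"
      using real_of_complex_limit[OF lim_b[of 1]] by (simp add: \<beta>_def)
    have "\<psi> t - complex_of_real l * integral\<^sup>L M (levy_kernel t) = \<i> * complex_of_real (t * \<beta>)" for t
      by (rule LIMSEQ_unique[OF lim_b]) (intro tendsto_intros \<beta>)
    then have "\<psi> t = \<i> * complex_of_real (t * \<beta>) + complex_of_real l * integral\<^sup>L M (levy_kernel t)" for t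
      by (simp add: algebra_simps)
    then show ?thesis using v(2) l by (intro exI[of _ \<beta>] exI[of _ l] exI[of _ M]) simp
  qed
  then show ?thesis using levy_char_if_kernel_integral by blast
qed

section \<open>Exponents of infinitely divisible characteristic functions\<close>

text \<open>Within distance \<open>1 / 3\<close> of \<open>1\<close> the real part is positive, so
  arguments lie strictly between \<open>- pi / 2\<close> and \<open>pi / 2\<close>. Multiplying by
  one more factor \<open>z\<close> then keeps the sum of arguments inside the principal branch; this
  is why all intermediate powers must be controlled.\<close>

lemma Ln_power_near_1:
  fixes z :: complex
  assumes "\<And>j. j \<le> m \<Longrightarrow> cmod (z ^ j - 1) \<le> 1 / 3" "j \<le> m"
  shows "Ln (z ^ j) = of_nat j * Ln z"
  using assms(2)
proof (induction j)
  case (Suc j)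
  have near: "w \<noteq> 0 \<and> \<bar>Im (Ln w)\<bar> < pi / 2" if "cmod (w - 1) \<le> 1 / 3" for w
  proof -
    have "\<bar>Re (w - 1)\<bar> \<le> 1 / 3" using abs_Re_le_cmod[of "w - 1"] that by linarith
    then have "0 < Re w" unfolding minus_complex.simps one_complex.simps by linarith
    moreover from this have "w \<noteq> 0" by auto
    ultimately show ?thesis using Re_Ln_pos_lt by blast
  qed
  have "cmod (z ^ j - 1) \<le> 1 / 3" "cmod (z - 1) \<le> 1 / 3"
    using assms(1)[of j] assms(1)[of 1] Suc.prems by auto
  then have "Ln (z ^ j * z) = Ln (z ^ j) + Ln z"
    using near[of "z ^ j"] near[of z] by (intro Ln_times_simple) auto
  then show ?case using Suc by (simp add: algebra_simps)
qed simp

lemma cmod_Ln_near_1: "cmod (w - 1) \<le> 1 / 3 \<Longrightarrow> cmod (Ln w) \<le> 1"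
  using norm_Ln_le[of "w - 1"] by simp

lemma eventually_const_seq:
  assumes "\<And>k. k \<ge> K \<Longrightarrow> X (Suc k) = X k" "k \<ge> K"
  shows "X k = X K"
  using assms(2) by (induction k rule: dec_induct) (simp_all add: assms(1))

text \<open>The exponential formula is claimed uniformly on bounded sets of \<open>t\<close>, since
  it will be inserted at all values of a bounded function simultaneously. The only quantitative
  input is \<open>small\<close>, which comes from the triple norm.\<close>

theorem root_exponent:
  fixes \<phi> :: "nat \<Rightarrow> real \<Rightarrow> complex" and D :: nat and \<eta> :: real
  assumes D: "D \<ge> 2" and \<eta>: "\<eta> > 0"
    and root: "\<And>k t. \<phi> k t = \<phi> (Suc k) t ^ D"
    and cont: "\<And>k t. isCont (\<phi> k) t"
    and zero: "\<And>k. \<phi> k 0 = 1"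
    and small: "\<And>k t m. t\<^sup>2 * ((real m / real D ^ k)\<^sup>2 + real m / real D ^ k) < \<eta>\<^sup>2 \<Longrightarrow> cmod (\<phi> k t ^ m - 1) \<le> 1 / 3"
  shows "\<exists>\<psi> C. (\<forall>t. isCont \<psi> t) \<and> \<psi> 0 = 0 \<and> (\<forall>t. cmod (\<psi> t) \<le> C * (\<bar>t\<bar> + t\<^sup>2)) \<and>
    (\<forall>T. \<exists>K. \<forall>k\<ge>K. \<forall>t. \<bar>t\<bar> \<le> T \<longrightarrow> \<phi> k t = exp (\<psi> t / complex_of_real (real D ^ k)))"
proof -
  define N where "N k = real D ^ k" for k
  have N: "N k > 0" "N (Suc k) = D * N k" for k using D by (auto simp: N_def)
  \<comment> \<open>Level \<open>k\<close> is fine enough for \<open>t\<close>: this is the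
    condition of \<open>ok_small\<close> for the first power.\<close>
  define ok where "ok k t \<longleftrightarrow> 2 * (\<bar>t\<bar> * \<eta> + t\<^sup>2) \<le> \<eta>\<^sup>2 * N k" for k t
  define B where "B t = 4 * (\<bar>t\<bar> * \<eta> + t\<^sup>2) / \<eta>\<^sup>2" for t
  \<comment> \<open>With \<open>v = m / N k\<close> the premise says
    \<open>v (|t| \<eta> + t^2) \<le> \<eta>^2 / 2\<close>. Its parts give
    \<open>t^2 v^2 \<le> \<eta>^2 / 4\<close> and \<open>t^2 v \<le> \<eta>^2 / 2\<close>, and the
    sum stays below \<open>\<eta>^2\<close>.\<close>
  have ok_small: "cmod (\<phi> k t ^ m - 1) \<le> 1 / 3" if "real m * (2 * (\<bar>t\<bar> * \<eta> + t\<^sup>2)) \<le> \<eta>\<^sup>2 * N k" for k t m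
  proof (rule small)
    define v where "v = real m / N k"
    have v0: "v \<ge> 0" using N(1)[of k] by (simp add: v_def)
    have v: "v * (\<bar>t\<bar> * \<eta> + t\<^sup>2) \<le> \<eta>\<^sup>2 / 2"
      using that N(1)[of k] by (simp add: v_def field_simps)
    have "v * \<bar>t\<bar> * \<eta> \<le> \<eta>\<^sup>2 / 2" using v mult_nonneg_nonneg[OF v0 zero_le_power2[of t]] by (simp add: algebra_simps)
    then have "v * \<bar>t\<bar> \<le> \<eta> / 2" using \<eta> by (simp add: power2_eq_square field_simps)
    then have "(v * \<bar>t\<bar>)\<^sup>2 \<le> (\<eta> / 2)\<^sup>2" using v0 by (intro power_mono) auto
    then have 1: "t\<^sup>2 * v\<^sup>2 \<le> \<eta>\<^sup>2 / 4" by (simp add: power_mult_distrib power_divide mult.commute)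
    have "0 \<le> v * (\<bar>t\<bar> * \<eta>)" using v0 \<eta> by simp
    then have 2: "t\<^sup>2 * v \<le> \<eta>\<^sup>2 / 2" using v by (simp add: algebra_simps)
    have "0 < \<eta>\<^sup>2" using \<eta> by simp
    then show "t\<^sup>2 * ((real m / real D ^ k)\<^sup>2 + real m / real D ^ k) < \<eta>\<^sup>2"
      using 1 2 unfolding v_def N_def distrib_left by linarith
  qed
  have ok_near: "cmod (\<phi> k t - 1) \<le> 1 / 3" if "ok k t" for k t
    using ok_small[of 1 t k] that by (simp add: ok_def)
  \<comment> \<open>Passing to level \<open>Suc k\<close> multiplies \<open>N\<close> by
    \<open>D\<close>, so admissibility at \<open>k\<close> controls all powers up to
    \<open>D\<close> of the finer function. Its principal logarithm, times \<open>D\<close>, is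
    therefore that of the coarser one.\<close>
  have ok_step: "N (Suc k) * Ln (\<phi> (Suc k) t) = N k * Ln (\<phi> k t)" if "ok k t" for k t
  proof -
    have "Ln (\<phi> (Suc k) t ^ D) = of_nat D * Ln (\<phi> (Suc k) t)"
    proof (rule Ln_power_near_1)
      fix j assume j: "j \<le> D"
      have "real j * (2 * (\<bar>t\<bar> * \<eta> + t\<^sup>2)) \<le> real D * (\<eta>\<^sup>2 * N k)"
        by (rule mult_mono) (use that j \<eta> in \<open>auto simp: ok_def\<close>)
      then show "cmod (\<phi> (Suc k) t ^ j - 1) \<le> 1 / 3"
        by (intro ok_small) (simp add: N(2) mult.left_commute)
    qed simp
    then show ?thesis unfolding root[of k t] N(2) by simp
  qed
  have ok_mono: "ok j s" if "ok k t" "\<bar>s\<bar> \<le> \<bar>t\<bar>" "k \<le> j" for k t j s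
  proof -
    have "2 * (\<bar>s\<bar> * \<eta> + s\<^sup>2) \<le> 2 * (\<bar>t\<bar> * \<eta> + t\<^sup>2)"
      using that(2) \<eta> by (intro mult_left_mono add_mono mult_right_mono) (auto simp: abs_le_square_iff)
    also have "\<dots> \<le> \<eta>\<^sup>2 * N k" using that(1) by (simp add: ok_def)
    also have "\<dots> \<le> \<eta>\<^sup>2 * N j" using that(3) D by (intro mult_left_mono) (auto simp: N_def power_increasing)
    finally show ?thesis by (simp add: ok_def)
  qed
  have N_lim: "filterlim N at_top sequentially"
    unfolding N_def using D
    by (intro filterlim_at_infinity_imp_filterlim_at_top filterlim_realpow_sequentially_gt1 always_eventually) auto
  have ok_ex: "\<exists>k. ok k t" for t
  proof -
    have "eventually (\<lambda>k. 2 * (\<bar>t\<bar> * \<eta> + t\<^sup>2) / \<eta>\<^sup>2 \<le> N k) sequentially"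
      using N_lim by (simp add: filterlim_at_top)
    then obtain k where "2 * (\<bar>t\<bar> * \<eta> + t\<^sup>2) / \<eta>\<^sup>2 \<le> N k" by (auto simp: eventually_sequentially)
    then show ?thesis using \<eta> by (auto simp: ok_def field_simps intro!: exI[of _ k])
  qed
  \<comment> \<open>Any admissible level would do; the least one makes \<open>\<psi>\<close>
    definite, and \<open>\<psi>_eq\<close> shows that every other admissible level gives the same
    value.\<close>
  define \<kappa> where "\<kappa> t = (LEAST k. ok k t)" for t
  have \<kappa>: "ok (\<kappa> t) t" for t unfolding \<kappa>_def using ok_ex by (rule LeastI_ex)
  define \<psi> where "\<psi> t = N (\<kappa> t) * Ln (\<phi> (\<kappa> t) t)" for t
  have \<psi>_eq: "\<psi> t = N k * Ln (\<phi> k t)" if "ok k t" for k t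
  proof -
    have "\<kappa> t \<le> k" unfolding \<kappa>_def using that by (rule Least_le)
    then show ?thesis unfolding \<psi>_def
      using eventually_const_seq[of "\<kappa> t" "\<lambda>k. N k * Ln (\<phi> k t)" k] ok_step ok_mono[OF \<kappa>[of t] order_refl] by simp
  qed
  have exp_eq: "\<phi> k t = exp (\<psi> t / complex_of_real (real D ^ k))" if "ok k t" for k t
  proof -
    have "\<phi> k t \<noteq> 0" using ok_near[OF that] by auto
    moreover have "complex_of_real (N k) \<noteq> 0" using N(1)[of k] by simp
    ultimately show ?thesis unfolding \<psi>_eq[OF that] by (simp add: N_def)
  qed
  have \<psi>0: "\<psi> 0 = 0" using \<psi>_eq[OF \<kappa>[of 0]] by (simp add: zero)
  have bound: "cmod (\<psi> t) \<le> B t" for t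
  proof (cases "t = 0")
    case False
    define k where "k = \<kappa> t"
    define A where "A = 2 * (\<bar>t\<bar> * \<eta> + t\<^sup>2)"
    have A: "A > 0" using False \<eta> by (auto simp: A_def intro!: add_pos_pos)
    have k: "A \<le> \<eta>\<^sup>2 * N k" using \<kappa>[of t] by (simp add: k_def ok_def A_def)
    \<comment> \<open>The largest power that \<open>ok_small\<close> controls. Since
      \<open>m Ln (\<phi> k t)\<close> is the logarithm of a number near \<open>1\<close>,
      \<open>Ln (\<phi> k t)\<close> is at most \<open>1 / m\<close>. The floor loses at most a
      factor \<open>2\<close>, which accounts for the \<open>4\<close> in \<open>B\<close>.\<close>
    define m where "m = nat \<lfloor>\<eta>\<^sup>2 * N k / A\<rfloor>"
    have q1: "1 \<le> \<eta>\<^sup>2 * N k / A" using k A by simp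
    have m1: "real m \<le> \<eta>\<^sup>2 * N k / A" using q1 by (simp add: m_def)
    have m2: "\<eta>\<^sup>2 * N k / A \<le> 2 * real m"
    proof -
      have f1: "1 \<le> \<lfloor>\<eta>\<^sup>2 * N k / A\<rfloor>" using q1 by simp
      then have "real m = of_int \<lfloor>\<eta>\<^sup>2 * N k / A\<rfloor>" by (simp add: m_def)
      moreover have "(1::real) \<le> of_int \<lfloor>\<eta>\<^sup>2 * N k / A\<rfloor>" using f1 by linarith
      ultimately show ?thesis using real_of_int_floor_add_one_gt[of "\<eta>\<^sup>2 * N k / A"] by linarith
    qed
    have m0: "real m > 0" using m2 q1 by linarith
    have near: "cmod (\<phi> k t ^ j - 1) \<le> 1 / 3" if "j \<le> m" for j
    proof (rule ok_small)
      have "real j * A \<le> real m * A" using that A by simp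
      also have "\<dots> \<le> \<eta>\<^sup>2 * N k" using m1 A by (simp add: field_simps)
      finally show "real j * (2 * (\<bar>t\<bar> * \<eta> + t\<^sup>2)) \<le> \<eta>\<^sup>2 * N k" by (simp add: A_def)
    qed
    have "cmod (of_nat m * Ln (\<phi> k t)) \<le> 1"
      using cmod_Ln_near_1[OF near[of m]] Ln_power_near_1[OF near, of m m] by simp
    then have L: "cmod (Ln (\<phi> k t)) \<le> 1 / m" using m0 by (simp add: norm_mult field_simps)
    have "cmod (\<psi> t) = N k * cmod (Ln (\<phi> k t))"
      using N(1)[of k] \<psi>_eq[OF \<kappa>[of t]] by (simp add: norm_mult k_def)
    also have "\<dots> \<le> N k * (1 / m)" using L N(1)[of k] by (intro mult_left_mono) auto
    also have "\<dots> \<le> B t"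
    proof -
      have "\<eta>\<^sup>2 * N k \<le> 2 * real m * A" using m2 A by (simp add: field_simps)
      then have "N k \<le> 2 * real m * A / \<eta>\<^sup>2" using \<eta> by (simp add: field_simps)
      then show ?thesis using m0 by (simp add: B_def A_def field_simps)
    qed
    finally show ?thesis .
  qed (simp add: \<psi>0 B_def)
  have \<psi>_cont: "isCont \<psi> t" for t
  proof -
    \<comment> \<open>The margin \<open>1\<close> makes one level admissible on a whole
      neighbourhood of \<open>t\<close>, where \<open>\<psi>\<close> is thus given by a single
      continuous formula.\<close>
    define T where "T = \<bar>t\<bar> + 1"
    obtain k where k: "ok k T" using ok_ex by blast
    have okk: "ok k s" if "\<bar>s\<bar> < T" for s using ok_mono[OF k, of s k] that by auto
    have "eventually (\<lambda>s. \<bar>s\<bar> < T) (nhds t)"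
      by (rule order_tendstoD(2)[of abs "\<bar>t\<bar>"]) (auto simp: T_def intro!: tendsto_eq_intros filterlim_ident)
    then have ev: "eventually (\<lambda>s. \<psi> s = N k * Ln (\<phi> k s)) (nhds t)"
      by (rule eventually_mono) (use \<psi>_eq okk in auto)
    have "\<phi> k t \<notin> \<real>\<^sub>\<le>\<^sub>0"
    proof -
      have "\<bar>Re (\<phi> k t - 1)\<bar> \<le> 1 / 3"
        using abs_Re_le_cmod[of "\<phi> k t - 1"] ok_near[OF okk[of t]] by (simp add: T_def)
      then show ?thesis by (auto simp: complex_nonpos_Reals_iff)
    qed
    then have "isCont (\<lambda>s. N k * Ln (\<phi> k s)) t"
      by (intro continuous_intros cont isCont_Ln')
    then show ?thesis using isCont_cong[OF ev] by simp
  qed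
  have B_eq: "B t \<le> (4 / \<eta> + 4 / \<eta>\<^sup>2) * (\<bar>t\<bar> + t\<^sup>2)" for t
  proof -
    have "B t = 4 / \<eta> * \<bar>t\<bar> + 4 / \<eta>\<^sup>2 * t\<^sup>2" using \<eta> by (simp add: B_def field_simps power2_eq_square)
    moreover have "0 \<le> 4 / \<eta> * t\<^sup>2" "0 \<le> 4 / \<eta>\<^sup>2 * \<bar>t\<bar>" using \<eta> by auto
    ultimately show ?thesis unfolding distrib_left distrib_right by linarith
  qed
  have "\<exists>K. \<forall>k\<ge>K. \<forall>t. \<bar>t\<bar> \<le> T \<longrightarrow> \<phi> k t = exp (\<psi> t / complex_of_real (real D ^ k))" for T
  proof -
    obtain K where "ok K T" using ok_ex by blast
    then have "ok k t" if "k \<ge> K" "\<bar>t\<bar> \<le> T" for k t using ok_mono that by (meson abs_ge_self order_trans)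
    then show ?thesis using exp_eq by blast
  qed
  then show ?thesis using \<psi>_cont \<psi>0 bound B_eq by (meson order_trans)
qed

section \<open>From exponents of roots back to the quantities
  \<open>N (exp (z / N) - 1)\<close>\<close>

lemma exp_rescaled_bound:
  assumes "N > 0" "cmod z \<le> N"
  shows "cmod (complex_of_real N * (exp (z / complex_of_real N) - 1)) \<le> 3 * cmod z"
proof -
  define h where "h = z / complex_of_real N"
  have h: "cmod h = cmod z / N" "cmod h \<le> 1" using assms by (auto simp: h_def norm_divide)
  have "cmod (exp h - 1) \<le> exp \<bar>Re h\<bar> * cmod h"
    using Taylor_exp[of h 0] by simp
  also have "\<dots> \<le> exp 1 * cmod h" using abs_Re_le_cmod[of h] h(2) by (intro mult_right_mono) auto
  also have "\<dots> \<le> 3 * cmod h" using exp_le by (intro mult_right_mono) auto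
  finally show ?thesis using assms(1) by (simp add: norm_mult h(1) flip: h_def) (simp add: field_simps)
qed

lemma exp_rescaled_tendsto:
  assumes "filterlim N at_top sequentially"
  shows "(\<lambda>k. complex_of_real (N k) * (exp (z / complex_of_real (N k)) - 1)) \<longlonglongrightarrow> z"
proof (rule Lim_transform2)
  have ev: "eventually (\<lambda>k. N k > max 1 (cmod z)) sequentially"
    using assms unfolding filterlim_at_top_dense by blast
  show "(\<lambda>k. z) \<longlonglongrightarrow> z" by simp
  show "(\<lambda>k. z - complex_of_real (N k) * (exp (z / complex_of_real (N k)) - 1)) \<longlonglongrightarrow> 0"
  proof (rule Lim_null_comparison)
    show "eventually (\<lambda>k. cmod (z - complex_of_real (N k) * (exp (z / complex_of_real (N k)) - 1)) \<le> 3 * (cmod z)\<^sup>2 / N k) sequentially"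
      using ev
    proof eventually_elim
      case (elim k)
      define h where "h = z / complex_of_real (N k)"
      have N: "N k > 0" using elim by simp
      have zh: "z = N k * h" using N by (simp add: h_def)
      have h: "cmod h = cmod z / N k" using N by (simp add: h_def norm_divide)
      have h1: "cmod h \<le> 1" using elim N by (simp add: h)
      have "cmod (exp h - (1 + h)) \<le> exp \<bar>Re h\<bar> * (cmod h)\<^sup>2"
        using Taylor_exp[of h 1] by (simp add: eval_nat_numeral)
      also have "\<dots> \<le> exp 1 * (cmod h)\<^sup>2" using abs_Re_le_cmod[of h] h1 by (intro mult_right_mono) auto
      also have "\<dots> \<le> 3 * (cmod h)\<^sup>2" using exp_le by (intro mult_right_mono) auto
      finally have *: "cmod (exp h - (1 + h)) \<le> 3 * (cmod h)\<^sup>2" .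
      have "z - complex_of_real (N k) * (exp h - 1) = - complex_of_real (N k) * (exp h - (1 + h))"
        by (subst zh) (simp add: algebra_simps)
      then have "cmod (z - complex_of_real (N k) * (exp h - 1)) = N k * cmod (exp h - (1 + h))"
        using N by (simp add: norm_mult)
      also have "\<dots> \<le> N k * (3 * (cmod h)\<^sup>2)" using * N by (intro mult_left_mono) auto
      also have "\<dots> = 3 * (cmod z)\<^sup>2 / N k" using N by (simp add: h power2_eq_square field_simps)
      finally show ?case unfolding h_def .
    qed
    show "(\<lambda>k. 3 * (cmod z)\<^sup>2 / N k) \<longlonglongrightarrow> 0"
      by (rule tendsto_divide_0[OF tendsto_const filterlim_at_top_imp_at_infinity[OF assms]])
  qed
qed

section \<open>Levy noise fields are stationary noise fields\<close>

lemma lborel_integral_translate: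
  fixes g :: "'a::euclidean_space \<Rightarrow> complex"
  assumes [measurable]: "g \<in> borel_measurable borel"
  shows "(CLINT x|lborel. g (x - a)) = (CLINT x|lborel. g x)"
proof -
  have "(CLINT x|lborel. g x) = (CLINT x|distr lborel borel ((+) (- a)). g x)"
    by (simp only: lborel_distr_plus)
  also have "\<dots> = (CLINT x|lborel. g (- a + x))" by (rule integral_distr) simp_all
  finally show ?thesis by simp
qed

lemma iexp_diff_le: "cmod (iexp x - iexp y) \<le> \<bar>x - y\<bar>"
proof -
  have "iexp x - iexp y = iexp y * (iexp (x - y) - 1)"
    by (simp add: algebra_simps flip: exp_add)
  then have "cmod (iexp x - iexp y) = cmod (iexp (x - y) - 1)" by (simp add: norm_mult)
  also have "\<dots> \<le> \<bar>x - y\<bar>" using iexp_approx1[of "x - y" 0] by simp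
  finally show ?thesis .
qed

text \<open>Off the event \<open>S n\<close> the Lipschitz bound gives \<open>e / 2\<close>. On it
  the integrand is at most \<open>2\<close>, while its probability falls below
  \<open>e / 4\<close>.\<close>

lemma (in prob_space) conv_in_prob_iexp:
  assumes [measurable]: "\<And>n. X n \<in> borel_measurable M" "Y \<in> borel_measurable M"
    and conv: "conv_in_prob M X Y"
  shows "(\<lambda>n. CLINT \<omega>|M. iexp (X n \<omega>)) \<longlonglongrightarrow> (CLINT \<omega>|M. iexp (Y \<omega>))"
proof (rule metric_LIMSEQ_I)
  fix e :: real assume e: "e > 0"
  define S where "S n = {\<omega> \<in> space M. e / 2 < \<bar>X n \<omega> - Y \<omega>\<bar>}" for n
  have S[measurable]: "S n \<in> sets M" for n unfolding S_def by measurable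
  have "(\<lambda>n. prob (S n)) \<longlonglongrightarrow> 0" unfolding S_def
    by (rule conv[unfolded conv_in_prob_def, rule_format]) (use e in simp)
  from order_tendstoD(2)[OF this, of "e / 4"] e obtain K where K: "\<And>n. n \<ge> K \<Longrightarrow> prob (S n) < e / 4"
    by (auto simp: eventually_sequentially)
  have int: "complex_integrable M (\<lambda>\<omega>. iexp (W \<omega>))" if [measurable]: "W \<in> borel_measurable M" for W
    by (rule integrable_const_bound[where B=1]) auto
  have "dist (CLINT \<omega>|M. iexp (X n \<omega>)) (CLINT \<omega>|M. iexp (Y \<omega>)) < e" if "n \<ge> K" for n
  proof -
    have "dist (CLINT \<omega>|M. iexp (X n \<omega>)) (CLINT \<omega>|M. iexp (Y \<omega>)) = cmod (CLINT \<omega>|M. iexp (X n \<omega>) - iexp (Y \<omega>))"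
      unfolding dist_norm using int by simp
    also have "\<dots> \<le> (LINT \<omega>|M. cmod (iexp (X n \<omega>) - iexp (Y \<omega>)))" by (rule integral_norm_bound)
    also have "\<dots> \<le> (LINT \<omega>|M. e / 2 + 2 * indicator (S n) \<omega>)"
    proof (rule integral_mono)
      show "integrable M (\<lambda>\<omega>. cmod (iexp (X n \<omega>) - iexp (Y \<omega>)))"
        using int by (intro integrable_norm Bochner_Integration.integrable_diff) auto
      show "integrable M (\<lambda>\<omega>. e / 2 + 2 * indicator (S n) \<omega>)"
        by (intro Bochner_Integration.integrable_add integrable_mult_right integrable_real_indicator) (auto simp: emeasure_eq_measure)
      fix \<omega> assume \<omega>: "\<omega> \<in> space M"
      show "cmod (iexp (X n \<omega>) - iexp (Y \<omega>)) \<le> e / 2 + 2 * indicator (S n) \<omega>"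
      proof (cases "\<omega> \<in> S n")
        case True
        have "cmod (iexp (X n \<omega>) - iexp (Y \<omega>)) \<le> 2"
          using norm_triangle_ineq4[of "iexp (X n \<omega>)" "iexp (Y \<omega>)"] by simp
        then show ?thesis using True e by simp
      next
        case False
        then show ?thesis using iexp_diff_le[of "X n \<omega>" "Y \<omega>"] \<omega> by (simp add: S_def)
      qed
    qed
    also have "\<dots> = e / 2 + 2 * prob (S n)"
      by (subst Bochner_Integration.integral_add)
         (auto simp: prob_space intro!: integrable_mult_right integrable_real_indicator simp: emeasure_eq_measure)
    also have "\<dots> < e" using K[OF that] by simp
    finally show ?thesis .
  qed
  then show "\<exists>K. \<forall>n\<ge>K. dist (CLINT \<omega>|M. iexp (X n \<omega>)) (CLINT \<omega>|M. iexp (Y \<omega>)) < e" by blast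
qed

lemma (in prob_space) iexp_integral_cong_AE:
  assumes "X \<in> borel_measurable M" "Y \<in> borel_measurable M" "AE \<omega> in M. X \<omega> = Y \<omega>"
  shows "(CLINT \<omega>|M. iexp (X \<omega>)) = (CLINT \<omega>|M. iexp (Y \<omega>))"
proof (rule integral_cong_AE)
  note [measurable] = assms(1,2)
  show "(\<lambda>\<omega>. iexp (X \<omega>)) \<in> borel_measurable M" "(\<lambda>\<omega>. iexp (Y \<omega>)) \<in> borel_measurable M" by measurable
  show "AE \<omega> in M. iexp (X \<omega>) = iexp (Y \<omega>)" using assms(3) by eventually_elim simp
qed

text \<open>Pointwise additivity on functions with disjoint supports; integrated and exponentiated,
  it becomes factorization of the characteristic functional.\<close>

lemma sum_at_most_one_nonzero:
  fixes \<psi> :: "real \<Rightarrow> complex"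
  assumes "finite I" "\<psi> 0 = 0" "\<And>i j. i \<in> I \<Longrightarrow> j \<in> I \<Longrightarrow> i \<noteq> j \<Longrightarrow> u i = 0 \<or> u j = 0"
  shows "\<psi> (\<Sum>i\<in>I. u i) = (\<Sum>i\<in>I. \<psi> (u i))"
proof (cases "\<exists>i\<in>I. u i \<noteq> 0")
  case True
  then obtain i where i: "i \<in> I" "u i \<noteq> 0" by blast
  then have z: "u j = 0" if "j \<in> I - {i}" for j using assms(3)[of i j] that by auto
  show ?thesis using assms(2) z by (simp add: sum.remove[OF assms(1) i(1)])
qed (use assms in simp)

section \<open>Characteristic functionals of fields on Schwartz functions\<close>

context
  fixes M :: "'w measure" and Z :: "('a::euclidean_space \<Rightarrow> real) \<Rightarrow> 'w \<Rightarrow> real"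
  assumes M: "prob_space M" and Z: "gen_random_field M Z"
begin

interpretation prob_space M by (rule M)

lemma field_measurable: "f \<in> schwartz \<Longrightarrow> Z f \<in> borel_measurable M"
  using Z unfolding gen_random_field_def by blast

lemma field_linear:
  "f \<in> schwartz \<Longrightarrow> g \<in> schwartz \<Longrightarrow> AE \<omega> in M. Z (\<lambda>x. \<alpha> * f x + \<beta> * g x) \<omega> = \<alpha> * Z f \<omega> + \<beta> * Z g \<omega>"
  using Z unfolding gen_random_field_def by blast

lemma field_sum:
  assumes "finite I" "\<And>i. i \<in> I \<Longrightarrow> f i \<in> schwartz"
  shows "AE \<omega> in M. Z (\<lambda>x. \<Sum>i\<in>I. c i * f i x) \<omega> = (\<Sum>i\<in>I. c i * Z (f i) \<omega>)"
  using assms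
proof (induction I rule: finite_induct)
  case empty
  show ?case using field_linear[OF schwartz_zero schwartz_zero, of 0 0] by simp
next
  case (insert i I)
  let ?g = "\<lambda>x. \<Sum>i\<in>I. c i * f i x"
  have "f i \<in> schwartz" "?g \<in> schwartz" using insert by (auto intro: schwartz_sum)
  then have "AE \<omega> in M. Z (\<lambda>x. c i * f i x + 1 * ?g x) \<omega> = c i * Z (f i) \<omega> + 1 * Z ?g \<omega>"
    by (rule field_linear)
  moreover have "AE \<omega> in M. Z ?g \<omega> = (\<Sum>i\<in>I. c i * Z (f i) \<omega>)" using insert by simp
  ultimately show ?case using insert by (auto elim: eventually_elim2)
qed

text \<open>Linearity holds only almost surely for each fixed combination, so it is used under the
  expectation.\<close>

lemma field_sum_char:
  assumes "finite I" "\<And>i. i \<in> I \<Longrightarrow> f i \<in> schwartz"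
  shows "(CLINT \<omega>|M. iexp (\<Sum>i\<in>I. c i * Z (f i) \<omega>)) = (CLINT \<omega>|M. iexp (Z (\<lambda>x. \<Sum>i\<in>I. c i * f i x) \<omega>))"
proof (rule iexp_integral_cong_AE[symmetric])
  show "Z (\<lambda>x. \<Sum>i\<in>I. c i * f i x) \<in> borel_measurable M" using assms by (intro field_measurable schwartz_sum)
  show "(\<lambda>\<omega>. \<Sum>i\<in>I. c i * Z (f i) \<omega>) \<in> borel_measurable M"
    by (intro borel_measurable_sum borel_measurable_times borel_measurable_const field_measurable assms)
qed (use assms in \<open>rule field_sum\<close>)

lemma field_scale_char:
  assumes "f \<in> schwartz"
  shows "(CLINT \<omega>|M. iexp (t * Z f \<omega>)) = (CLINT \<omega>|M. iexp (Z (\<lambda>x. t * f x) \<omega>))"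
  using field_sum_char[of "{()}" "\<lambda>_. f" "\<lambda>_. t"] assms by simp

lemma levy_noise_fieldE:
  assumes "levy_noise_field M Z"
  obtains b s2 \<nu> where "\<And>f::'a \<Rightarrow> real. f \<in> schwartz \<Longrightarrow> integrable lborel (\<lambda>x. levy_char b s2 \<nu> (f x))"
    "\<And>f. f \<in> schwartz \<Longrightarrow> (CLINT \<omega>|M. iexp (Z f \<omega>)) = exp (CLINT x|lborel. levy_char b s2 \<nu> (f x))"
proof -
  obtain b s2 \<nu> where "\<forall>f\<in>schwartz. integrable lborel (\<lambda>x. levy_char b s2 \<nu> (f x)) \<and>
        (CLINT \<omega>|M. iexp (Z f \<omega>)) = exp (CLINT x|lborel. levy_char b s2 \<nu> (f x))"
    using assms unfolding levy_noise_field_def by (elim exE conjE)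
  then show ?thesis by (intro that) auto
qed

lemma levy_noise_imp_stationary:
  assumes "levy_noise_field M Z" shows "stationary_field M Z"
  unfolding stationary_field_def
proof (intro ballI allI)
  fix f :: "'a \<Rightarrow> real" and a :: 'a assume f: "f \<in> schwartz"
  obtain b s2 \<nu> where L: "\<And>f::'a \<Rightarrow> real. f \<in> schwartz \<Longrightarrow> integrable lborel (\<lambda>x. levy_char b s2 \<nu> (f x))"
    "\<And>f. f \<in> schwartz \<Longrightarrow> (CLINT \<omega>|M. iexp (Z f \<omega>)) = exp (CLINT x|lborel. levy_char b s2 \<nu> (f x))"
    by (rule levy_noise_fieldE[OF assms]) blast
  have fa: "(\<lambda>x. f (x - a)) \<in> schwartz" using f by (rule schwartz_translate)
  note [measurable] = field_measurable[OF f] field_measurable[OF fa]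
  show "distr M borel (Z f) = distr M borel (Z (\<lambda>x. f (x - a)))"
  proof (rule Levy_uniqueness)
    show "char (distr M borel (Z f)) = char (distr M borel (Z (\<lambda>x. f (x - a))))"
    proof
      fix t
      have tf: "(\<lambda>x. t * f x) \<in> schwartz" using f by (rule schwartz_scale)
      have "char (distr M borel (Z f)) t = (CLINT \<omega>|M. iexp (t * Z f \<omega>))"
        unfolding char_def by (subst integral_distr) auto
      also have "\<dots> = exp (CLINT x|lborel. levy_char b s2 \<nu> (t * f x))"
        unfolding field_scale_char[OF f] by (rule L(2)[OF tf])
      also have "(CLINT x|lborel. levy_char b s2 \<nu> (t * f x)) = (CLINT x|lborel. levy_char b s2 \<nu> (t * f (x - a)))"
        using lborel_integral_translate[of "\<lambda>x. levy_char b s2 \<nu> (t * f x)" a] borel_measurable_integrable[OF L(1)[OF tf]]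
        by simp
      also have "exp \<dots> = (CLINT \<omega>|M. iexp (t * Z (\<lambda>x. f (x - a)) \<omega>))"
        unfolding field_scale_char[OF fa] by (rule L(2)[OF schwartz_scale[OF fa], symmetric])
      also have "\<dots> = char (distr M borel (Z (\<lambda>x. f (x - a)))) t"
        unfolding char_def by (subst integral_distr) auto
      finally show "char (distr M borel (Z f)) t = char (distr M borel (Z (\<lambda>x. f (x - a)))) t" .
    qed
  qed (auto intro!: real_distribution_distr)
qed

lemma levy_noise_imp_noise:
  assumes "levy_noise_field M Z" shows "noise_field M Z"
  unfolding noise_field_def
proof (intro allI impI)
  fix n :: nat and fs :: "nat \<Rightarrow> 'a \<Rightarrow> real"
  assume fs: "\<forall>i<n. fs i \<in> schwartz" and disj: "\<forall>i<n. \<forall>j<n. i \<noteq> j \<longrightarrow> fsupport (fs i) \<inter> fsupport (fs j) = {}"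
  obtain b s2 \<nu> where L: "\<And>f::'a \<Rightarrow> real. f \<in> schwartz \<Longrightarrow> integrable lborel (\<lambda>x. levy_char b s2 \<nu> (f x))"
    "\<And>f. f \<in> schwartz \<Longrightarrow> (CLINT \<omega>|M. iexp (Z f \<omega>)) = exp (CLINT x|lborel. levy_char b s2 \<nu> (f x))"
    by (rule levy_noise_fieldE[OF assms]) blast
  have \<psi>0: "levy_char b s2 \<nu> 0 = 0" by (simp add: levy_char_def)
  show "indep_vars (\<lambda>_. borel) (\<lambda>i. Z (fs i)) {..<n}"
  proof (rule indep_vars_if_char_factorizes)
    fix t :: "nat \<Rightarrow> real"
    have f: "fs i \<in> schwartz" if "i \<in> {..<n}" for i using fs that by simp
    have tf: "(\<lambda>x. t i * fs i x) \<in> schwartz" if "i \<in> {..<n}" for i by (rule schwartz_scale[OF f[OF that]])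
    have zero: "t i * fs i x = 0 \<or> t j * fs j x = 0" if "i \<in> {..<n}" "j \<in> {..<n}" "i \<noteq> j" for i j x
    proof (rule ccontr)
      assume "\<not> (t i * fs i x = 0 \<or> t j * fs j x = 0)"
      then have "x \<in> fsupport (fs i) \<inter> fsupport (fs j)"
        unfolding fsupport_def using closure_subset by fastforce
      then show False using disj that by auto
    qed
    have "(CLINT \<omega>|M. iexp (\<Sum>i\<in>{..<n}. t i * Z (fs i) \<omega>)) = exp (CLINT x|lborel. levy_char b s2 \<nu> (\<Sum>i\<in>{..<n}. t i * fs i x))"
      by (subst field_sum_char[OF _ f]) (auto intro!: L(2) schwartz_sum f)
    also have "(CLINT x|lborel. levy_char b s2 \<nu> (\<Sum>i\<in>{..<n}. t i * fs i x)) = (CLINT x|lborel. \<Sum>i\<in>{..<n}. levy_char b s2 \<nu> (t i * fs i x))"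
      by (intro Bochner_Integration.integral_cong refl sum_at_most_one_nonzero \<psi>0 zero) auto
    also have "\<dots> = (\<Sum>i\<in>{..<n}. CLINT x|lborel. levy_char b s2 \<nu> (t i * fs i x))"
      by (intro Bochner_Integration.integral_sum L(1) tf)
    also have "exp \<dots> = (\<Prod>i\<in>{..<n}. exp (CLINT x|lborel. levy_char b s2 \<nu> (t i * fs i x)))"
      by (simp add: exp_sum)
    also have "\<dots> = (\<Prod>i\<in>{..<n}. CLINT \<omega>|M. iexp (t i * Z (fs i) \<omega>))"
    proof (rule prod.cong[OF refl])
      fix i assume i: "i \<in> {..<n}"
      show "exp (CLINT x|lborel. levy_char b s2 \<nu> (t i * fs i x)) = (CLINT \<omega>|M. iexp (t i * Z (fs i) \<omega>))"
        unfolding field_scale_char[OF f[OF i]] by (rule L(2)[OF tf[OF i], symmetric])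
    qed
    finally show "(CLINT \<omega>|M. iexp (\<Sum>i\<in>{..<n}. t i * Z (fs i) \<omega>)) = (\<Prod>i\<in>{..<n}. CLINT \<omega>|M. iexp (t i * Z (fs i) \<omega>))" .
  qed (use fs field_measurable in auto)
qed

text \<open>Independence turns the expectation of a product into a product of expectations. The
  enumeration \<open>h\<close> matches the index sets \<open>{..<n}\<close> in
  \<open>noise_field\<close>.\<close>

lemma noise_field_char_sum:
  assumes noise: "noise_field M Z" and fin: "finite I"
    and f: "\<And>i. i \<in> I \<Longrightarrow> f i \<in> schwartz"
    and disj: "\<And>i j. i \<in> I \<Longrightarrow> j \<in> I \<Longrightarrow> i \<noteq> j \<Longrightarrow> fsupport (f i) \<inter> fsupport (f j) = {}"
  shows "(CLINT \<omega>|M. iexp (Z (\<lambda>x. \<Sum>i\<in>I. c i * f i x) \<omega>)) = (\<Prod>i\<in>I. CLINT \<omega>|M. iexp (c i * Z (f i) \<omega>))"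
proof -
  define n where "n = card I"
  obtain h where h: "bij_betw h {..<n} I"
    using ex_bij_betw_nat_finite[OF fin] unfolding n_def atLeast0LessThan by blast
  have hI: "h i \<in> I" if "i < n" for i using bij_betwE[OF h] that by blast
  have hinj: "h i \<noteq> h j" if "i < n" "j < n" "i \<noteq> j" for i j
    using bij_betw_imp_inj_on[OF h] that by (auto dest: inj_onD)
  have "indep_vars (\<lambda>_. borel) (\<lambda>i. Z (f (h i))) {..<n}"
    using noise[unfolded noise_field_def, rule_format, of n "\<lambda>i. f (h i)"] f hI disj hinj by blast
  then have ind: "indep_vars (\<lambda>_. borel) (\<lambda>i \<omega>. iexp (c (h i) * Z (f (h i)) \<omega>)) {..<n}"
    by (rule indep_vars_compose2) measurable
  have "(CLINT \<omega>|M. iexp (Z (\<lambda>x. \<Sum>i\<in>I. c i * f i x) \<omega>)) = (CLINT \<omega>|M. iexp (\<Sum>i\<in>I. c i * Z (f i) \<omega>))"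
    by (rule field_sum_char[OF fin f, symmetric])
  also have "\<dots> = (CLINT \<omega>|M. (\<Prod>i\<in>{..<n}. iexp (c (h i) * Z (f (h i)) \<omega>)))"
    by (intro Bochner_Integration.integral_cong refl)
       (simp add: sum.reindex_bij_betw[OF h, symmetric] sum_distrib_left exp_sum)
  also have "\<dots> = (\<Prod>i\<in>{..<n}. CLINT \<omega>|M. iexp (c (h i) * Z (f (h i)) \<omega>))"
  proof (rule indep_vars_lebesgue_integral[OF _ ind])
    fix i assume "i \<in> {..<n}"
    then have [measurable]: "Z (f (h i)) \<in> borel_measurable M" using field_measurable f hI by auto
    show "complex_integrable M (\<lambda>\<omega>. iexp (c (h i) * Z (f (h i)) \<omega>))"
      by (rule integrable_const_bound[where B=1]) auto
  qed simp
  also have "\<dots> = (\<Prod>i\<in>I. CLINT \<omega>|M. iexp (c i * Z (f i) \<omega>))"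
    by (rule prod.reindex_bij_betw[OF h])
  finally show ?thesis .
qed

lemma stationary_field_char_translate:
  assumes "stationary_field M Z" and f: "f \<in> schwartz"
  shows "(CLINT \<omega>|M. iexp (t * Z (\<lambda>x. f (x - a)) \<omega>)) = (CLINT \<omega>|M. iexp (t * Z f \<omega>))"
proof -
  note [measurable] = field_measurable[OF f] field_measurable[OF schwartz_translate[OF f]]
  have "distr M borel (Z f) = distr M borel (Z (\<lambda>x. f (x - a)))"
    using assms unfolding stationary_field_def by blast
  then have "(CLINT y|distr M borel (Z (\<lambda>x. f (x - a))). iexp (t * y)) = (CLINT y|distr M borel (Z f). iexp (t * y))" by simp
  then show ?thesis by (simp add: integral_distr)
qed

end

section \<open>Stationary noise fields are Levy noise fields\<close>

lemma fsupport_translate: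
  fixes f :: "'a::euclidean_space \<Rightarrow> real"
  shows "fsupport (\<lambda>x. f (x - a)) = (+) a ` fsupport f"
proof -
  have "{x. f (x - a) \<noteq> 0} = (+) a ` {x. f x \<noteq> 0}"
    by (auto simp: image_iff) (metis add.commute diff_add_cancel)
  then show ?thesis unfolding fsupport_def by (simp add: closure_translation)
qed

lemma sum_singleton_real: "(\<Sum>a\<in>{a}. u a) = (u a :: real)"
  by simp

section \<open>Step functions on the dyadic grid\<close>

lemma dyadic_step_eq:
  assumes "finite I"
  shows "(\<Sum>a\<in>I. c a * indicator (dyadic_cube k a) x) = (if dyadic_floor k x \<in> I then c (dyadic_floor k x) else (0::real))"
proof -
  have "(\<Sum>a\<in>I. c a * indicator (dyadic_cube k a) x) = (\<Sum>a\<in>I. if dyadic_floor k x = a then c a else 0)"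
    by (intro sum.cong refl) (simp add: dyadic_cube_def indicator_def)
  then show ?thesis using assms by simp
qed

text \<open>One constant dominates a step function together with all its bump approximations, as
  required for convergence in the triple norm.\<close>

lemma dyadic_step_bound:
  fixes I :: "'a::euclidean_space set"
  assumes I: "finite I" "I \<subseteq> dyadic_lattice k"
  obtains C where "C \<ge> 0" "\<And>x. \<bar>\<Sum>a\<in>I. c a * indicator (dyadic_cube k a) x\<bar> \<le> C * lorentz_prod x"
    "\<And>n x. \<bar>\<Sum>a\<in>I. c a * cube_bump (1 / 2 ^ k) n (x - a)\<bar> \<le> C * lorentz_prod x"
proof -
  define S where "S = (\<Union>a\<in>I. cbox a (a + (1 / 2 ^ k) *\<^sub>R One :: 'a))"
  define B where "B = (\<Sum>a\<in>I. \<bar>c a\<bar>)"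
  have S: "bounded S" unfolding S_def using I by (intro bounded_UN) auto
  have B: "B \<ge> 0" by (auto simp: B_def intro: sum_nonneg)
  obtain C where C: "C \<ge> 0"
    "\<And>x y. \<bar>y\<bar> \<le> B \<Longrightarrow> (x \<notin> S \<Longrightarrow> y = 0) \<Longrightarrow> \<bar>y\<bar> \<le> C * lorentz_prod x"
    using lorentz_bound_if_bounded_support[OF S B] by blast
  have le_B: "\<bar>\<Sum>a\<in>I. c a * u a\<bar> \<le> B" if "\<And>a. \<bar>u a\<bar> \<le> 1" for u
    unfolding B_def using that by (intro order_trans[OF sum_abs] sum_mono) (simp add: abs_mult mult_left_le)
  show ?thesis
  proof
    fix x
    show "\<bar>\<Sum>a\<in>I. c a * indicator (dyadic_cube k a) x\<bar> \<le> C * lorentz_prod x"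
    proof (rule C(2))
      assume "x \<notin> S"
      then have "x \<notin> dyadic_cube k a" if "a \<in> I" for a
        using dyadic_cube_between(2)[of a k] that I unfolding S_def by blast
      then show "(\<Sum>a\<in>I. c a * indicator (dyadic_cube k a) x) = 0" by simp
    qed (auto intro!: le_B simp: indicator_def)
    fix n
    show "\<bar>\<Sum>a\<in>I. c a * cube_bump (1 / 2 ^ k) n (x - a)\<bar> \<le> C * lorentz_prod x"
    proof (rule C(2))
      assume x: "x \<notin> S"
      have "cube_bump (1 / 2 ^ k) n (x - a) = 0" if "a \<in> I" for a
      proof (rule ccontr)
        assume "cube_bump (1 / 2 ^ k) n (x - a) \<noteq> 0"
        then have "x - a \<in> fsupport (cube_bump (1 / 2 ^ k) n)"
          unfolding fsupport_def using closure_subset by fastforce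
        then have "x - a \<in> box 0 ((1 / 2 ^ k) *\<^sub>R One)" using fsupport_cube_bump[of "1 / 2 ^ k" n] by auto
        then have "x \<in> cbox a (a + (1 / 2 ^ k) *\<^sub>R One)"
          by (auto simp: mem_box inner_diff_left inner_add_left less_imp_le algebra_simps)
        then show False using x that unfolding S_def by blast
      qed
      then show "(\<Sum>a\<in>I. c a * cube_bump (1 / 2 ^ k) n (x - a)) = 0" by simp
    qed (auto intro!: le_B simp: cube_bump_bounds)
  qed (rule C(1))
qed

lemma dyadic_step_L12:
  assumes "finite I" "I \<subseteq> dyadic_lattice k"
  shows "(\<lambda>x. \<Sum>a\<in>I. c a * indicator (dyadic_cube k a) x) \<in> L12"
proof -
  obtain C where "\<And>x. \<bar>\<Sum>a\<in>I. c a * indicator (dyadic_cube k a) x\<bar> \<le> C * lorentz_prod x"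
    by (rule dyadic_step_bound[OF assms, of c]) blast
  moreover have "(\<lambda>x. \<Sum>a\<in>I. c a * indicator (dyadic_cube k a) x) \<in> borel_measurable borel" by measurable
  ultimately show ?thesis by (rule L12_if_lorentz_bound[rotated])
qed

text \<open>The cubes are disjoint with total volume \<open>v\<close>, so the L1 norm is
  \<open>|t| v\<close> and the squared L2 norm is \<open>t^2 v\<close>. This is the expression in
  hypothesis \<open>small\<close> of \<open>root_exponent\<close>.\<close>

lemma dyadic_step_triple_norm:
  fixes I :: "'a::euclidean_space set"
  assumes I: "finite I" "I \<subseteq> dyadic_lattice k"
  defines "v \<equiv> real (card I) / real (dyadic_density TYPE('a)) ^ k"
  shows "(triple_norm (\<lambda>x. \<Sum>a\<in>I. t * indicator (dyadic_cube k a) x))\<^sup>2 = t\<^sup>2 * (v\<^sup>2 + v)"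
proof -
  let ?S = "\<lambda>x. \<Sum>a\<in>I. indicator (dyadic_cube k a) x :: real"
  have int: "integrable lborel (indicator (dyadic_cube k a) :: 'a \<Rightarrow> real)" if "a \<in> I" for a
    using that I by (intro integrable_real_indicator) (auto simp: emeasure_dyadic_cube)
  have "(LINT x|lborel. ?S x) = (\<Sum>a\<in>I. measure lborel (dyadic_cube k a))"
    using int by (subst Bochner_Integration.integral_sum) auto
  also have "\<dots> = (\<Sum>a\<in>I. 1 / real (dyadic_density TYPE('a)) ^ k)"
    using I by (intro sum.cong refl measure_dyadic_cube) auto
  also have "\<dots> = v" by (simp add: v_def)
  finally have v: "(LINT x|lborel. ?S x) = v" .
  have S: "?S x = (if dyadic_floor k x \<in> I then 1 else 0)" for x
    using dyadic_step_eq[OF I(1), of "\<lambda>_. 1" k x] by simp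
  have "\<bar>\<Sum>a\<in>I. t * indicator (dyadic_cube k a) x\<bar> = \<bar>t\<bar> * ?S x" for x
    unfolding sum_distrib_left[symmetric] S by (simp add: abs_mult)
  moreover have "(\<Sum>a\<in>I. t * indicator (dyadic_cube k a) x)\<^sup>2 = t\<^sup>2 * ?S x" for x
    unfolding sum_distrib_left[symmetric] S by simp
  ultimately have "triple_norm (\<lambda>x. \<Sum>a\<in>I. t * indicator (dyadic_cube k a) x) = sqrt ((\<bar>t\<bar> * v)\<^sup>2 + t\<^sup>2 * v)"
    unfolding triple_norm_def by (simp only: integral_mult_right_zero v)
  moreover have "v \<ge> 0" by (simp add: v_def)
  ultimately show ?thesis by (simp add: power_mult_distrib algebra_simps)
qed

lemma zero_dyadic_lattice: "0 \<in> dyadic_lattice k"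
  by (rule image_eqI[of _ _ 0]) (auto simp: dyadic_floor_def)

lemma cube_indicator_L12: "(indicator (dyadic_cube k 0) :: 'a::euclidean_space \<Rightarrow> real) \<in> L12"
  using dyadic_step_L12[of "{0::'a}" k "\<lambda>_. 1"] unfolding sum_singleton_real by (simp add: zero_dyadic_lattice)

section \<open>The characteristic functional of the extended field\<close>

context
  fixes M :: "'w measure" and Z Z' :: "('a::euclidean_space \<Rightarrow> real) \<Rightarrow> 'w \<Rightarrow> real"
  assumes M: "prob_space M" and Z: "gen_random_field M Z" and ext: "triple_extension M Z Z'"
begin

interpretation prob_space M by (rule M)

definition ext_char :: "('a \<Rightarrow> real) \<Rightarrow> complex" where
  "ext_char f = (CLINT \<omega>|M. iexp (Z' f \<omega>))"

lemma ext_measurable: "f \<in> L12 \<Longrightarrow> Z' f \<in> borel_measurable M"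
  using ext unfolding triple_extension_def by blast

lemma ext_char_schwartz: "f \<in> schwartz \<Longrightarrow> ext_char f = (CLINT \<omega>|M. iexp (Z f \<omega>))"
  unfolding ext_char_def using ext
  by (intro iexp_integral_cong_AE ext_measurable schwartz_in_L12 field_measurable[OF M Z])
     (auto simp: triple_extension_def)

lemma ext_char_tendsto:
  assumes "\<And>n. g n \<in> L12" "h \<in> L12" "(\<lambda>n. triple_norm (\<lambda>x. g n x - h x)) \<longlonglongrightarrow> 0"
  shows "(\<lambda>n. ext_char (g n)) \<longlonglongrightarrow> ext_char h"
  unfolding ext_char_def
proof (rule conv_in_prob_iexp)
  show "conv_in_prob M (\<lambda>n. Z' (g n)) (Z' h)"
    using ext assms unfolding triple_extension_def triple_continuous_def by blast
qed (use assms ext_measurable in auto)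

lemma ext_char_tendsto_dominated:
  assumes "\<And>n. g n \<in> borel_measurable borel" "h \<in> borel_measurable borel"
    and "\<And>n x. \<bar>g n x\<bar> \<le> C * lorentz_prod x" "\<And>x. \<bar>h x\<bar> \<le> C * lorentz_prod x"
    and "AE x in lborel. (\<lambda>n. g n x) \<longlonglongrightarrow> h x"
  shows "(\<lambda>n. ext_char (g n)) \<longlonglongrightarrow> ext_char h"
  by (intro ext_char_tendsto triple_norm_tendsto_0[OF assms] L12_if_lorentz_bound[where C=C] assms)

lemma ext_char_scale:
  assumes f: "f \<in> L12"
  shows "ext_char (\<lambda>x. t * f x) = char (distr M borel (Z' f)) t"
proof -
  note [measurable] = ext_measurable[OF f]
  have tf: "(\<lambda>x. t * f x) \<in> L12" using f by (auto simp: L12_def power_mult_distrib)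
  have "AE \<omega> in M. Z' (\<lambda>x. t * f x + 0 * f x) \<omega> = t * Z' f \<omega> + 0 * Z' f \<omega>"
    using ext f unfolding triple_extension_def by blast
  then have "ext_char (\<lambda>x. t * f x) = (CLINT \<omega>|M. iexp (t * Z' f \<omega>))"
    unfolding ext_char_def by (intro iexp_integral_cong_AE ext_measurable tf) auto
  also have "\<dots> = char (distr M borel (Z' f)) t"
    unfolding char_def by (subst integral_distr) auto
  finally show ?thesis .
qed

text \<open>Continuity is given for sequences; the uniform neighbourhood follows by contradiction,
  choosing violating functions of triple norm below \<open>1 / Suc n\<close>.\<close>

lemma ext_char_near_1:
  assumes "e > 0"
  obtains \<eta> where "\<eta> > 0" "\<And>f. f \<in> L12 \<Longrightarrow> triple_norm f < \<eta> \<Longrightarrow> cmod (ext_char f - 1) \<le> e"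
proof -
  have zero: "(\<lambda>x. 0) \<in> L12" by (simp add: L12_def)
  \<comment> \<open>The zero function, viewed as a multiple with \<open>t = 0\<close>, so that its
    value is a characteristic function at \<open>0\<close>.\<close>
  have "ext_char (\<lambda>x. 0 * 0) = char (distr M borel (Z' (\<lambda>x. 0))) 0"
    by (rule ext_char_scale[OF zero])
  then have one: "ext_char (\<lambda>x. 0) = 1"
    using real_distribution.char_zero[OF real_distribution_distr[OF ext_measurable[OF zero]]] by simp
  have "\<exists>\<eta>>0. \<forall>f. f \<in> L12 \<longrightarrow> triple_norm f < \<eta> \<longrightarrow> cmod (ext_char f - 1) \<le> e"
  proof (rule ccontr)
    assume "\<not> ?thesis"
    then have "\<exists>f. f \<in> L12 \<and> triple_norm f < 1 / real (Suc n) \<and> e < cmod (ext_char f - 1)" for n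
      by (metis not_le of_nat_0_less_iff zero_less_Suc zero_less_divide_1_iff)
    then obtain f where f: "\<And>n. f n \<in> L12" "\<And>n. triple_norm (f n) < 1 / real (Suc n)" "\<And>n. e < cmod (ext_char (f n) - 1)"
      by metis
    have "(\<lambda>n. triple_norm (\<lambda>x. f n x - 0)) \<longlonglongrightarrow> 0"
    proof (rule tendsto_sandwich[OF _ _ tendsto_const LIMSEQ_inverse_real_of_nat])
      show "eventually (\<lambda>n. 0 \<le> triple_norm (\<lambda>x. f n x - 0)) sequentially" by (simp add: triple_norm_def)
      show "eventually (\<lambda>n. triple_norm (\<lambda>x. f n x - 0) \<le> inverse (real (Suc n))) sequentially"
        using f(2) by (simp add: inverse_eq_divide less_imp_le)
    qed
    from ext_char_tendsto[OF f(1) zero this] have "(\<lambda>n. ext_char (f n)) \<longlonglongrightarrow> 1" unfolding one .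
    then have "(\<lambda>n. cmod (ext_char (f n) - 1)) \<longlonglongrightarrow> 0" by (simp add: LIM_zero_iff tendsto_norm_zero_iff)
    from order_tendstoD(2)[OF this assms] obtain n where "cmod (ext_char (f n) - 1) < e"
      by (auto simp: eventually_sequentially)
    then show False using f(3)[of n] by simp
  qed
  then show ?thesis using that by blast
qed

section \<open>Characteristic functions of cubes for a stationary noise field\<close>

context
  assumes noise: "noise_field M Z" and stat: "stationary_field M Z"
begin

text \<open>The \<open>phi_k\<close> of the overview. By stationarity the cube at the origin
  represents all cubes of its level.\<close>

definition cube_char :: "nat \<Rightarrow> real \<Rightarrow> complex" where
  "cube_char k t = ext_char (\<lambda>x. t * indicator (dyadic_cube k 0) x)"

text \<open>The one place where both field properties enter: independence separates the bumps, whose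
  supports lie in disjoint cubes, and stationarity moves each of them to the origin.\<close>

lemma bump_sum_char:
  assumes I: "finite I" "I \<subseteq> dyadic_lattice k"
  shows "ext_char (\<lambda>x. \<Sum>a\<in>I. c a * cube_bump (1 / 2 ^ k) n (x - a)) =
    (\<Prod>a\<in>I. ext_char (\<lambda>x. c a * cube_bump (1 / 2 ^ k) n x))"
proof -
  let ?h = "cube_bump (1 / 2 ^ k) n :: 'a \<Rightarrow> real"
  have h: "?h \<in> schwartz" by (rule cube_bump_schwartz) simp
  have ha: "(\<lambda>x. ?h (x - a)) \<in> schwartz" for a by (rule schwartz_translate[OF h])
  have supp: "fsupport (\<lambda>x. ?h (x - a)) \<subseteq> dyadic_cube k a" if "a \<in> I" for a
  proof
    fix x assume "x \<in> fsupport (\<lambda>x. ?h (x - a))"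
    then have "x - a \<in> fsupport ?h" unfolding fsupport_translate by auto
    then have "x - a \<in> box 0 ((1 / 2 ^ k) *\<^sub>R One)" using fsupport_cube_bump[of "1 / 2 ^ k" n] by auto
    then have "x \<in> box a (a + (1 / 2 ^ k) *\<^sub>R One)"
      by (auto simp: mem_box inner_diff_left inner_add_left algebra_simps)
    then show "x \<in> dyadic_cube k a" using dyadic_cube_between(1)[of a k] that I by blast
  qed
  have "ext_char (\<lambda>x. \<Sum>a\<in>I. c a * ?h (x - a)) = (CLINT \<omega>|M. iexp (Z (\<lambda>x. \<Sum>a\<in>I. c a * ?h (x - a)) \<omega>))"
    by (intro ext_char_schwartz schwartz_sum ha)
  also have "\<dots> = (\<Prod>a\<in>I. CLINT \<omega>|M. iexp (c a * Z (\<lambda>x. ?h (x - a)) \<omega>))"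
  proof (rule noise_field_char_sum[OF M Z noise I(1) ha])
    fix a b assume "a \<in> I" "b \<in> I" "a \<noteq> b"
    then show "fsupport (\<lambda>x. ?h (x - a)) \<inter> fsupport (\<lambda>x. ?h (x - b)) = {}"
      using supp[of a] supp[of b] by (auto simp: dyadic_cube_def)
  qed
  also have "\<dots> = (\<Prod>a\<in>I. ext_char (\<lambda>x. c a * ?h x))"
    unfolding stationary_field_char_translate[OF M Z stat h] field_scale_char[OF M Z h]
    by (intro prod.cong refl ext_char_schwartz[symmetric] schwartz_scale h)
  finally show ?thesis .
qed

lemma bump_tendsto_step:
  assumes I: "finite I" "I \<subseteq> dyadic_lattice k"
  shows "(\<lambda>n. ext_char (\<lambda>x. \<Sum>a\<in>I. c a * cube_bump (1 / 2 ^ k) n (x - a)))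
    \<longlonglongrightarrow> ext_char (\<lambda>x. \<Sum>a\<in>I. c a * indicator (dyadic_cube k a) x)"
proof -
  obtain C where C: "\<And>x. \<bar>\<Sum>a\<in>I. c a * indicator (dyadic_cube k a) x\<bar> \<le> C * lorentz_prod x"
    "\<And>n x. \<bar>\<Sum>a\<in>I. c a * cube_bump (1 / 2 ^ k) n (x - a)\<bar> \<le> C * lorentz_prod x"
    by (rule dyadic_step_bound[OF I, of c]) blast
  show ?thesis
  proof (rule ext_char_tendsto_dominated[OF _ _ C(2) C(1)])
    have h: "(cube_bump (1 / 2 ^ k) n :: 'a \<Rightarrow> real) \<in> schwartz" for n by (rule cube_bump_schwartz) simp
    show "(\<lambda>x. \<Sum>a\<in>I. c a * cube_bump (1 / 2 ^ k) n (x - a)) \<in> borel_measurable borel" for n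
      by (intro schwartz_measurable schwartz_sum schwartz_translate[OF h])
    \<comment> \<open>Bumps converge to indicators of open boxes, which agree with the half-open
      cubes only up to null sets. Finiteness of \<open>I\<close> makes the exceptional set common to
      all \<open>a\<close>.\<close>
    have "AE x in lborel. \<forall>a\<in>I. indicator (dyadic_cube k a) x = (indicator (box a (a + (1 / 2 ^ k) *\<^sub>R One)) x :: real)"
      using I by (intro AE_finite_allI AE_dyadic_cube_eq_box) auto
    then show "AE x in lborel. (\<lambda>n. \<Sum>a\<in>I. c a * cube_bump (1 / 2 ^ k) n (x - a))
      \<longlonglongrightarrow> (\<Sum>a\<in>I. c a * indicator (dyadic_cube k a) x)"
    proof eventually_elim
      case (elim x)
      have "(\<lambda>n. cube_bump (1 / 2 ^ k) n (x - a)) \<longlonglongrightarrow> indicator (dyadic_cube k a) x" if "a \<in> I" for a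
      proof -
        have "x - a \<in> box 0 ((1 / 2 ^ k) *\<^sub>R One) \<longleftrightarrow> x \<in> box a (a + (1 / 2 ^ k) *\<^sub>R One)"
          by (auto simp: mem_box inner_diff_left inner_add_left algebra_simps)
        then have "indicator (box 0 ((1 / 2 ^ k) *\<^sub>R One)) (x - a) = (indicator (dyadic_cube k a) x :: real)"
          using elim that by (auto simp: indicator_def)
        then show ?thesis using cube_bump_tendsto[of "1 / 2 ^ k" "x - a"] by simp
      qed
      then show ?case by (intro tendsto_sum tendsto_mult tendsto_const)
    qed
  qed measurable
qed

text \<open>Passage to the limit in \<open>bump_sum_char\<close>: the left side converges by
  \<open>bump_tendsto_step\<close>, and each factor on the right by its one-cube case.\<close>

lemma step_char:
  assumes I: "finite I" "I \<subseteq> dyadic_lattice k"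
  shows "ext_char (\<lambda>x. \<Sum>a\<in>I. c a * indicator (dyadic_cube k a) x) = (\<Prod>a\<in>I. cube_char k (c a))"
proof (rule LIMSEQ_unique[OF bump_tendsto_step[OF I]])
  have "(\<lambda>n. ext_char (\<lambda>x. t * cube_bump (1 / 2 ^ k) n x)) \<longlonglongrightarrow> cube_char k t" for t
    using bump_tendsto_step[of "{0}" k "\<lambda>_. t"] unfolding sum_singleton_real by (simp add: cube_char_def zero_dyadic_lattice)
  then show "(\<lambda>n. ext_char (\<lambda>x. \<Sum>a\<in>I. c a * cube_bump (1 / 2 ^ k) n (x - a))) \<longlonglongrightarrow> (\<Prod>a\<in>I. cube_char k (c a))"
    unfolding bump_sum_char[OF I] by (intro tendsto_prod)
qed

definition cube_distr :: "nat \<Rightarrow> real measure" where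
  "cube_distr k = distr M borel (Z' (indicator (dyadic_cube k 0)))"

lemma cube_distr: "real_distribution (cube_distr k)" "cube_char k = char (cube_distr k)"
  unfolding cube_distr_def cube_char_def
  using ext_measurable[OF cube_indicator_L12] ext_char_scale[OF cube_indicator_L12]
  by (auto intro!: real_distribution_distr)

text \<open>A cube is the disjoint union of its \<open>D\<close> subcubes, so its indicator is a
  step function of the next level.\<close>

lemma cube_char_root: "cube_char k t = cube_char (Suc k) t ^ dyadic_density TYPE('a)"
proof -
  define I where "I = {c \<in> dyadic_lattice (Suc k). dyadic_floor k c = (0::'a)}"
  have I: "finite I" "card I = dyadic_density TYPE('a)" "(\<Union>c\<in>I. dyadic_cube (Suc k) c) = dyadic_cube k 0"
    unfolding I_def by (rule card_dyadic_subcubes[OF zero_dyadic_lattice])+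
  have "(\<Sum>a\<in>I. t * indicator (dyadic_cube (Suc k) a) x) = t * indicator (dyadic_cube k 0) x" for x
  proof -
    have "dyadic_floor (Suc k) x \<in> I \<longleftrightarrow> x \<in> dyadic_cube k 0"
      by (simp add: I_def dyadic_cube_def dyadic_floor_Suc)
    then show ?thesis unfolding dyadic_step_eq[OF I(1)] by simp
  qed
  then have "cube_char k t = ext_char (\<lambda>x. \<Sum>a\<in>I. t * indicator (dyadic_cube (Suc k) a) x)"
    by (simp add: cube_char_def)
  also have "\<dots> = (\<Prod>a\<in>I. cube_char (Suc k) t)" by (rule step_char) (use I in \<open>auto simp: I_def\<close>)
  finally show ?thesis by (simp add: I)
qed

text \<open>The power \<open>cube_char k t ^ m\<close> is the functional of a step function of
  height \<open>t\<close> on \<open>m\<close> distinct cubes, whose triple norm is known; continuity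
  at \<open>0\<close> then supplies hypothesis \<open>small\<close>.\<close>

lemma cube_char_exponent:
  "\<exists>\<psi> C. (\<forall>t. isCont \<psi> t) \<and> \<psi> 0 = 0 \<and> (\<forall>t. cmod (\<psi> t) \<le> C * (\<bar>t\<bar> + t\<^sup>2)) \<and>
    (\<forall>T. \<exists>K. \<forall>k\<ge>K. \<forall>t. \<bar>t\<bar> \<le> T \<longrightarrow> cube_char k t = exp (\<psi> t / complex_of_real (real (dyadic_density TYPE('a)) ^ k)))"
proof -
  obtain \<eta> where \<eta>: "\<eta> > 0" "\<And>f. f \<in> L12 \<Longrightarrow> triple_norm f < \<eta> \<Longrightarrow> cmod (ext_char f - 1) \<le> 1 / 3"
    using ext_char_near_1[of "1/3"] by auto
  show ?thesis
  proof (rule root_exponent[where D="dyadic_density TYPE('a)" and \<phi>=cube_char, OF _ \<eta>(1) cube_char_root])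
    show "2 \<le> dyadic_density TYPE('a)"
      using self_le_power[of "2::nat" "DIM('a)"] by (simp add: dyadic_density_def)
    show "isCont (cube_char k) t" for k t
      unfolding cube_distr(2) by (rule real_distribution.isCont_char[OF cube_distr(1)])
    show "cube_char k 0 = 1" for k
      unfolding cube_distr(2) by (rule real_distribution.char_zero[OF cube_distr(1)])
    fix k m :: nat and t :: real
    assume small: "t\<^sup>2 * ((real m / real (dyadic_density TYPE('a)) ^ k)\<^sup>2 + real m / real (dyadic_density TYPE('a)) ^ k) < \<eta>\<^sup>2"
    obtain I :: "'a set" where I: "finite I" "card I = m" "I \<subseteq> dyadic_lattice k"
      using infinite_arbitrarily_large[OF infinite_dyadic_lattice] by blast
    let ?f = "\<lambda>x. \<Sum>a\<in>I. t * indicator (dyadic_cube k a) x"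
    have "(triple_norm ?f)\<^sup>2 < \<eta>\<^sup>2" using small unfolding dyadic_step_triple_norm[OF I(1,3)] I(2) .
    then have "triple_norm ?f < \<eta>" by (rule power2_less_imp_less[OF _ less_imp_le[OF \<eta>(1)]])
    then have "cmod (ext_char ?f - 1) \<le> 1 / 3" by (rule \<eta>(2)[OF dyadic_step_L12[OF I(1,3)]])
    then show "cmod (cube_char k t ^ m - 1) \<le> 1 / 3" unfolding step_char[OF I(1,3)] by (simp add: I)
  qed
qed

text \<open>Sampling \<open>f\<close> at grid corners gives step functions whose functional is a
  product over cubes, that is, the exponential of a Riemann sum of
  \<open>\<psi> \<circ> f\<close>.\<close>

lemma schwartz_char_eq_exp:
  fixes \<psi> :: "real \<Rightarrow> complex"
  assumes cont: "\<And>t. isCont \<psi> t" and \<psi>0: "\<psi> 0 = 0" and bd: "\<And>t. cmod (\<psi> t) \<le> C * (\<bar>t\<bar> + t\<^sup>2)"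
    and root: "\<And>T. \<exists>K. \<forall>k\<ge>K. \<forall>t. \<bar>t\<bar> \<le> T \<longrightarrow> cube_char k t = exp (\<psi> t / complex_of_real (real (dyadic_density TYPE('a)) ^ k))"
    and f: "f \<in> schwartz"
  shows "integrable lborel (\<lambda>x. \<psi> (f x))" "(CLINT \<omega>|M. iexp (Z f \<omega>)) = exp (CLINT x|lborel. \<psi> (f x))"
proof -
  let ?d = "real DIM('a)" and ?D = "real (dyadic_density TYPE('a))"
  have C0: "C \<ge> 0" using order_trans[OF norm_ge_zero bd[of 1]] by simp
  have \<psi>_meas[measurable]: "\<psi> \<in> borel_measurable borel"
    by (intro borel_measurable_continuous_onI continuous_at_imp_continuous_on ballI cont)
  have f_meas[measurable]: "f \<in> borel_measurable borel" by (rule schwartz_measurable[OF f])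
  obtain A where A: "A \<ge> 0" "\<And>x. (1 + norm x) ^ (2 * DIM('a)) * \<bar>f x\<bar> \<le> A"
    using schwartz_decay[OF f, of "[]" "2 * DIM('a)"] by auto
  define B where "B = A * (1 + ?d) ^ (2 * DIM('a))"
  have B0: "B \<ge> 0" using A by (simp add: B_def)
  \<comment> \<open>A value of \<open>f\<close> at a grid corner is bounded by the weight at any
    point of its cube. As \<open>DIM('a)\<close> exceeds the distance at every level, the sampled
    functions get a majorant independent of \<open>k\<close>.\<close>
  have fdy: "\<bar>f y\<bar> \<le> B * lorentz_prod x" if "norm (x - y) \<le> ?d" for x y
  proof -
    have "1 + norm x \<le> (1 + ?d) * (1 + norm y)"
      using one_plus_norm_le_mult[of x y] that by (smt (verit) mult_right_mono norm_ge_zero)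
    then have "(1 + norm x) ^ (2 * DIM('a)) \<le> ((1 + ?d) * (1 + norm y)) ^ (2 * DIM('a))"
      by (intro power_mono) auto
    then have "(1 + norm x) ^ (2 * DIM('a)) * lorentz_prod x \<le> ((1 + ?d) * (1 + norm y)) ^ (2 * DIM('a)) * lorentz_prod x"
      by (intro mult_right_mono less_imp_le[OF lorentz_prod_pos])
    with one_le_lorentz_prod[of x] have "1 \<le> ((1 + ?d) * (1 + norm y)) ^ (2 * DIM('a)) * lorentz_prod x" by linarith
    then have "\<bar>f y\<bar> * 1 \<le> \<bar>f y\<bar> * (((1 + ?d) * (1 + norm y)) ^ (2 * DIM('a)) * lorentz_prod x)"
      by (intro mult_left_mono) auto
    also have "\<dots> = ((1 + norm y) ^ (2 * DIM('a)) * \<bar>f y\<bar>) * ((1 + ?d) ^ (2 * DIM('a)) * lorentz_prod x)"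
      by (simp add: power_mult_distrib mult_ac)
    also have "\<dots> \<le> A * ((1 + ?d) ^ (2 * DIM('a)) * lorentz_prod x)"
      by (intro mult_right_mono A mult_nonneg_nonneg less_imp_le[OF lorentz_prod_pos]) simp
    finally show ?thesis by (simp add: B_def mult_ac)
  qed
  have f_bd: "\<bar>f x\<bar> \<le> B * lorentz_prod x" for x using fdy[of x x] by simp
  have f_B: "\<bar>f x\<bar> \<le> B" for x
    using f_bd[of x] lorentz_prod_le_1[of x] B0 by (meson mult_left_le order_trans)
  have \<psi>_bd: "cmod (\<psi> s) \<le> (C * (B + B\<^sup>2)) * lorentz_prod x" if "\<bar>s\<bar> \<le> B * lorentz_prod x" for s x
  proof -
    have w: "0 \<le> lorentz_prod x" "lorentz_prod x \<le> 1" using lorentz_prod_pos[of x] lorentz_prod_le_1[of x] by auto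
    have "s\<^sup>2 \<le> (B * lorentz_prod x)\<^sup>2" using power_mono[OF that, of 2] by simp
    also have "\<dots> = B\<^sup>2 * (lorentz_prod x * lorentz_prod x)" by (simp add: power2_eq_square)
    also have "\<dots> \<le> B\<^sup>2 * lorentz_prod x" using w by (intro mult_left_mono mult_left_le) auto
    finally have "\<bar>s\<bar> + s\<^sup>2 \<le> (B + B\<^sup>2) * lorentz_prod x" using that by (simp add: algebra_simps)
    then have "C * (\<bar>s\<bar> + s\<^sup>2) \<le> C * ((B + B\<^sup>2) * lorentz_prod x)" using C0 by (rule mult_left_mono)
    then show ?thesis using bd[of s] by (simp add: mult.assoc)
  qed
  have dom: "integrable lborel (\<lambda>x::'a. (C * (B + B\<^sup>2)) * lorentz_prod x)"
    by (intro integrable_mult_right integrable_lorentz_prod)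
  show "integrable lborel (\<lambda>x. \<psi> (f x))"
  proof (rule Bochner_Integration.integrable_bound[OF dom])
    show "AE x in lborel. cmod (\<psi> (f x)) \<le> norm (C * (B + B\<^sup>2) * lorentz_prod x)"
      using \<psi>_bd[OF f_bd] by (intro AE_I2) (simp add: order_trans[OF _ abs_ge_self])
  qed simp
  \<comment> \<open>Restricting to corners in \<open>[-k, k]^d\<close> keeps the sum finite, while
    any fixed point is eventually covered.\<close>
  define J where "J k = dyadic_lattice k \<inter> cbox (- real k *\<^sub>R One) (real k *\<^sub>R One :: 'a)" for k
  have J: "finite (J k)" "J k \<subseteq> dyadic_lattice k" for k
    unfolding J_def by (auto intro: finite_dyadic_lattice_bounded)
  define g where "g k x = (\<Sum>a\<in>J k. f a * indicator (dyadic_cube k a) x)" for k x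
  have g_eq: "g k x = (if dyadic_floor k x \<in> J k then f (dyadic_floor k x) else 0)" for k x
    unfolding g_def by (rule dyadic_step_eq[OF J(1)])
  have dist1: "norm (x - dyadic_floor k x) \<le> ?d" for k and x :: 'a
  proof -
    have "?d / 2 ^ k \<le> ?d / 1" by (intro divide_left_mono) auto
    then show ?thesis using dyadic_floor_dist[of x k] by linarith
  qed
  have g_bd: "\<bar>g k x\<bar> \<le> B * lorentz_prod x" for k x
    unfolding g_eq using fdy[OF dist1[of x k]] mult_nonneg_nonneg[OF B0 less_imp_le[OF lorentz_prod_pos[of x]]] by simp
  have g_meas[measurable]: "g k \<in> borel_measurable borel" for k unfolding g_def by measurable
  have floor_lim: "(\<lambda>k. dyadic_floor k x) \<longlonglongrightarrow> x" for x :: 'a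
  proof -
    have "(\<lambda>k. x - dyadic_floor k x) \<longlonglongrightarrow> 0"
    proof (rule Lim_null_comparison)
      show "eventually (\<lambda>k. norm (x - dyadic_floor k x) \<le> ?d / 2 ^ k) sequentially"
        by (simp add: dyadic_floor_dist)
      have "(\<lambda>k. ?d * (1 / 2) ^ k) \<longlonglongrightarrow> ?d * 0" by (intro tendsto_intros LIMSEQ_realpow_zero) auto
      then show "(\<lambda>k. ?d / 2 ^ k) \<longlonglongrightarrow> 0" by (simp add: power_divide)
    qed
    from tendsto_diff[OF tendsto_const[of x] this] show ?thesis by simp
  qed
  have g_lim: "(\<lambda>k. g k x) \<longlonglongrightarrow> f x" for x
  proof -
    have "isCont f x" using schwartz_continuous[OF f] by (simp add: continuous_on_eq_continuous_at)
    then have "(\<lambda>k. f (dyadic_floor k x)) \<longlonglongrightarrow> f x"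
      using floor_lim by (rule isCont_tendsto_compose)
    moreover have "eventually (\<lambda>k. f (dyadic_floor k x) = g k x) sequentially"
    proof -
      have "eventually (\<lambda>k. norm x + ?d \<le> real k) sequentially"
        using filterlim_real_sequentially by (simp add: filterlim_at_top)
      then show ?thesis
      proof eventually_elim
        case (elim k)
        have "norm (dyadic_floor k x) \<le> real k"
          using norm_triangle_ineq2[of "dyadic_floor k x" x] dist1[of x k] elim by (simp add: norm_minus_commute)
        then have "\<bar>dyadic_floor k x \<bullet> b\<bar> \<le> real k" if "b \<in> Basis" for b
          using Basis_le_norm[OF that, of "dyadic_floor k x"] by linarith
        then have "dyadic_floor k x \<in> J k" by (auto simp: J_def mem_box abs_le_iff minus_le_iff)
        then show ?case by (simp add: g_eq)
      qed
    qed
    ultimately show ?thesis by (rule Lim_transform_eventually)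
  qed
  have lim1: "(\<lambda>k. ext_char (g k)) \<longlonglongrightarrow> ext_char f"
    by (rule ext_char_tendsto_dominated[where C=B]) (use g_bd f_bd g_lim in auto)
  have \<psi>g: "\<psi> (g k x) = (\<Sum>a\<in>J k. indicator (dyadic_cube k a) x *\<^sub>R \<psi> (f a))" for k x
  proof -
    have "(\<Sum>a\<in>J k. indicator (dyadic_cube k a) x *\<^sub>R \<psi> (f a)) = (\<Sum>a\<in>J k. if dyadic_floor k x = a then \<psi> (f a) else 0)"
      by (intro sum.cong refl) (simp add: dyadic_cube_def indicator_def)
    then show ?thesis using J(1)[of k] by (simp add: g_eq \<psi>0)
  qed
  have g_int: "(CLINT x|lborel. \<psi> (g k x)) = (\<Sum>a\<in>J k. \<psi> (f a) / complex_of_real (?D ^ k))" for k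
  proof -
    have int: "integrable lborel (indicator (dyadic_cube k a) :: 'a \<Rightarrow> real)" if "a \<in> J k" for a
      using that J(2)[of k] by (intro integrable_real_indicator) (auto simp: emeasure_dyadic_cube)
    have "(CLINT x|lborel. \<psi> (g k x)) = (\<Sum>a\<in>J k. CLINT x|lborel. indicator (dyadic_cube k a) x *\<^sub>R \<psi> (f a))"
      unfolding \<psi>g by (intro Bochner_Integration.integral_sum integrable_scaleR_left int)
    also have "\<dots> = (\<Sum>a\<in>J k. \<psi> (f a) / complex_of_real (?D ^ k))"
    proof (rule sum.cong[OF refl])
      fix a assume a: "a \<in> J k"
      have "(CLINT x|lborel. indicator (dyadic_cube k a) x *\<^sub>R \<psi> (f a)) = measure lborel (dyadic_cube k a) *\<^sub>R \<psi> (f a)"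
        using int[OF a] by simp
      also have "measure lborel (dyadic_cube k a) = 1 / ?D ^ k"
        using a J(2)[of k] by (intro measure_dyadic_cube) auto
      finally show "(CLINT x|lborel. indicator (dyadic_cube k a) x *\<^sub>R \<psi> (f a)) = \<psi> (f a) / complex_of_real (?D ^ k)"
        by (simp add: scaleR_conv_of_real)
    qed
    finally show ?thesis .
  qed
  \<comment> \<open>Since \<open>\<bar>f\<bar> \<le> B\<close>, one level \<open>K\<close> makes the
    exponential formula valid for all samples at once.\<close>
  obtain K where K: "\<And>k t. k \<ge> K \<Longrightarrow> \<bar>t\<bar> \<le> B \<Longrightarrow> cube_char k t = exp (\<psi> t / complex_of_real (?D ^ k))"
    using root[of B] by blast
  have "exp (CLINT x|lborel. \<psi> (g k x)) = ext_char (g k)" if "k \<ge> K" for k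
  proof -
    have "ext_char (g k) = (\<Prod>a\<in>J k. cube_char k (f a))"
      unfolding g_def by (rule step_char[OF J])
    also have "\<dots> = (\<Prod>a\<in>J k. exp (\<psi> (f a) / complex_of_real (?D ^ k)))"
      by (intro prod.cong refl K that f_B)
    also have "\<dots> = exp (CLINT x|lborel. \<psi> (g k x))"
      unfolding g_int by (rule exp_sum[OF J(1), symmetric])
    finally show ?thesis by simp
  qed
  then have ev: "eventually (\<lambda>k. exp (CLINT x|lborel. \<psi> (g k x)) = ext_char (g k)) sequentially"
    by (auto simp: eventually_sequentially)
  have "(\<lambda>k. CLINT x|lborel. \<psi> (g k x)) \<longlonglongrightarrow> (CLINT x|lborel. \<psi> (f x))"
  proof (rule integral_dominated_convergence[OF _ _ dom])
    show "AE x in lborel. (\<lambda>k. \<psi> (g k x)) \<longlonglongrightarrow> \<psi> (f x)"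
      by (intro AE_I2 isCont_tendsto_compose[OF cont] g_lim)
    show "AE x in lborel. cmod (\<psi> (g k x)) \<le> C * (B + B\<^sup>2) * lorentz_prod x" for k
      by (intro AE_I2 \<psi>_bd g_bd)
  qed simp_all
  then have "(\<lambda>k. exp (CLINT x|lborel. \<psi> (g k x))) \<longlonglongrightarrow> exp (CLINT x|lborel. \<psi> (f x))"
    by (rule tendsto_exp)
  from LIMSEQ_unique[OF lim1 Lim_transform_eventually[OF this ev]]
  show "(CLINT \<omega>|M. iexp (Z f \<omega>)) = exp (CLINT x|lborel. \<psi> (f x))"
    unfolding ext_char_schwartz[OF f] .
qed

lemma noise_stationary_imp_levy_noise: "levy_noise_field M Z"
proof -
  let ?D = "real (dyadic_density TYPE('a))"
  obtain \<psi> C where cont: "\<And>t. isCont \<psi> t" and \<psi>0: "\<psi> 0 = 0" and bd: "\<And>t. cmod (\<psi> t) \<le> C * (\<bar>t\<bar> + t\<^sup>2)"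
    and root: "\<And>T. \<exists>K. \<forall>k\<ge>K. \<forall>t. \<bar>t\<bar> \<le> T \<longrightarrow> cube_char k t = exp (\<psi> t / complex_of_real (?D ^ k))"
    using cube_char_exponent by metis
  have C0: "C \<ge> 0" using order_trans[OF norm_ge_zero bd[of 1]] by simp
  have "?D > 1" by (simp add: dyadic_density_def)
  then have D_lim: "filterlim (\<lambda>k. ?D ^ k) at_top sequentially"
    by (intro filterlim_at_infinity_imp_filterlim_at_top filterlim_realpow_sequentially_gt1 always_eventually) auto
  obtain K1 where K1: "\<And>k t. k \<ge> K1 \<Longrightarrow> \<bar>t\<bar> \<le> 1 \<Longrightarrow> cube_char k t = exp (\<psi> t / complex_of_real (?D ^ k))"
    using root[of 1] by blast
  \<comment> \<open>On \<open>\<bar>t\<bar> \<le> 1\<close> the exponent is at most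
    \<open>2 * C\<close>, so from this level on \<open>exp_rescaled_bound\<close> applies; its
    factor \<open>3\<close> turns \<open>2 * C * \<bar>t\<bar>\<close> into the constant
    \<open>6 * C\<close>.\<close>
  obtain K2 where K2: "\<And>k. k \<ge> K2 \<Longrightarrow> 2 * C \<le> ?D ^ k"
    using D_lim unfolding filterlim_at_top eventually_sequentially by blast
  define K where "K = max K1 K2"
  have "\<exists>b s2 \<nu>. char_triplet b s2 \<nu> \<and> (\<forall>t. \<psi> t = levy_char b s2 \<nu> t)"
  \<comment> \<open>The shift by \<open>K\<close> is needed because the linear bound must hold for
    every index, not just eventually.\<close>
  proof (rule levy_khinchine_limit[where \<mu>="\<lambda>k. cube_distr (k + K)" and N="\<lambda>k. ?D ^ (k + K)" and C="6 * C"])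
    show "real_distribution (cube_distr (k + K))" for k by (rule cube_distr)
    show "0 < ?D ^ (k + K)" for k using \<open>?D > 1\<close> by simp
    fix t :: real
    obtain K' where K': "\<And>k. k \<ge> K' \<Longrightarrow> cube_char k t = exp (\<psi> t / complex_of_real (?D ^ k))"
      using root[of "\<bar>t\<bar>"] by blast
    have "(\<lambda>k. complex_of_real (?D ^ k) * (exp (\<psi> t / complex_of_real (?D ^ k)) - 1)) \<longlonglongrightarrow> \<psi> t"
      by (rule exp_rescaled_tendsto[OF D_lim])
    moreover have "eventually (\<lambda>k. complex_of_real (?D ^ k) * (exp (\<psi> t / complex_of_real (?D ^ k)) - 1)
        = complex_of_real (?D ^ k) * (char (cube_distr k) t - 1)) sequentially"
      unfolding eventually_sequentially using K' cube_distr(2) by (intro exI[of _ K']) simp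
    ultimately have "(\<lambda>k. complex_of_real (?D ^ k) * (char (cube_distr k) t - 1)) \<longlonglongrightarrow> \<psi> t"
      by (rule Lim_transform_eventually)
    from LIMSEQ_ignore_initial_segment[OF this, of K]
    show "(\<lambda>k. complex_of_real (?D ^ (k + K)) * (char (cube_distr (k + K)) t - 1)) \<longlonglongrightarrow> \<psi> t" .
  next
    fix k and t :: real assume t: "\<bar>t\<bar> \<le> 1"
    have "t\<^sup>2 = \<bar>t\<bar> * \<bar>t\<bar>" by (simp add: power2_eq_square)
    also have "\<dots> \<le> \<bar>t\<bar>" using t by (intro mult_left_le) auto
    finally have "t\<^sup>2 \<le> \<bar>t\<bar>" .
    then have "C * (\<bar>t\<bar> + t\<^sup>2) \<le> C * (2 * \<bar>t\<bar>)" using C0 by (intro mult_left_mono) auto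
    then have b1: "cmod (\<psi> t) \<le> 2 * C * \<bar>t\<bar>" using bd[of t] by simp
    also have "\<dots> \<le> 2 * C * 1" using t C0 by (intro mult_left_mono) auto
    also have "\<dots> \<le> ?D ^ (k + K)" using K2[of "k + K"] by (simp add: K_def)
    finally have "cmod (\<psi> t) \<le> ?D ^ (k + K)" .
    then have "cmod (complex_of_real (?D ^ (k + K)) * (exp (\<psi> t / complex_of_real (?D ^ (k + K))) - 1)) \<le> 3 * cmod (\<psi> t)"
      using \<open>?D > 1\<close> by (intro exp_rescaled_bound) auto
    also have "\<dots> \<le> 6 * C * \<bar>t\<bar>" using b1 by simp
    also have "exp (\<psi> t / complex_of_real (?D ^ (k + K))) = char (cube_distr (k + K)) t"
      using K1[of "k + K" t] t cube_distr(2) by (simp add: K_def)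
    finally show "cmod (complex_of_real (?D ^ (k + K)) * (char (cube_distr (k + K)) t - 1)) \<le> 6 * C * \<bar>t\<bar>" .
  qed
  then obtain b s2 \<nu> where L: "char_triplet b s2 \<nu>" "\<psi> = levy_char b s2 \<nu>" by blast
  show ?thesis
    unfolding levy_noise_field_def
    using L schwartz_char_eq_exp[OF cont \<psi>0 bd root] by blast
qed

end

end

theorem theorem3p6:
  fixes M :: "'w measure" and Z :: "('a::euclidean_space \<Rightarrow> real) \<Rightarrow> 'w \<Rightarrow> real"
  assumes "prob_space M"
    and "gen_random_field M Z"
    and "triple_continuous M Z schwartz"
    and "\<exists>Z'. triple_extension M Z Z' \<and> (\<forall>f\<in>L12. integrable M (Z' f))"
  shows "levy_noise_field M Z \<longleftrightarrow> noise_field M Z \<and> stationary_field M Z"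
proof -
  obtain Z' where ext: "triple_extension M Z Z'" using assms(4) by blast
  show ?thesis
  proof
    assume L: "levy_noise_field M Z"
    show "noise_field M Z \<and> stationary_field M Z"
      using levy_noise_imp_noise[OF assms(1,2) L] levy_noise_imp_stationary[OF assms(1,2) L] ..
  next
    assume "noise_field M Z \<and> stationary_field M Z"
    then show "levy_noise_field M Z"
      using noise_stationary_imp_levy_noise[OF assms(1,2) ext] by (elim conjE)
  qed
qed

end
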